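(* Fix $T>0$, $\varepsilon>0$, $\sigma\in(0,1)$, and let $V_1$ satisfy (V1) and $\operatorname{supp}V_1\subset B_1$. Let $\mathcal N$ be either $\mathcal N_1$ or $\mathcal N_2$. Suppose $\rho_0\in\mathcal P_2(\mathbb R^d)$ satisfies $\mathcal H^\varepsilon_\sigma[\rho_0]<+\infty$. Then there exists a weak measure solution $\rho^\varepsilon$ on $[0,T]$ of $$\partial_t\rho=(1-\sigma)\nabla\cdot\big(\rho\,\nabla V_\varepsilon*\log((1-\sigma)V_\varepsilon*\rho+\sigma\mathcal N)\big)$$ such that $\rho^\varepsilon(0)=\rho_0$.
   Context: $\mathcal P_2(\mathbb R^d)$ is the set of Borel probability measures on $\mathbb R^d$ with finite second moment, equipped with the 2-Wasserstein distance $d_W$. $B_R$ is the closed ball of radius $R$ centred at $0$. $\langle x\rangle:=\sqrt{1+|x|^2}$. For $p=1,2$, $\mathcal N_p(x):=Z^{-1}\exp(-\langle x\rangle^p)$ with $Z$ the normalising constant so that $\int\mathcal N_p\,dx=1$. (V1): $V_1\in C_b(\mathbb R^d)\cap C^1(\mathbb R^d)$, $V_1\ge0$, $\|V_1\|_{L^1}=1$, $V_1(x)=V_1(-x)$. For $\varepsilon>0$, $V_\varepsilon(x):=\varepsilon^{-d}V_1(x/\varepsilon)$. For $\rho\in\mathcal P_2(\mathbb R^d)$, $\mathcal H^\varepsilon_\sigma[\rho]:=\int_{\mathbb R^d}((1-\sigma)V_\varepsilon*\rho+\sigma\mathcal N)\log((1-\sigma)V_\varepsilon*\rho+\sigma\mathcal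 N)\,dx$. Weak measure solution: an absolutely continuous curve $\rho:[0,T]\to(\mathcal P_2(\mathbb R^d),d_W)$ such that for every $\varphi\in C^1_c(\mathbb R^d)$ and every $t\in[0,T]$, $$\int\varphi\,d\rho_t-\int\varphi\,d\rho_0=-(1-\sigma)\int_0^t\int_{\mathbb R^d}\nabla\varphi(x)\cdot\nabla V_\varepsilon*[\log((1-\sigma)V_\varepsilon*\rho_s+\sigma\mathcal N)](x)\,d\rho_s(x)\,ds .$$ *)

theory Defs
  imports "HOL-Probability.Probability"
begin

definition supp :: "('a::euclidean_space \<Rightarrow> real) \<Rightarrow> 'a set" where
  "supp f = closure {x. f x \<noteq> 0}"

definition grad :: "('a::euclidean_space \<Rightarrow> real) \<Rightarrow> 'a \<Rightarrow> 'a" where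
  "grad f x = (THE D. GDERIV f x :> D)"

definition C1 :: "('a::euclidean_space \<Rightarrow> real) set" where
  "C1 = {f. \<exists>g. (\<forall>x. GDERIV f x :> g x) \<and> continuous_on UNIV g}"

definition C1c :: "('a::euclidean_space \<Rightarrow> real) set" where
  "C1c = {f \<in> C1. compact (supp f)}"

definition P2 :: "'a::euclidean_space measure set" where
  "P2 = {\<mu>. prob_space \<mu> \<and> sets \<mu> = sets borel \<and> (\<integral>\<^sup>+x. ennreal ((norm x)\<^sup>2) \<partial>\<mu>) < \<infinity>}"

definition couplings ::
    "'a::euclidean_space measure \<Rightarrow> 'a measure \<Rightarrow> ('a \<times> 'a) measure set" where
  "couplings \<mu> \<nu> =
    {\<gamma>. sets \<gamma> = sets borel \<and> distr \<gamma> borel fst = \<mu> \<and> distr \<gamma> borel snd = \<nu>}"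

(* The infimum is taken in ennreal; it is finite for measures in P2, so enn2real loses nothing there. *)
definition wasserstein2 :: "'a::euclidean_space measure \<Rightarrow> 'a measure \<Rightarrow> real" where
  "wasserstein2 \<mu> \<nu> =
    sqrt (enn2real (INF \<gamma>\<in>couplings \<mu> \<nu>. \<integral>\<^sup>+z. ennreal ((dist (fst z) (snd z))\<^sup>2) \<partial>\<gamma>))"

(* Absolute continuity of a metric-space-valued curve c : [0,T] -> (X,d) in the sense of
   Ambrosio-Gigli-Savare: d (c s) (c t) is bounded by the integral over [s,t] of some m in L^1(0,T). *)
definition abs_cont_curve ::
    "('b \<Rightarrow> 'b \<Rightarrow> real) \<Rightarrow> 'b set \<Rightarrow> real \<Rightarrow> (real \<Rightarrow> 'b) \<Rightarrow> bool" where
  "abs_cont_curve d X T c \<longleftrightarrow>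
    (\<forall>t\<in>{0..T}. c t \<in> X) \<and>
    (\<exists>m::real \<Rightarrow> real. set_integrable lborel {0..T} m \<and>
      (\<forall>s t. 0 \<le> s \<and> s \<le> t \<and> t \<le> T \<longrightarrow>
        d (c s) (c t) \<le> (LINT r:{s..t}|lborel. m r)))"

definition japanese :: "'a::euclidean_space \<Rightarrow> real" where
  "japanese x = sqrt (1 + (norm x)\<^sup>2)"

definition Nref :: "nat \<Rightarrow> 'a::euclidean_space \<Rightarrow> real" where
  "Nref p x = exp (- (japanese x ^ p)) / (LINT y|(lborel :: 'a measure). exp (- (japanese y ^ p)))"

definition V1_cond :: "('a::euclidean_space \<Rightarrow> real) \<Rightarrow> bool" where
  "V1_cond V \<longleftrightarrow>
    V \<in> bcontfun \<and> V \<in> C1 \<and> (\<forall>x. V x \<ge> 0) \<and>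
    integrable lborel V \<and> (LINT x|lborel. \<bar>V x\<bar>) = 1 \<and> (\<forall>x. V x = V (- x))"

definition rescale :: "real \<Rightarrow> ('a::euclidean_space \<Rightarrow> real) \<Rightarrow> 'a \<Rightarrow> real" where
  "rescale \<epsilon> V x = (1 / \<epsilon>) ^ DIM('a) * V (x /\<^sub>R \<epsilon>)"

definition conv_measure ::
    "('a::euclidean_space \<Rightarrow> real) \<Rightarrow> 'a measure \<Rightarrow> 'a \<Rightarrow> real" where
  "conv_measure V \<mu> x = (LINT y|\<mu>. V (x - y))"

definition conv_vec :: "('a::euclidean_space \<Rightarrow> 'a) \<Rightarrow> ('a \<Rightarrow> real) \<Rightarrow> 'a \<Rightarrow> 'a" where
  "conv_vec K g x = (LINT y|lborel. g y *\<^sub>R K (x - y))"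

definition mixture ::
    "('a::euclidean_space \<Rightarrow> real) \<Rightarrow> ('a \<Rightarrow> real) \<Rightarrow> real \<Rightarrow> real \<Rightarrow> 'a measure \<Rightarrow> 'a \<Rightarrow> real" where
  "mixture V N \<sigma> \<epsilon> \<mu> x = (1 - \<sigma>) * conv_measure (rescale \<epsilon> V) \<mu> x + \<sigma> * N x"

(* Extended-real-valued integral, positive part minus negative part: ennreal sends negative
   reals to 0. In ereal, infinity - infinity = infinity. *)
definition ext_integral :: "'a measure \<Rightarrow> ('a \<Rightarrow> real) \<Rightarrow> ereal" where
  "ext_integral M f =
    enn2ereal (\<integral>\<^sup>+x. ennreal (f x) \<partial>M) - enn2ereal (\<integral>\<^sup>+x. ennreal (- f x) \<partial>M)"

definition entropy_functional ::
    "('a::euclidean_space \<Rightarrow> real) \<Rightarrow> ('a \<Rightarrow> real) \<Rightarrow> real \<Rightarrow> real \<Rightarrow> 'a measure \<Rightarrow> ereal" where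
  "entropy_functional V N \<sigma> \<epsilon> \<mu> =
    ext_integral lborel (\<lambda>x. mixture V N \<sigma> \<epsilon> \<mu> x * ln (mixture V N \<sigma> \<epsilon> \<mu> x))"

definition weak_measure_solution ::
    "('a::euclidean_space \<Rightarrow> real) \<Rightarrow> ('a \<Rightarrow> real) \<Rightarrow> real \<Rightarrow> real \<Rightarrow> real
      \<Rightarrow> (real \<Rightarrow> 'a measure) \<Rightarrow> bool" where
  "weak_measure_solution V N \<sigma> \<epsilon> T \<rho> \<longleftrightarrow>
    abs_cont_curve wasserstein2 P2 T \<rho> \<and>
    (\<forall>\<phi>\<in>C1c. \<forall>t\<in>{0..T}.
      (LINT x|\<rho> t. \<phi> x) - (LINT x|\<rho> 0. \<phi> x) =
      - (1 - \<sigma>) * (LINT s:{0..t}|lborel.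
          (LINT x|\<rho> s.
            grad \<phi> x \<bullet>
              conv_vec (grad (rescale \<epsilon> V)) (\<lambda>y. ln (mixture V N \<sigma> \<epsilon> (\<rho> s) y)) x)))"

end

theory Submission
  imports Defs "HOL-Library.Diagonal_Subsequence"
begin

text \<open>
  The equation is the 2-Wasserstein gradient flow of the mollified entropy. For a finite system
  of particles this entropy is a differentiable function of the positions, and the implicit
  Euler scheme (minimizing movements) gives positions whose Euler--Lagrange equations are a
  time-discrete weak formulation. Since the mixture is bounded, the entropy is bounded above by
  a constant for every measure, and it is bounded below by an arbitrarily small multiple of the
  second moment. So the scheme has uniform bounds on second moments and on the total squared
  displacement, also for the Gaussian reference measure, where the velocity grows
  quadratically. Prokhorov's theorem and the uniform Hoelder estimate give a limit curve of
  measures, the drift term passes to weak limits, and absolute continuity of the curve follows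
  from a Mazur-type limit of the discrete metric speeds.
\<close>

section \<open>Prokhorov's theorem in Euclidean space\<close>

text \<open>Two features of the equation shape the argument. The logarithm of the mixture is
  unbounded where \<open>N\<close> decays, but both \<open>gW\<close> and the gradient of a test
  function have compact support, so the weak form sees it only on a fixed ball, where
  \<open>\<sigma> * N\<close> has a positive minimum. And the energy bounds must ignore the tails of
  \<open>N\<close>: the energy is taken relative to that of \<open>\<sigma> * N\<close>, and adding
  \<open>a \<ge> 0\<close> to \<open>b > 0\<close> changes \<open>ent\<close> by at least
  \<open>a * ln a - a\<close> and at most \<open>a * ln M\<close>, if \<open>a + b \<le> M\<close>;
  \<open>b\<close> itself has disappeared. To bound \<open>a * ln a\<close> below, a weight
  \<open>\<delta> * (norm y)^2\<close> with arbitrarily small \<open>\<delta>\<close> is enough,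
  since its negative exponential is integrable; hence the small multiple of the second moment.
  Particles carry fixed labels, so each Euler step minimizes over finitely many vectors, with the
  labelled squared displacement as penalty. All bounds are uniform in the weights and in the number
  of particles, which lets particles and time step be refined together by one index. Distances
  between measures are only ever bounded from above, by explicit couplings.\<close>

definition tri :: "real \<Rightarrow> real" where
  "tri t = arccos (cos (pi * t)) / pi"

text \<open>\<open>tri\<close> is the even triangle wave of period 2, the distance to the nearest
  even integer; through \<open>arccos\<close> its continuity and periodicity need no case
  distinction. \<open>plateau\<close> is Schoenberg's function: 0 on [0, 1/3], 1 on [2/3, 1], linear
  between, again even with period 2.\<close>

definition plateau :: "real \<Rightarrow> real" where
  "plateau t = min 1 (max 0 (3 * tri t - 1))"

lemma tri_eq: "0 \<le> t \<Longrightarrow> t \<le> 1 \<Longrightarrow> tri t = t"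
  unfolding tri_def by (subst arccos_cos) auto

lemma tri_shift: "tri (t + 2 * real k) = tri t"
proof -
  have "cos (pi * (t + 2 * real k)) = cos (pi * t + 2 * real k * pi)"
    by (simp add: algebra_simps)
  also have "\<dots> = cos (pi * t)"
    unfolding cos_add cos_2npi sin_2npi by simp
  finally show ?thesis by (simp add: tri_def)
qed

lemma continuous_on_tri: "continuous_on S tri"
  unfolding tri_def by (intro continuous_intros) auto

lemma continuous_on_plateau: "continuous_on S plateau"
  unfolding plateau_def by (intro continuous_intros continuous_on_tri)

lemma plateau_shift: "plateau (t + 2 * real k) = plateau t"
  by (simp add: plateau_def tri_shift)

lemma plateau_bounds: "0 \<le> plateau t" "plateau t \<le> 1"
  by (auto simp: plateau_def)

lemma plateau_eq_0: "0 \<le> t \<Longrightarrow> t \<le> 1/3 \<Longrightarrow> plateau t = 0"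
  by (simp add: plateau_def tri_eq)

lemma plateau_eq_1: "2/3 \<le> t \<Longrightarrow> t \<le> 1 \<Longrightarrow> plateau t = 1"
  by (simp add: plateau_def tri_eq)

text \<open>Digit \<open>k\<close> has weight \<open>(1/2) ^ Suc k\<close>. The floor form makes it
  a Borel function of \<open>u\<close>, on which the measurability of the section of the
  space-filling curve rests.\<close>

definition binary_digit :: "real \<Rightarrow> nat \<Rightarrow> real" where
  "binary_digit u k = of_int \<lfloor>2 ^ Suc k * u\<rfloor> - 2 * of_int \<lfloor>2 ^ k * u\<rfloor>"

lemma binary_digit_cases: "binary_digit u k = 0 \<or> binary_digit u k = 1"
proof -
  define x where "x = 2 ^ k * u"
  have "\<lfloor>2 * x\<rfloor> = 2 * \<lfloor>x\<rfloor> \<or> \<lfloor>2 * x\<rfloor> = 2 * \<lfloor>x\<rfloor> + 1"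
    by linarith
  then show ?thesis
    by (auto simp: binary_digit_def x_def mult.assoc)
qed

lemma binary_digit_sums:
  assumes "0 \<le> u" "u < 1"
  shows "(\<lambda>k. (1/2) ^ Suc k * binary_digit u k) sums u"
proof -
  \<comment> \<open>The sum telescopes to \<open>u\<close> truncated after \<open>n\<close> binary
    digits.\<close>
  have ps: "(\<Sum>k<n. (1/2) ^ Suc k * binary_digit u k) = of_int \<lfloor>2 ^ n * u\<rfloor> / 2 ^ n" for n
  proof (induction n)
    case 0
    then show ?case using assms by (simp add: floor_eq_iff)
  next
    case (Suc n)
    then show ?case
      by (simp add: binary_digit_def field_simps power_divide)
  qed
  have "(\<lambda>n. of_int \<lfloor>2 ^ n * u\<rfloor> / 2 ^ n) \<longlonglongrightarrow> u"
  proof (rule tendsto_sandwich)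
    show "\<forall>\<^sub>F n in sequentially. u - (1/2)^n \<le> of_int \<lfloor>2 ^ n * u\<rfloor> / 2 ^ n"
    proof (intro always_eventually allI)
      fix n
      have "2 ^ n * u - 1 \<le> of_int \<lfloor>2 ^ n * u\<rfloor>" by linarith
      then have "(2 ^ n * u - 1) / 2 ^ n \<le> of_int \<lfloor>2 ^ n * u\<rfloor> / 2 ^ n"
        by (rule divide_right_mono) simp
      then show "u - (1/2)^n \<le> of_int \<lfloor>2 ^ n * u\<rfloor> / 2 ^ n"
        by (simp add: diff_divide_distrib power_divide)
    qed
    show "\<forall>\<^sub>F n in sequentially. of_int \<lfloor>2 ^ n * u\<rfloor> / 2 ^ n \<le> u"
      by (intro always_eventually allI) (simp add: field_simps)
    have "(\<lambda>n. u - (1/2)^n) \<longlonglongrightarrow> u - 0"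
      by (intro tendsto_intros LIMSEQ_power_zero) auto
    then show "(\<lambda>n. u - (1/2)^n) \<longlonglongrightarrow> u" by simp
  qed auto
  then show ?thesis
    unfolding sums_def ps .
qed

text \<open>For digits 0 and 1 this is the point of the Cantor set with ternary digits
  \<open>2 * a m\<close>. Avoiding the ternary digit 1 keeps every shifted tail in [0, 1/3] or
  [2/3, 1], where \<open>plateau\<close> is constant.\<close>

definition ternary :: "(nat \<Rightarrow> real) \<Rightarrow> real" where
  "ternary a = (\<Sum>m. 2 * a m * (1/3) ^ Suc m)"

lemma ternary_summable:
  assumes "\<And>m. a m = 0 \<or> a m = (1::real)"
  shows "summable (\<lambda>m. 2 * a m * (1/3) ^ Suc m)"
proof (rule summable_comparison_test')
  show "summable (\<lambda>m. 2 * (1/3::real) ^ Suc m)"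
    by (intro summable_mult) (simp add: summable_geometric)
  show "norm (2 * a m * (1/3) ^ Suc m) \<le> 2 * (1/3) ^ Suc m" if "0 \<le> m" for m
    using assms[of m] by auto
qed

lemma ternary_bounds:
  assumes "\<And>m. a m = 0 \<or> a m = (1::real)"
  shows "0 \<le> ternary a" "ternary a \<le> 1"
proof -
  show "0 \<le> ternary a"
    unfolding ternary_def
    by (intro suminf_nonneg ternary_summable assms) (metis assms mult_nonneg_nonneg power_one_over zero_le_divide_1_iff zero_le_numeral zero_le_one zero_le_power order_refl)
  have s: "(\<lambda>m. 2 * (1/3::real) ^ Suc m) sums 1"
    using sums_mult[OF geometric_sums[of "1/3::real"], of "2/3"] by (simp add: field_simps)
  have "ternary a \<le> (\<Sum>m. 2 * (1/3::real) ^ Suc m)"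
    unfolding ternary_def
  proof (rule suminf_le)
    show "2 * a m * (1/3) ^ Suc m \<le> 2 * (1/3) ^ Suc m" for m
      using assms[of m] by auto
  qed (use ternary_summable[OF assms] s in \<open>auto simp: sums_iff\<close>)
  then show "ternary a \<le> 1"
    using s by (simp add: sums_iff)
qed

lemma ternary_rec:
  assumes "\<And>m. a m = 0 \<or> a m = (1::real)"
  shows "3 * ternary a = 2 * a 0 + ternary (\<lambda>m. a (Suc m))"
proof -
  have "(\<Sum>m. 2 * a (Suc m) * (1/3) ^ Suc (Suc m)) = ternary a - 2 * a 0 * (1/3)"
    using suminf_split_head[OF ternary_summable[OF assms]] by (simp add: ternary_def)
  moreover have "(\<Sum>m. 2 * a (Suc m) * (1/3) ^ Suc (Suc m))
      = (1/3) * ternary (\<lambda>m. a (Suc m))"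
  proof -
    have "summable (\<lambda>m. 2 * a (Suc m) * (1/3) ^ Suc m)"
      by (rule ternary_summable) (rule assms)
    from suminf_mult[OF this, of "1/3"] show ?thesis
      by (simp add: ternary_def mult_ac)
  qed
  ultimately show ?thesis by simp
qed

text \<open>Multiplying by \<open>3 ^ n\<close> shifts the ternary expansion. Every digit is even,
  so the part moved to the left of the point is an even integer and the period 2 removes it; the
  first remaining digit decides on which flat part the rest lies.\<close>

lemma plateau_ternary:
  assumes a: "\<And>m. a m = 0 \<or> a m = (1::real)"
  shows "plateau (3 ^ n * ternary a) = a n"
proof -
  have "\<exists>k::nat. 3 ^ n * ternary a = ternary (\<lambda>m. a (n + m)) + 2 * real k"
  proof (induction n)
    case 0
    then show ?case by (intro exI[of _ 0]) simp
  next
    case (Suc n)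
    then obtain k :: nat where k: "3 ^ n * ternary a = ternary (\<lambda>m. a (n + m)) + 2 * real k"
      by blast
    have "3 ^ Suc n * ternary a = 3 * ternary (\<lambda>m. a (n + m)) + 2 * real (3 * k)"
      using k by simp
    also have "3 * ternary (\<lambda>m. a (n + m)) = 2 * a n + ternary (\<lambda>m. a (Suc n + m))"
      using ternary_rec[of "\<lambda>m. a (n + m)"] a by simp
    finally have *: "3 ^ Suc n * ternary a = ternary (\<lambda>m. a (Suc n + m)) + 2 * (a n + real (3 * k))"
      by simp
    show ?case
    proof (cases "a n = 0")
      case True
      then show ?thesis using * by (intro exI[of _ "3 * k"]) simp
    next
      case False
      then show ?thesis using * a[of n] by (intro exI[of _ "3 * k + 1"]) simp
    qed
  qed
  then obtain k :: nat where k: "3 ^ n * ternary a = ternary (\<lambda>m. a (n + m)) + 2 * real k"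
    by blast
  have r: "3 * ternary (\<lambda>m. a (n + m)) = 2 * a n + ternary (\<lambda>m. a (Suc n + m))"
    using ternary_rec[of "\<lambda>m. a (n + m)"] a by simp
  have b: "0 \<le> ternary (\<lambda>m. a (Suc n + m))" "ternary (\<lambda>m. a (Suc n + m)) \<le> 1"
    using a by (auto intro!: ternary_bounds)
  have "plateau (ternary (\<lambda>m. a (n + m))) = a n"
    using a[of n] r b by (auto intro!: plateau_eq_0 plateau_eq_1)
  then show ?thesis
    by (simp add: k plateau_shift)
qed

text \<open>Coordinate \<open>j\<close> reads the positions congruent to \<open>j\<close> modulo
  \<open>d\<close>, so that one parameter interleaves \<open>d\<close> binary expansions.\<close>

definition curve_coord :: "nat \<Rightarrow> nat \<Rightarrow> real \<Rightarrow> real" where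
  "curve_coord d j t = (\<Sum>k. (1/2) ^ Suc k * plateau (3 ^ (d * k + j) * t))"

lemma continuous_on_curve_coord: "continuous_on UNIV (curve_coord d j)"
proof -
  have "uniform_limit UNIV (\<lambda>n t. \<Sum>k<n. (1/2) ^ Suc k * plateau (3 ^ (d * k + j) * t))
      (curve_coord d j) sequentially"
    unfolding curve_coord_def
  proof (rule Weierstrass_m_test)
    show "norm ((1/2) ^ Suc n * plateau (3 ^ (d * n + j) * x)) \<le> (1/2) ^ Suc n" for n x
      using plateau_bounds[of "3 ^ (d * n + j) * x"] by (simp add: mult_left_le abs_mult)
    show "summable (\<lambda>n. (1/2::real) ^ Suc n)"
      by (simp add: summable_geometric)
  qed
  then show ?thesis
    by (rule uniform_limit_theorem[rotated])
      (auto intro!: always_eventually continuous_intros continuous_on_compose2[OF continuous_on_plateau])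
qed

lemma curve_coord_shift: "curve_coord d j (t + 2 * real k) = curve_coord d j t"
proof -
  have "plateau (3 ^ n * (t + 2 * real k)) = plateau (3 ^ n * t)" for n
    using plateau_shift[of "3 ^ n * t" "3 ^ n * k"] by (simp add: algebra_simps)
  then show ?thesis by (simp add: curve_coord_def)
qed

text \<open>A space-filling curve after Schoenberg: the ternary digits of the parameter list the
  binary digits of all coordinates, and the flat parts of \<^const>\<open>plateau\<close> recover them.
  Dilating by the radius \<open>2k+1\<close> on \<open>[2k, 2k+1]\<close> covers the whole space.\<close>

lemma space_filling_section:
  obtains f :: "real \<Rightarrow> 'a::euclidean_space" and \<psi> :: "'a \<Rightarrow> real" where
    "continuous_on UNIV f" "\<psi> \<in> borel_measurable borel" "\<And>x. f (\<psi> x) = x"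
    "\<And>x. \<bar>\<psi> x\<bar> \<le> 2 * norm x + 3"
proof -
  obtain e :: "'a \<Rightarrow> nat" where e: "bij_betw e Basis {0..<DIM('a)}"
    using ex_bij_betw_finite_nat[OF finite_Basis] by blast
  define d where "d = DIM('a)"
  have d: "d > 0" by (simp add: d_def)
  \<comment> \<open>At a parameter \<open>\<psi> x\<close> the factor \<open>t + 1 - tri t\<close>
    equals \<open>2 * R x + 1\<close>, because the shift \<open>2 * R x\<close> is even; it is a
    continuous substitute for reading off the integer part of \<open>t\<close>.\<close>
  define f where
    "f t = (t + 1 - tri t) *\<^sub>R (\<Sum>b\<in>Basis. (2 * curve_coord d (e b) t - 1) *\<^sub>R (b::'a))" for t
  define R where "R x = real_of_int \<lceil>norm x\<rceil>" for x :: 'a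
  \<comment> \<open>Affine image of the coordinate in the unit interval. As \<open>R x\<close>
    bounds the norm, the endpoint 1 is never reached, as the binary expansion requires.\<close>
  define u where "u x b = (x \<bullet> b / (2 * R x + 1) + 1) / 2" for x b :: 'a
  \<comment> \<open>The basis vector whose digit sits at position \<open>m\<close> of the
    interleaved sequence; \<open>m div d\<close> is the index of that digit.\<close>
  define B where "B m = inv_into Basis e (m mod d)" for m
  define A where "A x m = binary_digit (u x (B m)) (m div d)" for x m
  define \<psi> where "\<psi> x = ternary (A x) + 2 * R x" for x
  have R: "R x \<ge> norm x" "R x \<ge> 0" "R x \<le> norm x + 1" for x
    unfolding R_def using norm_ge_zero[of x] by linarith+
  have A01: "A x m = 0 \<or> A x m = 1" for x m
    unfolding A_def by (rule binary_digit_cases)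
  have u01: "0 \<le> u x b" "u x b < 1" if "b \<in> Basis" for x b
  proof -
    have "\<bar>x \<bullet> b\<bar> < 2 * R x + 1"
      using Basis_le_norm[OF that, of x] R[of x] by linarith
    moreover have p: "2 * R x + 1 > 0" using R[of x] by linarith
    ultimately have "-1 < x \<bullet> b / (2 * R x + 1)" "x \<bullet> b / (2 * R x + 1) < 1"
      by (auto simp: field_simps)
    then show "0 \<le> u x b" "u x b < 1" by (auto simp: u_def)
  qed
  have coord: "curve_coord d (e b) (\<psi> x) = u x b" if b: "b \<in> Basis" for x b
  proof -
    have eb: "e b < d" using e b by (auto simp: bij_betw_def d_def)
    have inv: "inv_into Basis e (e b) = b"
      using e b by (simp add: bij_betw_def inv_into_f_f)
    have RR: "R x = real (nat \<lceil>norm x\<rceil>)" by (simp add: R_def)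
    have "curve_coord d (e b) (\<psi> x) = curve_coord d (e b) (ternary (A x))"
      unfolding \<psi>_def RR by (rule curve_coord_shift)
    also have "\<dots> = (\<Sum>k. (1/2) ^ Suc k * A x (d * k + e b))"
      unfolding curve_coord_def plateau_ternary[OF A01] ..
    also have "\<dots> = (\<Sum>k. (1/2) ^ Suc k * binary_digit (u x b) k)"
      using d eb by (simp add: A_def B_def inv mult.commute)
    also have "\<dots> = u x b"
      using binary_digit_sums[OF u01[OF b]] by (simp add: sums_iff)
    finally show ?thesis .
  qed
  have scale: "\<psi> x + 1 - tri (\<psi> x) = 2 * R x + 1" for x
  proof -
    have RR: "R x = real (nat \<lceil>norm x\<rceil>)" by (simp add: R_def)
    have "tri (\<psi> x) = tri (ternary (A x))"
      unfolding \<psi>_def RR by (rule tri_shift)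
    also have "\<dots> = ternary (A x)"
      by (intro tri_eq ternary_bounds A01)
    finally show ?thesis by (simp add: \<psi>_def)
  qed
  show ?thesis
  proof
    show "continuous_on UNIV f"
      unfolding f_def by (intro continuous_intros continuous_on_tri continuous_on_curve_coord)
    have [measurable]: "R \<in> borel_measurable borel"
      unfolding R_def by measurable
    have [measurable]: "(\<lambda>x. A x m) \<in> borel_measurable borel" for m
      unfolding A_def binary_digit_def u_def by measurable
    show "\<psi> \<in> borel_measurable borel"
      unfolding \<psi>_def ternary_def by measurable
    show "f (\<psi> x) = x" for x
    proof -
      have p: "2 * R x + 1 > 0" using R[of x] by linarith
      have "f (\<psi> x) = (2 * R x + 1) *\<^sub>R (\<Sum>b\<in>Basis. (2 * u x b - 1) *\<^sub>R b)"
        unfolding f_def scale by (simp add: coord)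
      also have "\<dots> = (\<Sum>b\<in>Basis. (x \<bullet> b) *\<^sub>R b)"
      proof -
        have "(2 * R x + 1) * (2 * u x b - 1) = x \<bullet> b" for b
          using p by (simp add: u_def field_simps del: times_divide_eq_left)
        then show ?thesis by (simp add: scaleR_sum_right)
      qed
      finally show ?thesis by (simp add: euclidean_representation)
    qed
    show "\<bar>\<psi> x\<bar> \<le> 2 * norm x + 3" for x
      using ternary_bounds[of "A x"] A01 R[of x] by (simp add: \<psi>_def)
  qed
qed

section \<open>Weak convergence of probability measures\<close>

definition weak_lim :: "(nat \<Rightarrow> 'a::topological_space measure) \<Rightarrow> 'a measure \<Rightarrow> bool" where
  "weak_lim M L \<longleftrightarrow> (\<forall>f :: 'a \<Rightarrow> real. continuous_on UNIV f \<longrightarrow> bounded (range f) \<longrightarrow>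
    (\<lambda>n. LINT x|M n. f x) \<longlonglongrightarrow> (LINT x|L. f x))"

lemma weak_limD:
  "weak_lim M L \<Longrightarrow> continuous_on UNIV f \<Longrightarrow> (\<And>x. \<bar>f x\<bar> \<le> B) \<Longrightarrow>
    (\<lambda>n. LINT x|M n. f x) \<longlonglongrightarrow> (LINT x|L. (f x :: real))"
  by (auto simp: weak_lim_def bounded_iff)

text \<open>The Borel section \<open>\<psi>\<close> moves the measures to the real line, where tight
  sequences have weakly convergent subsequences, and the continuous \<open>f\<close> carries the
  limit back. For bounded continuous \<open>g\<close>, the integral of \<open>g\<close> against
  \<open>M n\<close> is that of \<open>g o f\<close> against the image measure because
  \<open>f (\<psi> x) = x\<close>, and \<open>g o f\<close> is bounded and continuous whatever the
  regularity of \<open>\<psi>\<close>.\<close>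

theorem prokhorov:
  fixes M :: "nat \<Rightarrow> 'a::euclidean_space measure"
  assumes M: "\<And>n. prob_space (M n)" "\<And>n. sets (M n) = sets borel"
    and C: "\<And>n. (\<integral>\<^sup>+x. ennreal ((norm x)\<^sup>2) \<partial>M n) \<le> ennreal C"
  obtains r L where "strict_mono (r :: nat \<Rightarrow> nat)" "prob_space L" "sets L = sets borel"
    "weak_lim (M \<circ> r) L"
proof -
  obtain f :: "real \<Rightarrow> 'a" and \<psi> where f: "continuous_on UNIV f" "\<And>x. f (\<psi> x) = x"
    and \<psi>_meas: "\<psi> \<in> borel_measurable borel"
    and \<psi>: "\<And>x. \<bar>\<psi> x\<bar> \<le> 2 * norm x + 3"
    by (rule space_filling_section) blast
  have f_meas: "f \<in> borel_measurable borel"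
    using f(1) by (rule borel_measurable_continuous_onI)
  have \<psi>_meas': "\<psi> \<in> measurable (M n) borel" for n
    by (subst measurable_cong_sets[OF M(2) refl]) (rule \<psi>_meas)
  define \<mu> where "\<mu> n = distr (M n) borel \<psi>" for n
  have rd: "real_distribution (\<mu> n)" for n
  proof -
    interpret prob_space "M n" by (rule M)
    show ?thesis
      unfolding real_distribution_def real_distribution_axioms_def \<mu>_def
      using \<psi>_meas' by (auto intro!: prob_space_distr)
  qed
  have tight: "tight \<mu>"
    unfolding tight_def
  proof (intro conjI allI impI rd)
    fix \<epsilon> :: real assume \<epsilon>: "\<epsilon> > 0"
    \<comment> \<open>\<open>C\<close> may be negative, and then \<open>ennreal C\<close> is 0.
      \<open>D\<close> is positive and strictly above \<open>C\<close>, so that the Markov bound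
      with radius \<open>K\<close> is strictly below \<open>\<epsilon>\<close>.\<close>
    define D where "D = max C 0 + 1"
    have D: "D > 0" "C < D" by (auto simp: D_def)
    define K where "K = sqrt (D / \<epsilon>)"
    have K: "K > 0" "K\<^sup>2 = D / \<epsilon>" using D \<epsilon> by (auto simp: K_def)
    \<comment> \<open>Where \<open>norm x < K\<close> the section is bounded by
      \<open>2 * K + 3\<close> in absolute value, hence lies strictly inside the interval.\<close>
    define b where "b = 2 * K + 4"
    have "measure (\<mu> n) {-b<..b} > 1 - \<epsilon>" for n
    proof -
      interpret prob_space "M n" by (rule M)
      note [simp] = M(2)[of n] sets_eq_imp_space_eq[OF M(2)[of n]]
      have nm: "(\<lambda>x. ennreal ((norm x)\<^sup>2)) \<in> borel_measurable (M n)"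
        by (subst measurable_cong_sets[OF M(2) refl]) measurable
      have "emeasure (M n) {x\<in>space (M n). ennreal (1 / K\<^sup>2) * ennreal ((norm x)\<^sup>2) \<ge> 1}
          \<le> ennreal (1 / K\<^sup>2) * (\<integral>\<^sup>+x. ennreal ((norm x)\<^sup>2) * indicator (space (M n)) x \<partial>M n)"
        using nm nn_integral_Markov_inequality[of "\<lambda>x. ennreal ((norm x)\<^sup>2)" "space (M n)" "M n" "ennreal (1 / K\<^sup>2)"]
        by auto
      also have "\<dots> \<le> ennreal (1 / K\<^sup>2) * ennreal C"
        using C[of n] by (intro mult_left_mono) (auto cong: nn_integral_cong simp: )
      also have "\<dots> \<le> ennreal (1 / K\<^sup>2 * max C 0)"
        by (subst ennreal_mult'[symmetric]) (auto intro!: ennreal_leI mult_left_mono simp: divide_right_mono)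
      also have "\<dots> < ennreal \<epsilon>"
      proof (rule ennreal_lessI[OF \<epsilon>])
        have "max C 0 < \<epsilon> * K\<^sup>2" using D \<epsilon> K(2) by (simp add: D_def)
        then show "1 / K\<^sup>2 * max C 0 < \<epsilon>"
          using K(1) by (simp add: pos_divide_less_eq)
      qed
      finally have 1: "emeasure (M n) {x. 1 \<le> ennreal (1 / K\<^sup>2) * ennreal ((norm x)\<^sup>2)} < ennreal \<epsilon>"
        by simp
      have set_eq: "{x::'a. 1 \<le> ennreal (1 / K\<^sup>2) * ennreal ((norm x)\<^sup>2)} = {x. K \<le> norm x}"
      proof -
        have "(1 \<le> ennreal (1 / K\<^sup>2) * ennreal ((norm x)\<^sup>2)) \<longleftrightarrow> K \<le> norm x" for x :: 'a
        proof -
          have "(1 \<le> ennreal (1 / K\<^sup>2) * ennreal ((norm x)\<^sup>2)) \<longleftrightarrow> 1 \<le> (norm x)\<^sup>2 / K\<^sup>2"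
            by (subst ennreal_mult'[symmetric]) (auto simp: ennreal_ge_1)
          also have "\<dots> \<longleftrightarrow> K\<^sup>2 \<le> (norm x)\<^sup>2" using K(1) by (simp add: pos_le_divide_eq)
          also have "\<dots> \<longleftrightarrow> K \<le> norm x" using K(1) by (intro power_mono_iff) auto
          finally show ?thesis .
        qed
        then show ?thesis by auto
      qed
      have closedK: "{x::'a. K \<le> norm x} \<in> sets borel"
        by (intro borel_closed closed_Collect_le continuous_intros)
      have 2: "measure (M n) {x. K \<le> norm x} < \<epsilon>"
        using 1 \<epsilon> unfolding set_eq emeasure_eq_measure by (simp add: ennreal_less_iff)
      have "1 - measure (M n) {x. K \<le> norm x} = measure (M n) (space (M n) - {x. K \<le> norm x})"
        using closedK by (subst prob_compl) auto
      also have "\<dots> \<le> measure (M n) (\<psi> -` {-b<..b} \<inter> space (M n))"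
      proof (rule finite_measure_mono)
        show "space (M n) - {x. K \<le> norm x} \<subseteq> \<psi> -` {-b<..b} \<inter> space (M n)"
        proof (safe, goal_cases)
          case (1 x)
          then have "\<bar>\<psi> x\<bar> < b" using \<psi>[of x] by (simp add: b_def)
          then show ?case by auto
        qed
        show "\<psi> -` {-b<..b} \<inter> space (M n) \<in> sets (M n)"
          using measurable_sets[OF \<psi>_meas', of "{-b<..b}" n] by auto
      qed
      also have "\<dots> = measure (\<mu> n) {-b<..b}"
        unfolding \<mu>_def by (subst measure_distr) (use \<psi>_meas' in auto)
      finally show ?thesis using 2 by linarith
    qed
    moreover have "-b < b" using K by (simp add: b_def)
    ultimately show "\<exists>a b. a < b \<and> (\<forall>n. 1 - \<epsilon> < measure (\<mu> n) {a<..b})" by blast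
  qed
  obtain r N where r: "strict_mono (r :: nat \<Rightarrow> nat)" and N: "real_distribution N"
    and w: "weak_conv_m (\<mu> \<circ> id \<circ> r) N"
    using tight_imp_convergent_subsubsequence[OF tight, of id] by (auto simp: strict_mono_id)
  interpret N: real_distribution N by (rule N)
  define L where "L = distr N borel f"
  show ?thesis
  proof
    show "strict_mono r" by (rule r)
    show "prob_space L"
      unfolding L_def by (intro N.prob_space_distr) (subst measurable_cong_sets[OF N.events_eq_borel refl], rule f_meas)
    show "sets L = sets borel" by (simp add: L_def)
    show "weak_lim (M \<circ> r) L"
      unfolding weak_lim_def
    proof (intro allI impI)
      fix g :: "'a \<Rightarrow> real" assume g: "continuous_on UNIV g" "bounded (range g)"
      have gm: "g \<in> borel_measurable borel" using g(1) by (rule borel_measurable_continuous_onI)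
      obtain B where B: "\<And>x. \<bar>g x\<bar> \<le> B" using g(2) by (auto simp: bounded_iff)
      have cont: "isCont (\<lambda>t. g (f t)) t" for t
        using continuous_on_compose2[OF g(1) f(1)] by (simp add: continuous_on_eq_continuous_at)
      have "(\<lambda>n. LINT t|(\<mu> \<circ> id \<circ> r) n. g (f t)) \<longlonglongrightarrow> (LINT t|N. g (f t))"
        by (rule weak_conv_imp_integral_bdd_continuous_conv[OF _ N w cont, of B])
          (use rd B in auto)
      moreover have "(LINT t|(\<mu> \<circ> id \<circ> r) n. g (f t)) = (LINT x|(M \<circ> r) n. g x)" for n
        unfolding \<mu>_def o_def id_def
        by (subst integral_distr) (use \<psi>_meas' gm f_meas in \<open>auto simp: f(2)\<close>)
      moreover have "(LINT t|N. g (f t)) = (LINT x|L. g x)"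
        unfolding L_def by (subst integral_distr) (use gm f_meas in auto)
      ultimately show "(\<lambda>n. LINT x|(M \<circ> r) n. g x) \<longlonglongrightarrow> (LINT x|L. g x)" by simp
    qed
  qed
qed

text \<open>Closed sets form an intersection-stable generator, and the indicator of a nonempty
  closed set is the limit of the Lipschitz functions \<open>max 0 (1 - n * infdist x S)\<close>. The
  test class is this small because along the curves only integrals of Lipschitz functions are
  controlled a priori, through mean displacements.\<close>

lemma measure_eqI_Lipschitz:
  fixes M1 M2 :: "'a::metric_space measure"
  assumes "prob_space M1" "prob_space M2"
    and sets: "sets M1 = sets borel" "sets M2 = sets borel"
    and eq: "\<And>f L. (\<And>x. 0 \<le> f x) \<Longrightarrow> (\<And>x. f x \<le> 1) \<Longrightarrow> (\<And>x y. \<bar>f x - f y\<bar> \<le> L * dist x y) \<Longrightarrow>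
      continuous_on UNIV f \<Longrightarrow> (LINT x|M1. f x) = (LINT x|M2. (f x :: real))"
  shows "M1 = M2"
proof (rule measure_eqI_generator_eq[where E="Collect closed" and \<Omega>=UNIV and A="\<lambda>_. UNIV"])
  interpret M1: prob_space M1 by fact
  interpret M2: prob_space M2 by fact
  have sp: "space M1 = UNIV" "space M2 = UNIV" using sets_eq_imp_space_eq[OF sets(1)] sets_eq_imp_space_eq[OF sets(2)] by auto
  show "Int_stable (Collect closed)" by (auto simp: Int_stable_def)
  show "sets M1 = sigma_sets UNIV (Collect closed)" "sets M2 = sigma_sets UNIV (Collect closed)"
    using sets by (simp_all add: borel_eq_closed)
  show "emeasure M1 S = emeasure M2 S" if "S \<in> Collect closed" for S
  proof (cases "S = {}")
    case False
    have S: "closed S" using that by simp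
    define f where "f n x = max 0 (1 - real n * infdist x S)" for n x
    have cont: "continuous_on UNIV (f n)" for n
      unfolding f_def by (intro continuous_intros)
    have fb: "0 \<le> f n x" "f n x \<le> 1" for n x
      by (auto simp: f_def infdist_nonneg)
    have flip: "\<bar>f n x - f n y\<bar> \<le> real n * dist x y" for n x y
    proof -
      have "\<bar>infdist x S - infdist y S\<bar> \<le> dist x y"
        using infdist_triangle[of x S y] infdist_triangle[of y S x] by (auto simp: dist_commute)
      then have "real n * \<bar>infdist x S - infdist y S\<bar> \<le> real n * dist x y"
        by (intro mult_left_mono) auto
      moreover have "\<bar>f n x - f n y\<bar> \<le> \<bar>real n * infdist x S - real n * infdist y S\<bar>"
        unfolding f_def by (auto simp: max_def)
      ultimately show ?thesis
        by (simp add: abs_mult right_diff_distrib[symmetric])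
    qed
    have flim: "(\<lambda>n. f n x) \<longlonglongrightarrow> indicator S x" for x
    proof (cases "x \<in> S")
      case True
      then show ?thesis by (simp add: f_def)
    next
      case xS: False
      then have pos: "infdist x S > 0"
        using S False in_closed_iff_infdist_zero[OF S False, of x] infdist_nonneg[of x S] by linarith
      obtain N :: nat where N: "real N * infdist x S > 1"
        using reals_Archimedean3[OF pos] by blast
      have "\<forall>\<^sub>F n in sequentially. f n x = indicator S x"
      proof (rule eventually_sequentiallyI[of N])
        fix n assume "N \<le> n"
        then have "real N * infdist x S \<le> real n * infdist x S"
          using pos by (intro mult_right_mono) auto
        then show "f n x = indicator S x" using N xS by (simp add: f_def)
      qed
      then show ?thesis by (rule tendsto_eventually)
    qed
    have lim: "(\<lambda>n. LINT x|M. f n x) \<longlonglongrightarrow> measure M S"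
      if M: "prob_space M" "sets M = sets borel" for M
    proof -
      interpret prob_space M by (rule M)
      have "f n \<in> borel_measurable M" for n
        by (subst measurable_cong_sets[OF M(2) refl]) (intro borel_measurable_continuous_onI cont)
      moreover have "S \<in> sets M" using S M(2) by auto
      ultimately have "(\<lambda>n. LINT x|M. f n x) \<longlonglongrightarrow> (LINT x|M. indicator S x)"
        using fb by (intro integral_dominated_convergence[where w="\<lambda>_. 1"]) (auto intro!: flim)
      then show ?thesis using \<open>S \<in> sets M\<close> by (simp add: Int_absorb2 sets.sets_into_space)
    qed
    have "measure M1 S = measure M2 S"
    proof (rule LIMSEQ_unique)
      show "(\<lambda>n. LINT x|M1. f n x) \<longlonglongrightarrow> measure M1 S" by (rule lim) fact+
      have "(LINT x|M1. f n x) = (LINT x|M2. f n x)" for n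
        using fb flip cont by (intro eq[where L="real n"]) auto
      then show "(\<lambda>n. LINT x|M1. f n x) \<longlonglongrightarrow> measure M2 S"
        using lim[of M2] assms by simp
    qed
    then show ?thesis by (simp add: M1.emeasure_eq_measure M2.emeasure_eq_measure)
  qed simp
  show "emeasure M1 UNIV \<noteq> \<infinity>" by simp
qed auto

lemma weak_lim_unique:
  fixes L1 L2 :: "'a::metric_space measure"
  assumes "weak_lim M L1" "weak_lim M L2" "prob_space L1" "prob_space L2"
    "sets L1 = sets borel" "sets L2 = sets borel"
  shows "L1 = L2"
proof (rule measure_eqI_Lipschitz)
  fix f :: "'a \<Rightarrow> real" assume f: "\<And>x. 0 \<le> f x" "\<And>x. f x \<le> 1" "continuous_on UNIV f"
  show "(LINT x|L1. f x) = (LINT x|L2. f x)"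
  proof (rule LIMSEQ_unique)
    show "(\<lambda>n. LINT x|M n. f x) \<longlonglongrightarrow> (LINT x|L1. f x)"
      by (rule weak_limD[OF assms(1) f(3), of 1]) (use f in auto)
    show "(\<lambda>n. LINT x|M n. f x) \<longlonglongrightarrow> (LINT x|L2. f x)"
      by (rule weak_limD[OF assms(2) f(3), of 1]) (use f in auto)
  qed
qed (use assms in auto)

text \<open>Truncating \<open>g\<close> at level \<open>k\<close> makes it bounded, so weak
  convergence applies; monotone convergence then removes the truncation. This form of Fatou's lemma
  transfers second moments and squared transport costs to the limit.\<close>

lemma weak_lim_nn_integral_le:
  fixes L :: "'a::topological_space measure"
  assumes w: "weak_lim M L"
    and M: "\<And>n. prob_space (M n)" "\<And>n. sets (M n) = sets borel"
    and L: "prob_space L" "sets L = sets borel"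
    and g: "continuous_on UNIV g" "\<And>x. 0 \<le> g x"
    and c: "\<And>n. (\<integral>\<^sup>+x. ennreal (g x) \<partial>M n) \<le> ennreal c" "0 \<le> c"
  shows "(\<integral>\<^sup>+x. ennreal (g x) \<partial>L) \<le> ennreal c"
proof -
  interpret L: prob_space L by fact
  have gm: "g \<in> borel_measurable N" if "sets N = sets borel" for N
    by (subst measurable_cong_sets[OF that refl]) (intro borel_measurable_continuous_onI g)
  have le: "(\<integral>\<^sup>+x. ennreal (min (g x) (real k)) \<partial>L) \<le> ennreal c" for k
  proof -
    define h where "h x = min (g x) (real k)" for x
    have hb: "0 \<le> h x" "h x \<le> real k" for x using g(2)[of x] by (auto simp: h_def)
    have hc: "continuous_on UNIV h" unfolding h_def by (intro continuous_intros g)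
    have int: "integrable N h" if "prob_space N" "sets N = sets borel" for N
    proof -
      interpret prob_space N by fact
      show ?thesis
        using hb by (intro integrable_const_bound[where B="real k"])
          (auto simp: measurable_cong_sets[OF that(2) refl] intro!: borel_measurable_continuous_onI hc)
    qed
    have "(LINT x|L. h x) \<le> c"
    proof (rule LIMSEQ_le_const2)
      show "(\<lambda>n. LINT x|M n. h x) \<longlonglongrightarrow> (LINT x|L. h x)"
        by (rule weak_limD[OF w hc, of "real k"]) (use hb in auto)
      have "(LINT x|M n. h x) \<le> c" for n
      proof -
        have "ennreal (LINT x|M n. h x) = (\<integral>\<^sup>+x. ennreal (h x) \<partial>M n)"
          using int[OF M(1,2)] hb by (intro nn_integral_eq_integral[symmetric]) auto
        also have "\<dots> \<le> (\<integral>\<^sup>+x. ennreal (g x) \<partial>M n)"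
          by (intro nn_integral_mono ennreal_leI) (simp add: h_def)
        also have "\<dots> \<le> ennreal c" by (rule c)
        finally show ?thesis using c(2) by simp
      qed
      then show "\<exists>N. \<forall>n\<ge>N. (LINT x|M n. h x) \<le> c" by blast
    qed
    then show ?thesis
      using int[OF L] hb by (subst h_def[symmetric], subst nn_integral_eq_integral) (auto intro: ennreal_leI)
  qed
  have sup: "ennreal (g x) = (SUP k. ennreal (min (g x) (real k)))" for x
  proof (rule antisym)
    obtain k :: nat where "g x \<le> real k" using real_arch_simple by blast
    then have "ennreal (g x) = ennreal (min (g x) (real k))" by simp
    then show "ennreal (g x) \<le> (SUP k. ennreal (min (g x) (real k)))"
      by (metis SUP_upper UNIV_I)
    show "(SUP k. ennreal (min (g x) (real k))) \<le> ennreal (g x)"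
      by (intro SUP_least ennreal_leI) simp
  qed
  have "(\<integral>\<^sup>+x. ennreal (g x) \<partial>L) = (SUP k. \<integral>\<^sup>+x. ennreal (min (g x) (real k)) \<partial>L)"
    unfolding sup
  proof (rule nn_integral_monotone_convergence_SUP)
    show "incseq (\<lambda>k x. ennreal (min (g x) (real k)))"
      by (intro incseq_SucI le_funI ennreal_leI) auto
    show "(\<lambda>x. ennreal (min (g x) (real k))) \<in> borel_measurable L" for k
      using gm[OF L(2)] by measurable
  qed
  also have "\<dots> \<le> ennreal c" by (intro SUP_least le)
  finally show ?thesis .
qed

text \<open>Every estimate of the distance goes through this bound: a coupling is exhibited and its
  cost estimated.\<close>

lemma wasserstein2_le:
  assumes "\<gamma> \<in> couplings \<mu> \<nu>" "(\<integral>\<^sup>+z. ennreal ((dist (fst z) (snd z))\<^sup>2) \<partial>\<gamma>) \<le> ennreal (c\<^sup>2)" "0 \<le> c"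
  shows "wasserstein2 \<mu> \<nu> \<le> c"
proof -
  have "(INF \<gamma>\<in>couplings \<mu> \<nu>. \<integral>\<^sup>+z. ennreal ((dist (fst z) (snd z))\<^sup>2) \<partial>\<gamma>) \<le> ennreal (c\<^sup>2)"
    using assms by (meson INF_lower2)
  then have "enn2real (INF \<gamma>\<in>couplings \<mu> \<nu>. \<integral>\<^sup>+z. ennreal ((dist (fst z) (snd z))\<^sup>2) \<partial>\<gamma>) \<le> c\<^sup>2"
    by (intro enn2real_leI) auto
  then have "wasserstein2 \<mu> \<nu> \<le> sqrt (c\<^sup>2)"
    unfolding wasserstein2_def by (rule real_sqrt_le_mono)
  then show ?thesis using assms(3) by simp
qed

text \<open>On the shell between radius \<open>k\<close> and \<open>k + 1\<close> the integrand is
  at most \<open>exp (- k)\<close>, and the enclosing ball lies in a cube of side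
  \<open>2 * (k + 1)\<close>. The resulting series converges because half of the exponential decay
  beats the polynomial volume.\<close>

lemma integrable_exp_minus_norm: "integrable lborel (\<lambda>x::'a::euclidean_space. exp (- norm x))"
proof (rule integrableI_bounded)
  define d where "d = DIM('a)"
  have vol: "emeasure lborel (cball (0::'a) r) \<le> ennreal ((2 * r) ^ d)" if "r \<ge> 0" for r
  proof -
    have "cball (0::'a) r \<subseteq> cbox (- r *\<^sub>R One) (r *\<^sub>R One)"
    proof
      fix x :: 'a assume x: "x \<in> cball 0 r"
      have "- r \<le> x \<bullet> b \<and> x \<bullet> b \<le> r" if "b \<in> Basis" for b
        using Basis_le_norm[OF that, of x] x by (auto simp: abs_le_iff)
      then show "x \<in> cbox (- r *\<^sub>R One) (r *\<^sub>R One)" by (simp add: mem_box)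
    qed
    then have "emeasure lborel (cball (0::'a) r) \<le> emeasure lborel (cbox (- r *\<^sub>R One) (r *\<^sub>R One :: 'a))"
      by (intro emeasure_mono) auto
    also have "\<dots> = ennreal ((2 * r) ^ d)"
      using that by (subst emeasure_lborel_cbox) (auto simp: d_def algebra_simps)
    finally show ?thesis .
  qed
  define a where "a k = exp (- real k) * (2 * (real k + 1)) ^ d" for k :: nat
  have a0: "a k \<ge> 0" for k by (simp add: a_def)
  have sa: "summable a"
  proof (rule summable_comparison_test')
    show "summable (\<lambda>k. (fact d * 4 ^ d * exp 1) * (exp (- (1/2::real))) ^ k)"
      by (intro summable_mult summable_geometric) auto
    fix k :: nat
    have f: "x ^ d \<le> fact d * exp x" if "x \<ge> 0" for x :: real
    proof -
      have "(\<Sum>n\<in>{d}. x ^ n /\<^sub>R fact n) \<le> (\<Sum>n. x ^ n /\<^sub>R fact n)"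
        using that by (intro sum_le_suminf summable_exp_generic) auto
      then show ?thesis by (simp add: exp_def field_simps)
    qed
    \<comment> \<open>Writing the volume as a power of \<open>(k + 1) / 2\<close> spends only half
      of the exponent.\<close>
    have "(2 * (real k + 1)) ^ d = 4 ^ d * ((real k + 1) / 2) ^ d"
    proof -
      have "2 * (real k + 1) = 4 * ((real k + 1) / 2)" by simp
      then show ?thesis by (simp only: power_mult_distrib)
    qed
    also have "\<dots> \<le> 4 ^ d * (fact d * exp ((real k + 1) / 2))"
      by (intro mult_left_mono f) auto
    finally have "a k \<le> exp (- real k) * (4 ^ d * (fact d * exp ((real k + 1) / 2)))"
      unfolding a_def by (intro mult_left_mono) auto
    also have "\<dots> = fact d * 4 ^ d * exp (1/2) * exp (- real k / 2)"
    proof -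
      have "exp (- real k) * exp ((real k + 1) / 2) = exp (1/2) * exp (- real k / 2)"
        unfolding exp_add[symmetric] by (rule arg_cong[of _ _ exp]) (simp add: field_simps)
      then show ?thesis by (simp add: mult_ac)
    qed
    also have "exp (- real k / 2) = exp (- (1/2)) ^ k"
      by (subst exp_of_nat_mult[symmetric]) simp
    also have "fact d * 4 ^ d * exp (1/2) * exp (- (1/2)) ^ k \<le> fact d * 4 ^ d * exp 1 * exp (- (1/2::real)) ^ k"
      by (intro mult_right_mono mult_left_mono) auto
    finally show "norm (a k) \<le> fact d * 4 ^ d * exp 1 * exp (- (1/2)) ^ k"
      using a0 by simp
  qed
  have "(\<integral>\<^sup>+x. ennreal (norm (exp (- norm x))) \<partial>(lborel :: 'a measure))
      \<le> (\<integral>\<^sup>+x. (\<Sum>k. ennreal (exp (- real k)) * indicator (cball 0 (real k + 1)) x) \<partial>(lborel :: 'a measure))"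
  proof (rule nn_integral_mono)
    fix x :: 'a
    define k where "k = nat \<lfloor>norm x\<rfloor>"
    have k: "real k \<le> norm x" "norm x \<le> real k + 1"
      unfolding k_def using norm_ge_zero[of x] by linarith+
    have "ennreal (norm (exp (- norm x))) \<le> ennreal (exp (- real k)) * indicator (cball 0 (real k + 1)) x"
      using k by (simp add: ennreal_leI)
    also have "\<dots> \<le> (\<Sum>k. ennreal (exp (- real k)) * indicator (cball 0 (real k + 1)) x)"
      using sum_le_suminf[OF summableI, of "{k}" "\<lambda>k. ennreal (exp (- real k)) * indicator (cball 0 (real k + 1)) x"]
      by (simp only: sum.insert[OF finite.emptyI] sum.empty empty_iff not_False_eq_True add_0_right finite.intros simp_thms zero_le)
    finally show "ennreal (norm (exp (- norm x))) \<le> (\<Sum>k. ennreal (exp (- real k)) * indicator (cball 0 (real k + 1)) x)" .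
  qed
  also have "\<dots> = (\<Sum>k. ennreal (exp (- real k)) * emeasure lborel (cball (0::'a) (real k + 1)))"
    by (subst nn_integral_suminf)
      (auto simp: nn_integral_cmult_indicator intro!: borel_measurable_times_ennreal borel_measurable_indicator)
  also have "\<dots> \<le> (\<Sum>k. ennreal (a k))"
  proof (intro suminf_le summableI)
    fix k
    have "ennreal (exp (- real k)) * emeasure lborel (cball (0::'a) (real k + 1))
      \<le> ennreal (exp (- real k)) * ennreal ((2 * (real k + 1)) ^ d)"
      by (intro mult_left_mono vol) auto
    then show "ennreal (exp (- real k)) * emeasure lborel (cball (0::'a) (real k + 1)) \<le> ennreal (a k)"
      by (simp add: a_def ennreal_mult')
  qed
  also have "\<dots> < \<infinity>"
    using ennreal_suminf_neq_top[OF sa a0] by (simp add: top.not_eq_extremum)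
  finally show "(\<integral>\<^sup>+x. ennreal (norm (exp (- norm x))) \<partial>(lborel :: 'a measure)) < \<infinity>" .
qed measurable

text \<open>Completing the square gives \<open>\<delta> * r^2 \<ge> r - 1 / (4 * \<delta>)\<close>,
  which reduces the claim to \<open>exp (- norm x)\<close>.\<close>

lemma integrable_exp_minus_norm_power2:
  assumes "\<delta> > 0"
  shows "integrable lborel (\<lambda>x::'a::euclidean_space. exp (- \<delta> * (norm x)\<^sup>2))"
proof (rule Bochner_Integration.integrable_bound)
  show "integrable lborel (\<lambda>x::'a. exp (1 / (4 * \<delta>)) * exp (- norm x))"
    by (intro integrable_mult_right integrable_exp_minus_norm)
  have "exp (- \<delta> * (norm x)\<^sup>2) \<le> exp (1 / (4 * \<delta>)) * exp (- norm x)" for x :: 'a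
  proof -
    have "0 \<le> \<delta> * (norm x - 1 / (2 * \<delta>))\<^sup>2" using assms by simp
    also have "\<dots> = \<delta> * (norm x)\<^sup>2 - norm x + 1 / (4 * \<delta>)"
      using assms by (simp add: power2_eq_square field_simps)
    finally show ?thesis by (simp add: exp_add[symmetric])
  qed
  then show "AE x in lborel. norm (exp (- \<delta> * (norm x)\<^sup>2)) \<le> norm (exp (1 / (4 * \<delta>)) * exp (- norm (x::'a)))"
    by simp
qed measurable

section \<open>Limits of square-integrable speeds\<close>

text \<open>These are the dyadic convex combinations of the tail \<open>u k\<close>,
  \<open>k \<ge> n\<close>. Closure under midpoints is chosen because the parallelogram identity
  compares two functions with their midpoint.\<close>

inductive_set midpoint_hull :: "(nat \<Rightarrow> 'a \<Rightarrow> real) \<Rightarrow> nat \<Rightarrow> ('a \<Rightarrow> real) set"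
  for u :: "nat \<Rightarrow> 'a \<Rightarrow> real" and n :: nat where
  base: "n \<le> k \<Longrightarrow> u k \<in> midpoint_hull u n"
| mid: "f \<in> midpoint_hull u n \<Longrightarrow> g \<in> midpoint_hull u n \<Longrightarrow> (\<lambda>x. (f x + g x) / 2) \<in> midpoint_hull u n"

lemma midpoint_hull_antimono: "n \<le> m \<Longrightarrow> f \<in> midpoint_hull u m \<Longrightarrow> f \<in> midpoint_hull u n"
  by (rotate_tac, induction rule: midpoint_hull.induct) (auto intro: midpoint_hull.intros)

lemma (in finite_measure) midpoint_hull_bounded_measurable:
  assumes u: "\<And>k. u k \<in> borel_measurable M" "\<And>k x. \<bar>u k x\<bar> \<le> B k"
    and f: "f \<in> midpoint_hull u n"
  shows "f \<in> borel_measurable M \<and> (\<exists>B. \<forall>x. \<bar>f x\<bar> \<le> B)"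
  using f
proof (induction rule: midpoint_hull.induct)
  case (mid f g)
  then obtain B1 B2 where B: "\<And>x. \<bar>f x\<bar> \<le> B1" "\<And>x. \<bar>g x\<bar> \<le> B2" by blast
  have "\<bar>(f x + g x) / 2\<bar> \<le> B1 + B2" for x
    using B(1)[of x] B(2)[of x] unfolding abs_le_iff by (auto simp: field_simps)
  then have "\<exists>B. \<forall>x. \<bar>(f x + g x) / 2\<bar> \<le> B" by blast
  moreover have "(\<lambda>x. (f x + g x) / 2) \<in> borel_measurable M" using mid by (intro borel_measurable_divide borel_measurable_add) auto
  ultimately show ?case by blast
qed (use u in auto)

text \<open>The approximants are almost minimizers of the \<open>L\<^sup>2\<close> norm over the convex tails of \<open>u\<close>
  (Mazur's lemma); the parallelogram identity makes them Cauchy.\<close>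

lemma (in finite_measure) bounded_L2_liminf:
  assumes u: "\<And>k. u k \<in> borel_measurable M" "\<And>k x. \<bar>u k x\<bar> \<le> B k"
    and C: "\<And>k. (LINT x|M. (u k x)\<^sup>2) \<le> C"
  obtains m :: "'a \<Rightarrow> real" where "integrable M m"
    "\<And>A c. A \<in> sets M \<Longrightarrow> (\<forall>\<^sub>F k in sequentially. c \<le> (LINT x|M. indicator A x * u k x)) \<Longrightarrow>
      c \<le> (LINT x|M. indicator A x * m x)"
proof -
  define H where "H = midpoint_hull u"
  define Q where "Q f = (LINT x|M. (f x)\<^sup>2)" for f :: "'a \<Rightarrow> real"
  note hull_meas = midpoint_hull_bounded_measurable[where u=u and B=B, OF u]
  have Hm: "f \<in> borel_measurable M" if "f \<in> H n" for f n
    using hull_meas that unfolding H_def by blast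
  have Hb: "\<exists>B. \<forall>x. \<bar>f x\<bar> \<le> B" if "f \<in> H n" for f n
    using hull_meas that unfolding H_def by blast
  have Hint: "integrable M (\<lambda>x. f x * g x)" if f: "f \<in> H n" and g: "g \<in> H k" for f g n k
  proof -
    obtain B1 B2 where b: "\<And>x. \<bar>f x\<bar> \<le> B1" "\<And>x. \<bar>g x\<bar> \<le> B2" using Hb[OF f] Hb[OF g] by blast
    have "\<bar>f x * g x\<bar> \<le> B1 * B2" for x
      unfolding abs_mult using b by (intro mult_mono) (auto intro: order_trans[OF abs_ge_zero])
    then show ?thesis
      using Hm[OF f] Hm[OF g] by (intro integrable_const_bound[where B="B1 * B2"]) auto
  qed
  have H1: "integrable M f" if f: "f \<in> H n" for f n
  proof -
    obtain B1 where "\<And>x. \<bar>f x\<bar> \<le> B1" using Hb[OF f] by blast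
    then show ?thesis using Hm[OF f] by (intro integrable_const_bound[where B=B1]) auto
  qed
  have Q0: "0 \<le> Q f" for f unfolding Q_def by (intro integral_nonneg_AE) auto
  \<comment> \<open>The infimum of the squared \<open>L2\<close> norm over the hull of the tail:
    nondecreasing in \<open>n\<close> because the hulls shrink, and bounded by \<open>C\<close>,
    hence convergent.\<close>
  define a where "a n = Inf (Q ` H n)" for n
  have uH: "u n \<in> H n" for n by (simp add: H_def midpoint_hull.base)
  have bdd: "bdd_below (Q ` H n)" for n using Q0 by (intro bdd_belowI[of _ 0]) auto
  have aQ: "a n \<le> Q f" if "f \<in> H n" for n f
    unfolding a_def using that bdd by (intro cInf_lower) auto
  have aC: "a n \<le> C" for n using aQ[OF uH, of n] C[of n] by (simp add: Q_def)
  have "incseq a"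
    unfolding incseq_def a_def
  proof (intro allI impI cInf_superset_mono)
    fix m n :: nat assume "m \<le> n"
    then show "Q ` H n \<subseteq> Q ` H m" by (auto simp: H_def intro: midpoint_hull_antimono)
    show "Q ` H n \<noteq> {}" using uH by auto
  qed (rule bdd)
  then obtain l where l: "a \<longlonglongrightarrow> l" and al: "\<And>n. a n \<le> l"
    using incseq_convergent[of a C] aC by blast
  define e where "e n = (1/2::real) ^ n" for n
  have e: "e n > 0" for n by (simp add: e_def)
  have "\<exists>f\<in>H n. Q f < a n + e n" for n
  proof -
    have "\<exists>q\<in>Q ` H n. q < a n + e n"
      unfolding a_def using uH[of n] e[of n] bdd[of n] by (intro cInf_lessD) auto
    then show ?thesis by auto
  qed
  then obtain w where w: "\<And>n. w n \<in> H n" "\<And>n. Q (w n) < a n + e n" by metis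
  have wH: "w m \<in> H n" if "n \<le> m" for m n
    using w(1)[of m] midpoint_hull_antimono[OF that] by (simp add: H_def)
  \<comment> \<open>The midpoint of \<open>w m\<close> and \<open>w n\<close> still lies in the hull
    from \<open>n\<close> on, so its squared norm is at least \<open>a n\<close>; the parallelogram
    identity turns near-minimality into closeness.\<close>
  have cauchy: "Q (\<lambda>x. w m x - w n x) \<le> 2 * (l - a n) + 4 * e n" if "n \<le> m" for m n
  proof -
    have "(\<lambda>x. (w m x + w n x) / 2) \<in> H n"
      using wH[OF that] w(1)[of n] unfolding H_def by (rule midpoint_hull.mid)
    then have "a n \<le> Q (\<lambda>x. (w m x + w n x) / 2)" by (rule aQ)
    moreover have "Q (\<lambda>x. w m x - w n x) = 2 * Q (w m) + 2 * Q (w n) - 4 * Q (\<lambda>x. (w m x + w n x) / 2)"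
    proof -
      note i = Hint[OF w(1)[of m] w(1)[of m]] Hint[OF w(1)[of n] w(1)[of n]] Hint[OF w(1)[of m] w(1)[of n]]
      have 1: "Q (\<lambda>x. w m x - w n x) = Q (w m) + Q (w n) - 2 * (LINT x|M. w m x * w n x)"
      proof -
        have "Q (\<lambda>x. w m x - w n x) = (LINT x|M. w m x * w m x + w n x * w n x - 2 * (w m x * w n x))"
          unfolding Q_def by (intro Bochner_Integration.integral_cong refl) (simp add: power2_eq_square algebra_simps)
        then show ?thesis using i by (simp add: Q_def power2_eq_square)
      qed
      have 2: "4 * Q (\<lambda>x. (w m x + w n x) / 2) = Q (w m) + Q (w n) + 2 * (LINT x|M. w m x * w n x)"
      proof -
        have "4 * Q (\<lambda>x. (w m x + w n x) / 2) = (LINT x|M. 4 * ((w m x + w n x) / 2)\<^sup>2)"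
          unfolding Q_def by simp
        also have "\<dots> = (LINT x|M. w m x * w m x + w n x * w n x + 2 * (w m x * w n x))"
          by (intro Bochner_Integration.integral_cong refl) (simp add: power2_eq_square algebra_simps)
        finally show ?thesis using i by (simp add: Q_def power2_eq_square)
      qed
      show ?thesis using 1 2 by simp
    qed
    moreover have "e m \<le> e n" using that by (simp add: e_def power_decreasing)
    moreover note w(2)[of n] w(2)[of m] al[of m]
    ultimately have "Q (\<lambda>x. w m x - w n x) \<le> 2 * Q (w m) + 2 * Q (w n) - 4 * a n" "e m \<le> e n"
      "Q (w n) < a n + e n" "Q (w m) < a m + e m" "a m \<le> l" by auto
    then show ?thesis by argo
  qed
  have "(\<lambda>n. 2 * (l - a n) + 4 * e n) \<longlonglongrightarrow> 2 * (l - l) + 4 * 0"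
    unfolding e_def by (intro tendsto_intros l LIMSEQ_power_zero) auto
  then have small: "\<exists>N. \<forall>n\<ge>N. 2 * (l - a n) + 4 * e n < \<delta>" if "\<delta> > 0" for \<delta>
    using order_tendstoD(2)[of _ 0 sequentially \<delta>] that by (auto simp: eventually_sequentially)
  \<comment> \<open>Squared \<open>L2\<close> distances of order \<open>(1/4) ^ k\<close> give
    \<open>L1\<close> distances of order \<open>(1/2) ^ k\<close>, which are summable.\<close>
  define \<delta> where "\<delta> k = (1/4::real) ^ k" for k
  have "\<exists>N. \<forall>k. (\<forall>n\<ge>N k. 2 * (l - a n) + 4 * e n < \<delta> k)"
    by (intro choice allI small) (simp add: \<delta>_def)
  then obtain N where N: "\<And>k n. n \<ge> N k \<Longrightarrow> 2 * (l - a n) + 4 * e n < \<delta> k" by blast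
  \<comment> \<open>Accumulating the \<open>N i\<close> makes the indices monotone, and the summand
    \<open>k\<close> drives them to infinity.\<close>
  define p where "p k = k + (\<Sum>i\<le>k. N i)" for k
  have pN: "p k \<ge> N k" for k unfolding p_def
    using member_le_sum[of k "{..k}" N] by simp
  have pm: "p k \<le> p (Suc k)" and pk: "k \<le> p k" for k by (auto simp: p_def)
  define D where "D k x = w (p (Suc k)) x - w (p k) x" for k x
  have Dm: "D k \<in> borel_measurable M" for k
    unfolding D_def using Hm[OF w(1)] by measurable
  have Dint: "integrable M (D k)" for k
    unfolding D_def using H1[OF w(1)] by auto
  have DQ: "Q (D k) \<le> \<delta> k" for k
    using cauchy[OF pm[of k]] N[OF pN[of k]] unfolding D_def[abs_def] by linarith
  define V where "V = measure M (space M)"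
  have Dsq: "integrable M (\<lambda>x. (D k x)\<^sup>2)" for k
  proof -
    note i = Hint[OF w(1)[of "p (Suc k)"] w(1)[of "p (Suc k)"]] Hint[OF w(1)[of "p k"] w(1)[of "p k"]]
        Hint[OF w(1)[of "p (Suc k)"] w(1)[of "p k"]]
    have "integrable M (\<lambda>x. w (p (Suc k)) x * w (p (Suc k)) x + w (p k) x * w (p k) x - 2 * (w (p (Suc k)) x * w (p k) x))"
      using i by auto
    then show ?thesis
      by (rule back_subst[of "integrable M"]) (auto simp: D_def fun_eq_iff power2_eq_square algebra_simps)
  qed
  have DL1: "(LINT x|M. \<bar>D k x\<bar>) \<le> (1 + V) * (1/2) ^ k" for k
  proof -
    \<comment> \<open>The pointwise inequality \<open>y \<le> 2 ^ k * y^2 + (1/2) ^ k\<close> takes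
      the place of Hoelder's inequality; its constant term is integrable because the measure is
      finite.\<close>
    have "(LINT x|M. \<bar>D k x\<bar>) \<le> (LINT x|M. 2 ^ k * (D k x)\<^sup>2 + (1/2) ^ k)"
    proof (rule integral_mono)
      show "integrable M (\<lambda>x. \<bar>D k x\<bar>)" using Dint by auto
      show "integrable M (\<lambda>x. 2 ^ k * (D k x)\<^sup>2 + (1/2) ^ k)" using Dsq by auto
      fix x
      define y where "y = \<bar>D k x\<bar>"
      have "0 \<le> (2 ^ k * y - 1)\<^sup>2" by simp
      also have "\<dots> = 2 ^ k * (2 ^ k * y\<^sup>2 + (1/2) ^ k - 2 * y)"
        by (simp add: power2_eq_square algebra_simps power_one_over)
      finally have "2 ^ k * 0 \<le> 2 ^ k * (2 ^ k * y\<^sup>2 + (1/2) ^ k - 2 * y)"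
        by (simp only: mult_zero_right)
      then have "0 \<le> 2 ^ k * y\<^sup>2 + (1/2) ^ k - 2 * y"
        by (subst (asm) mult_le_cancel_left_pos) simp_all
      moreover have "0 \<le> y" by (simp add: y_def)
      ultimately have "y \<le> 2 ^ k * y\<^sup>2 + (1/2) ^ k" by linarith
      then show "\<bar>D k x\<bar> \<le> 2 ^ k * (D k x)\<^sup>2 + (1/2) ^ k" by (simp add: y_def)
    qed
    also have "\<dots> = 2 ^ k * Q (D k) + V * (1/2) ^ k"
      using Dsq by (simp add: Q_def V_def)
    also have "\<dots> \<le> 2 ^ k * \<delta> k + V * (1/2) ^ k"
      using DQ by (intro add_mono mult_left_mono) (auto simp: V_def)
    also have "2 ^ k * \<delta> k = (1/2) ^ k"
      by (simp add: \<delta>_def power_mult_distrib[symmetric])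
    finally show ?thesis by (simp add: algebra_simps)
  qed
  have sumL1: "summable (\<lambda>k. LINT x|M. \<bar>D k x\<bar>)"
  proof (rule summable_comparison_test')
    show "summable (\<lambda>k. (1 + V) * (1/2) ^ k)" by (intro summable_mult summable_geometric) auto
    show "norm (LINT x|M. \<bar>D k x\<bar>) \<le> (1 + V) * (1/2) ^ k" for k
      using DL1[of k] by simp
  qed
  have AEsum: "AE x in M. summable (\<lambda>k. \<bar>D k x\<bar>)"
  proof -
    have "(\<integral>\<^sup>+x. (\<Sum>k. ennreal \<bar>D k x\<bar>) \<partial>M) = (\<Sum>k. \<integral>\<^sup>+x. ennreal \<bar>D k x\<bar> \<partial>M)"
      using Dm by (intro nn_integral_suminf) measurable
    also have "\<dots> = (\<Sum>k. ennreal (LINT x|M. \<bar>D k x\<bar>))"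
    proof -
      have "(\<integral>\<^sup>+x. ennreal \<bar>D k x\<bar> \<partial>M) = ennreal (LINT x|M. \<bar>D k x\<bar>)" for k
        using Dint[of k] by (intro nn_integral_eq_integral) auto
      then show ?thesis by simp
    qed
    also have "\<dots> \<noteq> \<infinity>"
      unfolding infinity_ennreal_def by (rule ennreal_suminf_neq_top[OF sumL1]) simp
    finally have fin: "(\<integral>\<^sup>+x. (\<Sum>k. ennreal \<bar>D k x\<bar>) \<partial>M) \<noteq> \<infinity>" .
    have "(\<lambda>x. \<Sum>k. ennreal \<bar>D k x\<bar>) \<in> borel_measurable M"
      using Dm by measurable
    then have "AE x in M. (\<Sum>k. ennreal \<bar>D k x\<bar>) \<noteq> \<infinity>"
      using fin by (rule nn_integral_PInf_AE)
    then show ?thesis by eventually_elim (auto intro!: summable_suminf_not_top)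
  qed
  \<comment> \<open>The almost everywhere limit of \<open>w (p k)\<close>, written as a telescoping
    series so that its integrability follows from the summable \<open>L1\<close> norms.\<close>
  define m where "m x = w (p 0) x + (\<Sum>k. D k x)" for x
  show thesis
  proof
    have "integrable M (\<lambda>x. \<Sum>k. D k x)"
      by (rule integrable_suminf) (use Dint AEsum sumL1 in auto)
    then show "integrable M m"
      unfolding m_def using H1[OF w(1)] by auto
  next
    fix A c assume A: "A \<in> sets M" and ev: "\<forall>\<^sub>F k in sequentially. c \<le> (LINT x|M. indicator A x * u k x)"
    obtain K where K: "\<And>k. k \<ge> K \<Longrightarrow> c \<le> (LINT x|M. indicator A x * u k x)"
      using ev by (auto simp: eventually_sequentially)
    have intA: "integrable M (\<lambda>x. indicator A x * f x)" if "integrable M f" for f :: "'a \<Rightarrow> real"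
      using A that integrable_mult_indicator[of A M f] by simp
    \<comment> \<open>The lower bound \<open>c\<close> for the integral over \<open>A\<close> is
      stable under midpoints, so it passes from the functions \<open>u k\<close> with
      \<open>k \<ge> K\<close> to their whole hull.\<close>
    have hull: "c \<le> (LINT x|M. indicator A x * f x)" if "f \<in> H K" for f
      using that unfolding H_def
    proof (induction rule: midpoint_hull.induct)
      case (base k)
      then show ?case by (rule K)
    next
      case (mid f g)
      have "(LINT x|M. indicator A x * ((f x + g x) / 2))
          = (LINT x|M. indicator A x * f x / 2 + indicator A x * g x / 2)"
        by (intro Bochner_Integration.integral_cong refl) (simp add: field_simps)
      also have "\<dots> = (LINT x|M. indicator A x * f x) / 2 + (LINT x|M. indicator A x * g x) / 2"
        using intA[OF H1[of f]] intA[OF H1[of g]] mid(1,2) by (simp add: H_def)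
      finally show ?case using mid by simp
    qed
    have DintA: "integrable M (\<lambda>x. indicator A x * D k x)" for k
      by (rule intA[OF Dint])
    have "(\<lambda>k. LINT x|M. indicator A x * D k x) sums (LINT x|M. (\<Sum>k. indicator A x * D k x))"
    proof (rule sums_integral)
      show "integrable M (\<lambda>x. indicator A x * D k x)" for k by (rule DintA)
      show "AE x in M. summable (\<lambda>k. norm (indicator A x * D k x))"
        using AEsum by eventually_elim (auto simp: abs_mult split: split_indicator)
      show "summable (\<lambda>k. LINT x|M. norm (indicator A x * D k x))"
      proof (rule summable_comparison_test'[OF sumL1])
        fix k :: nat
        have "norm (LINT x|M. norm (indicator A x * D k x)) = (LINT x|M. norm (indicator A x * D k x))"
          by simp
        also have "\<dots> \<le> (LINT x|M. \<bar>D k x\<bar>)"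
          using DintA Dint by (intro integral_mono) (auto split: split_indicator)
        finally show "norm (LINT x|M. norm (indicator A x * D k x)) \<le> (LINT x|M. \<bar>D k x\<bar>)" .
      qed
    qed
    moreover have "(LINT x|M. (\<Sum>k. indicator A x * D k x)) = (LINT x|M. indicator A x * (\<Sum>k. D k x))"
    proof (rule integral_cong_AE)
      show "AE x in M. (\<Sum>k. indicator A x * D k x) = indicator A x * (\<Sum>k. D k x)"
        using AEsum by eventually_elim (auto split: split_indicator)
    qed (use Dm A in measurable)
    ultimately have s: "(\<lambda>n. \<Sum>k<n. LINT x|M. indicator A x * D k x)
        \<longlonglongrightarrow> (LINT x|M. indicator A x * (\<Sum>k. D k x))"
      by (simp add: sums_def)
    have part: "(\<Sum>k<n. LINT x|M. indicator A x * D k x)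
        = (LINT x|M. indicator A x * w (p n) x) - (LINT x|M. indicator A x * w (p 0) x)" for n
    proof (induction n)
      case (Suc n)
      have "(LINT x|M. indicator A x * D n x)
          = (LINT x|M. indicator A x * w (p (Suc n)) x - indicator A x * w (p n) x)"
        by (intro Bochner_Integration.integral_cong refl) (simp add: D_def algebra_simps)
      also have "\<dots> = (LINT x|M. indicator A x * w (p (Suc n)) x) - (LINT x|M. indicator A x * w (p n) x)"
        using intA[OF H1[OF w(1)]] by simp
      finally show ?case using Suc by simp
    qed simp
    have Sint: "integrable M (\<lambda>x. \<Sum>k. D k x)"
      by (rule integrable_suminf) (use Dint AEsum sumL1 in auto)
    have "(LINT x|M. indicator A x * m x)
        = (LINT x|M. indicator A x * w (p 0) x + indicator A x * (\<Sum>k. D k x))"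
      by (intro Bochner_Integration.integral_cong refl) (simp add: m_def algebra_simps)
    also have "\<dots> = (LINT x|M. indicator A x * w (p 0) x) + (LINT x|M. indicator A x * (\<Sum>k. D k x))"
      using intA[OF H1[OF w(1)]] intA[OF Sint] by simp
    finally have mA: "(LINT x|M. indicator A x * m x)
        = (LINT x|M. indicator A x * w (p 0) x) + (LINT x|M. indicator A x * (\<Sum>k. D k x))" .
    have "(\<lambda>n. (LINT x|M. indicator A x * w (p n) x)) \<longlonglongrightarrow> (LINT x|M. indicator A x * m x)"
      using tendsto_add[OF s tendsto_const[of "LINT x|M. indicator A x * w (p 0) x"]]
      unfolding part mA by (simp add: add.commute)
    moreover have "c \<le> (LINT x|M. indicator A x * w (p n) x)" if "n \<ge> K" for n
      by (rule hull) (use wH[of K "p n"] pk[of n] that in simp)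
    ultimately show "c \<le> (LINT x|M. indicator A x * m x)"
      by (intro LIMSEQ_le_const) auto
  qed
qed

section \<open>Differentiable functions and compactness of curves\<close>

lemma GDERIV_line:
  fixes f :: "'a::real_inner \<Rightarrow> real"
  assumes "\<And>x. GDERIV f x :> g x"
  shows "((\<lambda>h. f (x + h *\<^sub>R v)) has_field_derivative (g (x + h *\<^sub>R v) \<bullet> v)) (at h within S)"
proof -
  have "(f has_derivative (\<lambda>u. u \<bullet> g (x + h *\<^sub>R v))) (at (x + h *\<^sub>R v))"
    using assms by (simp add: gderiv_def)
  moreover have "((\<lambda>h. x + h *\<^sub>R v) has_derivative (\<lambda>t. t *\<^sub>R v)) (at h within S)"
    by (auto intro!: derivative_eq_intros)
  ultimately have "((\<lambda>h. f (x + h *\<^sub>R v)) has_derivative (\<lambda>t. (t *\<^sub>R v) \<bullet> g (x + h *\<^sub>R v))) (at h within S)"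
    by (rule has_derivative_compose[rotated])
  then show ?thesis
    unfolding has_field_derivative_def
    by (rule back_subst[of "\<lambda>D. (_ has_derivative D) _"]) (auto simp: fun_eq_iff inner_commute mult.commute)
qed

lemma GDERIV_mvt:
  fixes f :: "'a::real_inner \<Rightarrow> real"
  assumes "\<And>x. GDERIV f x :> g x"
  obtains c where "dist c b \<le> dist a b" "f b - f a = g c \<bullet> (b - a)"
proof -
  have "\<exists>z>0. z < 1 \<and> f (a + 1 *\<^sub>R (b - a)) - f (a + 0 *\<^sub>R (b - a)) = (1 - 0) * (g (a + z *\<^sub>R (b - a)) \<bullet> (b - a))"
    by (intro MVT2[where f="\<lambda>h. f (a + h *\<^sub>R (b - a))"] GDERIV_line assms) auto
  then obtain z where z: "0 < z" "z < 1" "f b - f a = g (a + z *\<^sub>R (b - a)) \<bullet> (b - a)" by auto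
  have "(a + z *\<^sub>R (b - a)) - b = (1 - z) *\<^sub>R (a - b)" by (simp add: algebra_simps)
  then have "dist (a + z *\<^sub>R (b - a)) b = (1 - z) * dist a b"
    using z by (simp add: dist_norm)
  also have "\<dots> \<le> dist a b" using z by (simp add: mult_left_le_one_le)
  finally show ?thesis using z that by blast
qed

lemma GDERIV_unique:
  fixes f :: "'a::real_inner \<Rightarrow> real"
  assumes "GDERIV f x :> D" "GDERIV f x :> E"
  shows "D = E"
proof -
  have "(\<lambda>h. h \<bullet> D) = (\<lambda>h. h \<bullet> E)"
    using assms unfolding gderiv_def by (rule has_derivative_unique)
  then have "(D - E) \<bullet> D = (D - E) \<bullet> E" by (rule fun_cong)
  then have "(D - E) \<bullet> (D - E) = 0" by (simp add: inner_diff_right)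
  then show ?thesis by simp
qed

lemma grad_eq:
  assumes "\<And>x. GDERIV f x :> g x"
  shows "grad f = g"
  unfolding grad_def using assms by (intro ext the_equality) (auto intro: GDERIV_unique)

lemma GDERIV_eq_0_outside:
  fixes f :: "'a::real_inner \<Rightarrow> real"
  assumes "GDERIV f x :> D" "\<And>y. norm y > R \<Longrightarrow> f y = 0" "norm x > R"
  shows "D = 0"
proof (rule GDERIV_unique[OF assms(1)])
  have "((\<lambda>_. 0::real) has_derivative (\<lambda>_. 0)) (at x)" by simp
  then have "(f has_derivative (\<lambda>_. 0)) (at x)"
  proof (rule has_derivative_transform_within_open)
    show "open {y::'a. R < norm y}" by (intro open_Collect_less continuous_intros)
  qed (use assms in auto)
  then show "GDERIV f x :> 0" by (simp add: gderiv_def)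
qed

lemma continuous_compact_support_bounded:
  fixes f :: "'a::euclidean_space \<Rightarrow> 'b::real_normed_vector"
  assumes "continuous_on UNIV f" "\<And>x. norm x > R \<Longrightarrow> f x = 0"
  obtains B where "\<And>x. norm (f x) \<le> B" "B > 0"
proof -
  have "bounded (f ` cball 0 R)"
    by (intro compact_imp_bounded compact_continuous_image continuous_on_subset[OF assms(1)]) auto
  then obtain B where B: "\<And>x. x \<in> cball 0 R \<Longrightarrow> norm (f x) \<le> B" unfolding bounded_iff by blast
  have "norm (f x) \<le> max B 1" for x
    using B[of x] assms(2)[of x] by (cases "norm x \<le> R") (auto simp: le_max_iff_disj)
  then show ?thesis by (rule that) auto
qed

lemma continuous_compact_support_uniform:
  fixes f :: "'a::euclidean_space \<Rightarrow> 'b::real_normed_vector"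
  assumes "continuous_on UNIV f" "\<And>x. norm x > R \<Longrightarrow> f x = 0" "\<eta> > 0"
  obtains \<delta> where "\<delta> > 0" "\<And>x y. dist x y < \<delta> \<Longrightarrow> dist (f x) (f y) < \<eta>"
proof -
  have "uniformly_continuous_on (cball 0 (R + 1)) f"
    by (intro compact_uniformly_continuous continuous_on_subset[OF assms(1)]) auto
  then obtain d where d: "d > 0"
    "\<And>x y. x \<in> cball 0 (R + 1) \<Longrightarrow> y \<in> cball 0 (R + 1) \<Longrightarrow> dist x y < d \<Longrightarrow> dist (f x) (f y) < \<eta>"
    unfolding uniformly_continuous_on_def using \<open>\<eta> > 0\<close> by metis
  show ?thesis
  proof
    show "min d 1 > 0" using d by simp
    fix x y :: 'a assume xy: "dist x y < min d 1"
    show "dist (f x) (f y) < \<eta>"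
    proof (cases "norm x \<le> R + 1 \<and> norm y \<le> R + 1")
      case True
      then show ?thesis using d(2)[of x y] xy by simp
    next
      case False
      have "norm x \<le> norm y + dist x y" "norm y \<le> norm x + dist x y"
        by (metis dist_norm norm_triangle_sub, metis dist_norm dist_commute norm_triangle_sub)
      then have "norm x > R" "norm y > R" using False xy by auto
      then show ?thesis using assms by simp
    qed
  qed
qed

text \<open>Test functions are only C1, so the remainder is not simply quadratic. Uniform continuity
  of the gradient bounds it by \<open>\<eta> * dist a b\<close> for points closer than some
  \<open>\<delta>\<close>; for the others the gradients differ by at most \<open>2 * B\<close>,
  which is at most \<open>(2 * B / \<delta>) * dist a b\<close>. The expansion is around the end
  point \<open>b\<close> because an implicit Euler step carries its equation at the new
  position.\<close>

lemma C1c_taylor: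
  fixes \<phi> :: "'a::euclidean_space \<Rightarrow> real"
  assumes "\<phi> \<in> C1c"
  obtains R where "\<And>x. GDERIV \<phi> x :> grad \<phi> x" "continuous_on UNIV (grad \<phi>)"
    "\<And>x. norm x > R \<Longrightarrow> \<phi> x = 0" "\<And>x. norm x > R \<Longrightarrow> grad \<phi> x = 0"
    "\<And>\<eta>. \<eta> > 0 \<Longrightarrow> \<exists>D\<ge>0. \<forall>a b. \<bar>\<phi> b - \<phi> a - grad \<phi> b \<bullet> (b - a)\<bar> \<le> \<eta> * dist a b + D * (dist a b)\<^sup>2"
proof -
  obtain g where g: "\<And>x. GDERIV \<phi> x :> g x" "continuous_on UNIV g"
    using assms by (auto simp: C1c_def C1_def)
  have gr: "grad \<phi> = g" by (rule grad_eq) (rule g)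
  have "bounded (supp \<phi>)" using assms by (auto simp: C1c_def compact_imp_bounded)
  then obtain R where R: "\<And>x. x \<in> supp \<phi> \<Longrightarrow> norm x \<le> R" by (auto simp: bounded_iff)
  have \<phi>0: "\<phi> x = 0" if "norm x > R" for x
    using R[of x] that closure_subset[of "{x. \<phi> x \<noteq> 0}"] by (auto simp: supp_def)
  have g0: "g x = 0" if "norm x > R" for x
    by (rule GDERIV_eq_0_outside[OF g(1) \<phi>0 that])
  obtain B where B: "\<And>x. norm (g x) \<le> B" "B > 0"
    using continuous_compact_support_bounded[OF g(2) g0] by blast
  show ?thesis
  proof (rule that[of R], unfold gr)
    fix \<eta> :: real assume \<eta>: "\<eta> > 0"
    obtain \<delta> where \<delta>: "\<delta> > 0" "\<And>x y. dist x y < \<delta> \<Longrightarrow> dist (g x) (g y) < \<eta>"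
      using continuous_compact_support_uniform[OF g(2) g0 \<eta>] by blast
    have "\<bar>\<phi> b - \<phi> a - g b \<bullet> (b - a)\<bar> \<le> \<eta> * dist a b + (2 * B / \<delta>) * (dist a b)\<^sup>2" for a b
    proof -
      obtain c where c: "dist c b \<le> dist a b" "\<phi> b - \<phi> a = g c \<bullet> (b - a)"
        using GDERIV_mvt[OF g(1)] by blast
      have "\<bar>\<phi> b - \<phi> a - g b \<bullet> (b - a)\<bar> = \<bar>(g c - g b) \<bullet> (b - a)\<bar>"
        by (simp add: c inner_diff_left)
      also have "\<dots> \<le> norm (g c - g b) * norm (b - a)" by (rule Cauchy_Schwarz_ineq2)
      also have "\<dots> = dist (g c) (g b) * dist a b" by (simp add: dist_norm norm_minus_commute)
      also have "\<dots> \<le> (\<eta> + (2 * B / \<delta>) * dist a b) * dist a b"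
      proof (rule mult_right_mono)
        show "dist (g c) (g b) \<le> \<eta> + (2 * B / \<delta>) * dist a b"
        proof (cases "dist a b < \<delta>")
          case True
          then have "dist (g c) (g b) < \<eta>" using c(1) by (intro \<delta>(2)) simp
          moreover have "0 \<le> (2 * B / \<delta>) * dist a b" using B \<delta> by simp
          ultimately show ?thesis by linarith
        next
          case False
          have "dist (g c) (g b) \<le> norm (g c) + norm (g b)" by (simp add: dist_norm norm_triangle_ineq4)
          also have "\<dots> \<le> 2 * B" using B(1)[of c] B(1)[of b] by simp
          also have "\<dots> = (2 * B / \<delta>) * \<delta>" using \<delta> by simp
          also have "\<dots> \<le> (2 * B / \<delta>) * dist a b"
            using False B \<delta> by (intro mult_left_mono) auto
          finally show ?thesis using \<eta> by linarith
        qed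
      qed simp
      finally show ?thesis by (simp add: algebra_simps power2_eq_square)
    qed
    moreover have "2 * B / \<delta> \<ge> 0" using B \<delta> by simp
    ultimately show "\<exists>D\<ge>0. \<forall>a b. \<bar>\<phi> b - \<phi> a - g b \<bullet> (b - a)\<bar> \<le> \<eta> * dist a b + D * (dist a b)\<^sup>2"
      by blast
  qed (use g \<phi>0 g0 in auto)
qed

section \<open>Weak compactness of curves of laws\<close>

lemma weak_lim_subseq:
  assumes "weak_lim M L" "strict_mono r"
  shows "weak_lim (M \<circ> r) L"
  unfolding weak_lim_def
proof (intro allI impI)
  fix f :: "'a \<Rightarrow> real" assume "continuous_on UNIV f" "bounded (range f)"
  then have "(\<lambda>n. LINT x|M n. f x) \<longlonglongrightarrow> (LINT x|L. f x)" using assms(1) by (auto simp: weak_lim_def)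
  from LIMSEQ_subseq_LIMSEQ[OF this assms(2)]
  show "(\<lambda>n. LINT x|(M \<circ> r) n. f x) \<longlonglongrightarrow> (LINT x|L. f x)" by (simp add: o_def)
qed

text \<open>Prokhorov's theorem yields a limit along some subsequence. Convergence of the Lipschitz
  integrals along the whole sequence forces every subsequential limit to agree with it, and a
  sequence all of whose subsequences have further subsequences with the same limit
  converges.\<close>

lemma weak_lim_of_Lipschitz_convergent:
  fixes M :: "nat \<Rightarrow> 'a::euclidean_space measure"
  assumes M: "\<And>n. prob_space (M n)" "\<And>n. sets (M n) = sets borel"
    and C: "\<And>n. (\<integral>\<^sup>+x. ennreal ((norm x)\<^sup>2) \<partial>M n) \<le> ennreal C"
    and conv: "\<And>f K. (\<And>x. 0 \<le> f x) \<Longrightarrow> (\<And>x. f x \<le> 1) \<Longrightarrow> (\<And>x y. \<bar>f x - f y\<bar> \<le> K * dist x y) \<Longrightarrow>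
      continuous_on UNIV f \<Longrightarrow> convergent (\<lambda>n. LINT x|M n. (f x :: real))"
  obtains L where "prob_space L" "sets L = sets borel" "weak_lim M L"
proof -
  obtain r L where r: "strict_mono (r :: nat \<Rightarrow> nat)" and L: "prob_space L" "sets L = sets borel"
    and w: "weak_lim (M \<circ> r) L"
    by (rule prokhorov[OF M C])
  have Llim: "L' = L"
    if s: "strict_mono s" and L': "prob_space L'" "sets L' = sets borel" "weak_lim (M \<circ> s) L'"
    for s :: "nat \<Rightarrow> nat" and L'
  proof (rule measure_eqI_Lipschitz)
    fix f :: "'a \<Rightarrow> real" and K
    assume f: "\<And>x. 0 \<le> f x" "\<And>x. f x \<le> 1" "\<And>x y. \<bar>f x - f y\<bar> \<le> K * dist x y" "continuous_on UNIV f"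
    obtain a where a: "(\<lambda>n. LINT x|M n. f x) \<longlonglongrightarrow> a"
      using conv[OF f] by (auto simp: convergent_def)
    have b: "\<bar>f x\<bar> \<le> 1" for x using f(1,2)[of x] by simp
    have "(LINT x|L. f x) = a"
      using weak_limD[OF w f(4) b] LIMSEQ_subseq_LIMSEQ[OF a r] by (auto simp: o_def intro: LIMSEQ_unique)
    moreover have "(LINT x|L'. f x) = a"
      using weak_limD[OF L'(3) f(4) b] LIMSEQ_subseq_LIMSEQ[OF a s] by (auto simp: o_def intro: LIMSEQ_unique)
    ultimately show "(LINT x|L'. f x) = (LINT x|L. f x)" by simp
  qed (use L L' in auto)
  have "weak_lim M L"
    unfolding weak_lim_def
  proof (intro allI impI, rule ccontr)
    fix f :: "'a \<Rightarrow> real" assume f: "continuous_on UNIV f" "bounded (range f)"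
    assume "\<not> (\<lambda>n. LINT x|M n. f x) \<longlonglongrightarrow> (LINT x|L. f x)"
    then obtain e where e: "e > 0" "\<not> (\<forall>\<^sub>F n in sequentially. dist (LINT x|M n. f x) (LINT x|L. f x) < e)"
      by (auto simp: tendsto_iff)
    then have "\<exists>\<^sub>\<infinity>n. \<not> dist (LINT x|M n. f x) (LINT x|L. f x) < e"
      by (simp add: not_eventually cofinite_eq_sequentially)
    then have "infinite {n. \<not> dist (LINT x|M n. f x) (LINT x|L. f x) < e}"
      by (simp add: INFM_iff_infinite)
    then obtain s :: "nat \<Rightarrow> nat" where s: "strict_mono s" "\<And>n. \<not> dist (LINT x|M (s n). f x) (LINT x|L. f x) < e"
      using infinite_enumerate by (metis (no_types, lifting) mem_Collect_eq)
    obtain r' L' where r': "strict_mono (r' :: nat \<Rightarrow> nat)" and L': "prob_space L'" "sets L' = sets borel"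
      and w': "weak_lim ((\<lambda>n. M (s n)) \<circ> r') L'"
      by (rule prokhorov[of "\<lambda>n. M (s n)" C]) (use M C in auto)
    have "L' = L"
      by (rule Llim[of "s \<circ> r'"]) (use s r' L' w' in \<open>auto simp: o_def strict_mono_def\<close>)
    then have "(\<lambda>n. LINT x|M (s (r' n)). f x) \<longlonglongrightarrow> (LINT x|L. f x)"
      using w' f by (auto simp: weak_lim_def o_def)
    then have "\<forall>\<^sub>F n in sequentially. dist (LINT x|M (s (r' n)). f x) (LINT x|L. f x) < e"
      using e(1) by (auto simp: tendsto_iff)
    then show False using s(2) by (auto simp: eventually_sequentially)
  qed
  with L show ?thesis by (rule that)
qed

text \<open>An Arzela-Ascoli argument for laws of random positions on one probability space. A
  diagonal sequence converges at all rational times; the mean displacement bound, which holds up to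
  an error \<open>\<tau> n\<close> because step curves jump, transfers convergence of Lipschitz
  integrals to every other time. One subsequence thus serves all times.\<close>

lemma curve_compactness:
  fixes P :: "'b measure" and X :: "nat \<Rightarrow> real \<Rightarrow> 'b \<Rightarrow> 'a::euclidean_space"
  assumes "prob_space P" and T: "T > 0"
    and X: "\<And>n t. X n t \<in> borel_measurable P"
    and C: "\<And>n t. t \<in> {0..T} \<Longrightarrow> (\<integral>\<^sup>+\<omega>. ennreal ((norm (X n t \<omega>))\<^sup>2) \<partial>P) \<le> ennreal C"
    and int: "\<And>n s t. integrable P (\<lambda>\<omega>. dist (X n s \<omega>) (X n t \<omega>))"
    and H: "\<And>n s t. s \<in> {0..T} \<Longrightarrow> t \<in> {0..T} \<Longrightarrow>
      (LINT \<omega>|P. dist (X n s \<omega>) (X n t \<omega>)) \<le> sqrt (K * (\<bar>t - s\<bar> + \<tau> n))"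
    and K: "K > 0" and \<tau>: "\<tau> \<longlonglongrightarrow> 0"
  obtains r \<rho> where "strict_mono (r :: nat \<Rightarrow> nat)"
    "\<And>t. t \<in> {0..T} \<Longrightarrow> prob_space (\<rho> t)" "\<And>t. t \<in> {0..T} \<Longrightarrow> sets (\<rho> t) = sets borel"
    "\<And>t. t \<in> {0..T} \<Longrightarrow> weak_lim (\<lambda>n. distr P borel (X (r n) t)) (\<rho> t)"
proof -
  interpret P: prob_space P by fact
  define \<mu> where "\<mu> n t = distr P borel (X n t)" for n t
  have \<mu>: "prob_space (\<mu> n t)" "sets (\<mu> n t) = sets borel" for n t
    unfolding \<mu>_def using X by (auto intro: P.prob_space_distr)
  have \<mu>C: "(\<integral>\<^sup>+x. ennreal ((norm x)\<^sup>2) \<partial>\<mu> n t) \<le> ennreal C" if "t \<in> {0..T}" for n t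
    unfolding \<mu>_def using C[OF that] X by (subst nn_integral_distr) auto
  have \<mu>int: "(LINT x|\<mu> n t. f x) = (LINT \<omega>|P. f (X n t \<omega>))" if "continuous_on UNIV f" for f :: "'a \<Rightarrow> real" and n t
    unfolding \<mu>_def using X borel_measurable_continuous_onI[OF that] by (subst integral_distr) auto
  define q where "q = from_nat_into (\<rat> \<inter> {0..T})"
  have "range q = \<rat> \<inter> {0..T}"
    unfolding q_def using T by (intro range_from_nat_into) (auto simp: countable_rat intro!: exI[of _ 0])
  then have q: "q n \<in> {0..T}" "\<And>s. s \<in> \<rat> \<Longrightarrow> s \<in> {0..T} \<Longrightarrow> \<exists>n. s = q n" for n by auto
  \<comment> \<open>The \<open>n\<close>-th property of the diagonal construction is weak
    convergence at the rational time \<open>q n\<close>.\<close>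
  interpret subseqs "\<lambda>n s. \<exists>L. weak_lim (\<lambda>k. \<mu> (s k) (q n)) L"
  proof
    fix n and s :: "nat \<Rightarrow> nat" assume "strict_mono s"
    obtain r L where "strict_mono (r :: nat \<Rightarrow> nat)" "weak_lim ((\<lambda>k. \<mu> (s k) (q n)) \<circ> r) L"
      by (rule prokhorov[of "\<lambda>k. \<mu> (s k) (q n)" C]) (use \<mu> \<mu>C[OF q(1)] in auto)
    then show "\<exists>r'. strict_mono r' \<and> (\<exists>L. weak_lim (\<lambda>k. \<mu> ((s \<circ> r') k) (q n)) L)"
      by (auto simp: o_def)
  qed
  define r where "r = diagseq"
  have r: "strict_mono r" unfolding r_def by (rule subseq_diagseq)
  have conv_q: "convergent (\<lambda>n. LINT x|\<mu> (r n) (q k). f x)"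
    if f: "continuous_on UNIV f" "\<And>x. \<bar>f x\<bar> \<le> B" for f :: "'a \<Rightarrow> real" and B k
  proof -
    have "\<exists>L. weak_lim (\<lambda>j. \<mu> ((diagseq \<circ> (+) (Suc k)) j) (q k)) L"
    proof (rule diagseq_holds)
      fix r s :: "nat \<Rightarrow> nat" and n
      assume "strict_mono r" "\<exists>L. weak_lim (\<lambda>k. \<mu> (s k) (q n)) L"
      then show "\<exists>L. weak_lim (\<lambda>k. \<mu> ((s \<circ> r) k) (q n)) L"
        using weak_lim_subseq[of "\<lambda>k. \<mu> (s k) (q n)"] by (auto simp: o_def)
    qed
    then obtain L where "weak_lim (\<lambda>j. \<mu> (r (Suc k + j)) (q k)) L" by (auto simp: r_def)
    from weak_limD[OF this f] have "(\<lambda>j. LINT x|\<mu> (r (j + Suc k)) (q k). f x) \<longlonglongrightarrow> (LINT x|L. f x)"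
      by (simp add: add.commute)
    then have "(\<lambda>j. LINT x|\<mu> (r j) (q k). f x) \<longlonglongrightarrow> (LINT x|L. f x)"
      by (rule LIMSEQ_offset)
    then show ?thesis by (auto simp: convergent_def)
  qed
  have "\<exists>L. prob_space L \<and> sets L = sets borel \<and> weak_lim (\<lambda>n. \<mu> (r n) t) L" if t: "t \<in> {0..T}" for t
  proof -
    have conv: "convergent (\<lambda>n. LINT x|\<mu> (r n) t. f x)"
      if f: "\<And>x. 0 \<le> f x" "\<And>x. f x \<le> 1" "\<And>x y. \<bar>f x - f y\<bar> \<le> M * dist x y" "continuous_on UNIV f"
      for f :: "'a \<Rightarrow> real" and M
    proof -
      define M' where "M' = max M 1"
      have M': "M' > 0" "\<bar>f x - f y\<bar> \<le> M' * dist x y" for x y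
        using f(3)[of x y] mult_right_mono[of M M' "dist x y"] by (auto simp: M'_def)
      have b: "\<bar>f x\<bar> \<le> 1" for x using f(1,2)[of x] by simp
      have fint: "integrable P (\<lambda>\<omega>. f (X n s \<omega>))" for n s
        using X borel_measurable_continuous_onI[OF f(4)] b
        by (intro P.integrable_const_bound[where B=1]) auto
      have near: "\<bar>(LINT x|\<mu> n t. f x) - (LINT x|\<mu> n s. f x)\<bar> \<le> M' * sqrt (K * (\<bar>t - s\<bar> + \<tau> n))"
        if s: "s \<in> {0..T}" for n s
      proof -
        have "\<bar>(LINT x|\<mu> n t. f x) - (LINT x|\<mu> n s. f x)\<bar> = \<bar>LINT \<omega>|P. f (X n t \<omega>) - f (X n s \<omega>)\<bar>"
          using fint by (simp add: \<mu>int[OF f(4)])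
        also have "\<dots> \<le> (LINT \<omega>|P. \<bar>f (X n t \<omega>) - f (X n s \<omega>)\<bar>)" by (rule integral_abs_bound)
        also have "\<dots> \<le> (LINT \<omega>|P. M' * dist (X n s \<omega>) (X n t \<omega>))"
        proof (intro integral_mono)
          show "\<bar>f (X n t \<omega>) - f (X n s \<omega>)\<bar> \<le> M' * dist (X n s \<omega>) (X n t \<omega>)" for \<omega>
            using M'(2)[of "X n t \<omega>" "X n s \<omega>"] by (simp add: dist_commute)
        qed (use fint int[of n s t] in auto)
        also have "\<dots> = M' * (LINT \<omega>|P. dist (X n s \<omega>) (X n t \<omega>))" by simp
        also have "\<dots> \<le> M' * sqrt (K * (\<bar>t - s\<bar> + \<tau> n))"
          using H[OF s t] M'(1) by (intro mult_left_mono) auto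
        finally show ?thesis .
      qed
      have "Cauchy (\<lambda>n. LINT x|\<mu> (r n) t. f x)"
      proof (rule metric_CauchyI)
        fix e :: real assume e: "e > 0"
        \<comment> \<open>Chosen so that \<open>K * (2 * d)\<close> is the square of
          \<open>e / (4 * M')\<close>; one \<open>d\<close> is for the gap between the times, the
          other for \<open>\<tau>\<close>.\<close>
        define d where "d = (e / (4 * M'))\<^sup>2 / (2 * K)"
        have d: "d > 0" using e M'(1) K by (simp add: d_def)
        have "max 0 (t - d) < min T (t + d)" using t d T by auto
        then obtain s where s: "s \<in> \<rat>" "max 0 (t - d) < s" "s < min T (t + d)"
          using Rats_dense_in_real by blast
        then have s': "s \<in> {0..T}" "\<bar>t - s\<bar> < d" by auto
        then obtain k where k: "s = q k" using q(2)[OF s(1)] by blast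
        obtain N1 where N1: "\<And>n. n \<ge> N1 \<Longrightarrow> \<tau> n < d"
          using order_tendstoD(2)[OF \<tau> d] by (auto simp: eventually_sequentially)
        have "Cauchy (\<lambda>n. LINT x|\<mu> (r n) s. f x)"
          unfolding k using conv_q[OF f(4) b] by (simp add: Cauchy_convergent_iff)
        then obtain N2 where N2: "\<And>m n. m \<ge> N2 \<Longrightarrow> n \<ge> N2 \<Longrightarrow>
            dist (LINT x|\<mu> (r m) s. f x) (LINT x|\<mu> (r n) s. f x) < e / 2"
          using metric_CauchyD[of _ "e/2"] e by (metis half_gt_zero)
        have near': "\<bar>(LINT x|\<mu> (r n) t. f x) - (LINT x|\<mu> (r n) s. f x)\<bar> \<le> e / 4" if "n \<ge> N1" for n
        proof -
          have "r n \<ge> N1" using seq_suble[OF r, of n] that by linarith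
          then have "\<bar>t - s\<bar> + \<tau> (r n) \<le> 2 * d" using N1[of "r n"] s'(2) by linarith
          then have "K * (\<bar>t - s\<bar> + \<tau> (r n)) \<le> K * (2 * d)" using K by (intro mult_left_mono) auto
          also have "\<dots> = (e / (4 * M'))\<^sup>2" using K by (simp add: d_def)
          finally have "sqrt (K * (\<bar>t - s\<bar> + \<tau> (r n))) \<le> e / (4 * M')"
            using e M'(1) by (intro real_le_lsqrt) auto
          then have "M' * sqrt (K * (\<bar>t - s\<bar> + \<tau> (r n))) \<le> M' * (e / (4 * M'))"
            using M'(1) by (intro mult_left_mono) auto
          also have "\<dots> = e / 4" using M'(1) by simp
          finally show ?thesis using near[OF s'(1), of "r n"] by linarith
        qed
        show "\<exists>N. \<forall>m\<ge>N. \<forall>n\<ge>N. dist (LINT x|\<mu> (r m) t. f x) (LINT x|\<mu> (r n) t. f x) < e"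
        proof (intro exI[of _ "max N1 N2"] allI impI)
          fix m n assume "m \<ge> max N1 N2" "n \<ge> max N1 N2"
          then show "dist (LINT x|\<mu> (r m) t. f x) (LINT x|\<mu> (r n) t. f x) < e"
            using near'[of m] near'[of n] N2[of m n] e unfolding dist_real_def by linarith
        qed
      qed
      then show ?thesis by (simp add: Cauchy_convergent_iff)
    qed
    obtain L where "prob_space L" "sets L = sets borel" "weak_lim (\<lambda>n. \<mu> (r n) t) L"
    proof (rule weak_lim_of_Lipschitz_convergent[of "\<lambda>n. \<mu> (r n) t" C])
      show "convergent (\<lambda>n. LINT x|\<mu> (r n) t. f x)"
        if "\<And>x. 0 \<le> f x" "\<And>x. f x \<le> 1" "\<And>x y. \<bar>f x - f y\<bar> \<le> K * dist x y" "continuous_on UNIV f"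
        for f :: "'a \<Rightarrow> real" and K
        using that by (rule conv)
    qed (use \<mu> \<mu>C[OF t] in auto)
    then show ?thesis by blast
  qed
  then obtain \<rho> where "\<And>t. t \<in> {0..T} \<Longrightarrow> prob_space (\<rho> t) \<and> sets (\<rho> t) = sets borel \<and> weak_lim (\<lambda>n. \<mu> (r n) t) (\<rho> t)"
    by metis
  then show ?thesis
    using that[of r \<rho>] r by (auto simp: \<mu>_def)
qed

text \<open>The joint laws of \<open>X k\<close> and \<open>Z k\<close> have bounded second moments
  on the product space. A subsequential limit has marginals \<open>\<mu>\<close> and
  \<open>\<nu>\<close>, hence is a coupling, and its cost is bounded by lower semicontinuity. The
  common space \<open>P\<close> supplies the couplings before the limit.\<close>

lemma wasserstein2_weak_lim_le:
  fixes X Z :: "nat \<Rightarrow> 'b \<Rightarrow> 'a::euclidean_space"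
  assumes P: "prob_space P"
    and X: "\<And>k. X k \<in> borel_measurable P" and Z: "\<And>k. Z k \<in> borel_measurable P"
    and C: "\<And>k. (\<integral>\<^sup>+\<omega>. ennreal ((norm (X k \<omega>))\<^sup>2) \<partial>P) \<le> ennreal C" "\<And>k. (\<integral>\<^sup>+\<omega>. ennreal ((norm (Z k \<omega>))\<^sup>2) \<partial>P) \<le> ennreal C"
    and \<mu>: "weak_lim (\<lambda>k. distr P borel (X k)) \<mu>" "prob_space \<mu>" "sets \<mu> = sets borel"
    and \<nu>: "weak_lim (\<lambda>k. distr P borel (Z k)) \<nu>" "prob_space \<nu>" "sets \<nu> = sets borel"
    and c: "c \<ge> 0" "\<And>k. (\<integral>\<^sup>+\<omega>. ennreal ((dist (X k \<omega>) (Z k \<omega>))\<^sup>2) \<partial>P) \<le> ennreal (c\<^sup>2)"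
  shows "wasserstein2 \<mu> \<nu> \<le> c"
proof -
  interpret P: prob_space P by fact
  define g where "g k = distr P borel (\<lambda>\<omega>. (X k \<omega>, Z k \<omega>))" for k
  have XZ: "(\<lambda>\<omega>. (X k \<omega>, Z k \<omega>)) \<in> borel_measurable P" for k
    using X Z by (rule borel_measurable_Pair)
  have g: "prob_space (g k)" "sets (g k) = sets borel" for k
    unfolding g_def using XZ by (auto intro: P.prob_space_distr)
  have gC: "(\<integral>\<^sup>+z. ennreal ((norm z)\<^sup>2) \<partial>g k) \<le> ennreal (2 * max C 0)" for k
  proof -
    have "(\<integral>\<^sup>+z. ennreal ((norm z)\<^sup>2) \<partial>g k) = (\<integral>\<^sup>+\<omega>. ennreal ((norm (X k \<omega>))\<^sup>2) + ennreal ((norm (Z k \<omega>))\<^sup>2) \<partial>P)"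
      unfolding g_def using XZ by (subst nn_integral_distr) (auto simp: norm_Pair ennreal_plus[symmetric] simp del: ennreal_plus)
    also have "\<dots> = (\<integral>\<^sup>+\<omega>. ennreal ((norm (X k \<omega>))\<^sup>2) \<partial>P) + (\<integral>\<^sup>+\<omega>. ennreal ((norm (Z k \<omega>))\<^sup>2) \<partial>P)"
    proof -
      note [measurable] = X[of k] Z[of k]
      show ?thesis by (intro nn_integral_add) measurable
    qed
    also have "\<dots> \<le> ennreal (max C 0) + ennreal (max C 0)"
      using C by (intro add_mono order_trans[OF C(1)] order_trans[OF C(2)] ennreal_leI) auto
    finally show ?thesis by (subst (asm) ennreal_plus[symmetric]) auto
  qed
  obtain r \<gamma> where r: "strict_mono (r :: nat \<Rightarrow> nat)" and \<gamma>: "prob_space \<gamma>" "sets \<gamma> = sets borel"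
    and w: "weak_lim (g \<circ> r) \<gamma>"
    by (rule prokhorov[OF g gC])
  interpret \<gamma>: prob_space \<gamma> by fact
  have meas_\<gamma>: "f \<in> borel_measurable \<gamma>" if "f \<in> borel_measurable borel" for f :: "'a \<times> 'a \<Rightarrow> 'c::topological_space"
    using that by (subst measurable_cong_sets[OF \<gamma>(2) refl])
  \<comment> \<open>Both marginals at once: \<open>p\<close> is a projection and \<open>V\<close>
    the corresponding sequence of positions. Image measures under the continuous \<open>p\<close>
    pass to the weak limit, which is unique.\<close>
  have marginal: "distr \<gamma> borel p = L"
    if p: "continuous_on UNIV p" and L: "weak_lim (\<lambda>k. distr P borel (V k)) L" "prob_space L" "sets L = sets borel"
      and V: "\<And>k \<omega>. p (X k \<omega>, Z k \<omega>) = V k \<omega>"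
    for p :: "'a \<times> 'a \<Rightarrow> 'a" and V L
  proof (rule weak_lim_unique)
    have pm: "p \<in> borel_measurable borel" using p by (rule borel_measurable_continuous_onI)
    have Vm: "V k \<in> borel_measurable P" for k
      using measurable_compose[OF XZ pm, of k] by (simp add: V)
    show "weak_lim (\<lambda>k. distr P borel (V (r k))) L"
      using weak_lim_subseq[OF L(1) r] by (simp add: o_def)
    show "prob_space (distr \<gamma> borel p)" using meas_\<gamma>[OF pm] by (rule \<gamma>.prob_space_distr)
    show "weak_lim (\<lambda>k. distr P borel (V (r k))) (distr \<gamma> borel p)"
      unfolding weak_lim_def
    proof (intro allI impI)
      fix f :: "'a \<Rightarrow> real" assume f: "continuous_on UNIV f" "bounded (range f)"
      have fm: "f \<in> borel_measurable borel" using f(1) by (rule borel_measurable_continuous_onI)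
      have fp: "continuous_on UNIV (\<lambda>z. f (p z))" by (rule continuous_on_compose2[OF f(1) p]) auto
      have "bounded (range (\<lambda>z. f (p z)))" by (rule bounded_subset[OF f(2)]) auto
      then have "(\<lambda>n. LINT z|(g \<circ> r) n. f (p z)) \<longlonglongrightarrow> (LINT z|\<gamma>. f (p z))"
        using w fp by (auto simp: weak_lim_def)
      moreover have "(LINT z|(g \<circ> r) n. f (p z)) = (LINT x|distr P borel (V (r n)). f x)" for n
        unfolding g_def o_def using XZ Vm fm borel_measurable_continuous_onI[OF fp]
        by (simp add: integral_distr V)
      moreover have "(LINT z|\<gamma>. f (p z)) = (LINT x|distr \<gamma> borel p. f x)"
        using meas_\<gamma>[OF pm] fm by (simp add: integral_distr)
      ultimately show "(\<lambda>n. LINT x|distr P borel (V (r n)). f x) \<longlonglongrightarrow> (LINT x|distr \<gamma> borel p. f x)"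
        by simp
    qed
  qed (use L in auto)
  have "\<gamma> \<in> couplings \<mu> \<nu>"
    unfolding couplings_def
  proof (intro CollectI conjI \<gamma>)
    show "distr \<gamma> borel fst = \<mu>" by (rule marginal[OF _ \<mu>]) (auto intro: continuous_intros)
    show "distr \<gamma> borel snd = \<nu>" by (rule marginal[OF _ \<nu>]) (auto intro: continuous_intros)
  qed
  moreover have "(\<integral>\<^sup>+z. ennreal ((dist (fst z) (snd z))\<^sup>2) \<partial>\<gamma>) \<le> ennreal (c\<^sup>2)"
  proof (rule weak_lim_nn_integral_le[OF w])
    show "continuous_on UNIV (\<lambda>z::'a \<times> 'a. (dist (fst z) (snd z))\<^sup>2)" by (intro continuous_intros)
    have "(\<integral>\<^sup>+z. ennreal ((dist (fst z) (snd z))\<^sup>2) \<partial>g k) \<le> ennreal (c\<^sup>2)" for k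
      unfolding g_def using XZ[of k] c(2)[of k]
      by (subst nn_integral_distr)
        (auto intro!: measurable_compose[OF _ measurable_ennreal] borel_measurable_continuous_onI continuous_intros)
    then show "(\<integral>\<^sup>+z. ennreal ((dist (fst z) (snd z))\<^sup>2) \<partial>(g \<circ> r) n) \<le> ennreal (c\<^sup>2)" for n by simp
  qed (use g \<gamma> in auto)
  ultimately show ?thesis using c(1) by (rule wasserstein2_le)
qed

text \<open>Left-open intervals match the ceiling: on the interval ending at
  \<open>real (Suc k) * \<tau>\<close> the function has the value with index \<open>Suc k\<close>,
  the new point of an implicit step. Hence the shifted index in the sum.\<close>

lemma step_function_integral:
  fixes F :: "nat \<Rightarrow> real"
  assumes \<tau>: "\<tau> > 0" and "j \<le> k"
  shows "set_integrable lborel {real j * \<tau><..real k * \<tau>} (\<lambda>r. F (nat \<lceil>r / \<tau>\<rceil>)) \<and>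
    (LINT r:{real j * \<tau><..real k * \<tau>}|lborel. F (nat \<lceil>r / \<tau>\<rceil>)) = \<tau> * (\<Sum>i=j..<k. F (Suc i))"
  using \<open>j \<le> k\<close>
proof (induction k rule: dec_induct)
  case base
  then show ?case by (simp add: set_lebesgue_integral_def)
next
  case (step k)
  have jk: "real j * \<tau> \<le> real k * \<tau>" "real k * \<tau> \<le> real (Suc k) * \<tau>"
    using step(1) \<tau> by (auto intro!: mult_right_mono)
  have split: "{real j * \<tau><..real (Suc k) * \<tau>} = {real j * \<tau><..real k * \<tau>} \<union> {real k * \<tau><..real (Suc k) * \<tau>}"
    using jk by auto
  have const: "nat \<lceil>r / \<tau>\<rceil> = Suc k" if "r \<in> {real k * \<tau><..real (Suc k) * \<tau>}" for r
  proof -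
    have "\<lceil>r / \<tau>\<rceil> = int (Suc k)"
      using that \<tau> by (intro ceiling_unique) (auto simp: field_simps)
    then show ?thesis by simp
  qed
  have eq: "set_integrable lborel {real k * \<tau><..real (Suc k) * \<tau>} (\<lambda>r. F (nat \<lceil>r / \<tau>\<rceil>)) \<longleftrightarrow>
      set_integrable lborel {real k * \<tau><..real (Suc k) * \<tau>} (\<lambda>r. F (Suc k))"
    by (rule set_integrable_cong) (use const in auto)
  have int: "set_integrable lborel {real k * \<tau><..real (Suc k) * \<tau>} (\<lambda>r. F (nat \<lceil>r / \<tau>\<rceil>))"
    unfolding eq unfolding set_integrable_def
    using jk by (intro integrable_scaleR_left integrable_real_indicator) auto
  have "(LINT r:{real k * \<tau><..real (Suc k) * \<tau>}|lborel. F (nat \<lceil>r / \<tau>\<rceil>))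
      = (LINT r:{real k * \<tau><..real (Suc k) * \<tau>}|lborel. F (Suc k))"
    by (rule set_lebesgue_integral_cong) (use const in auto)
  also have "\<dots> = \<tau> * F (Suc k)"
    using jk \<tau> by (simp add: set_lebesgue_integral_def algebra_simps)
  finally have val: "(LINT r:{real k * \<tau><..real (Suc k) * \<tau>}|lborel. F (nat \<lceil>r / \<tau>\<rceil>)) = \<tau> * F (Suc k)" .
  show ?case
  proof
    show "set_integrable lborel {real j * \<tau><..real (Suc k) * \<tau>} (\<lambda>r. F (nat \<lceil>r / \<tau>\<rceil>))"
      unfolding split using step(3) int by (intro set_integrable_Un) auto
    have "(LINT r:{real j * \<tau><..real (Suc k) * \<tau>}|lborel. F (nat \<lceil>r / \<tau>\<rceil>))
        = \<tau> * (\<Sum>i=j..<k. F (Suc i)) + \<tau> * F (Suc k)"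
      unfolding split using step(3) int val by (subst set_integral_Un) auto
    then show "(LINT r:{real j * \<tau><..real (Suc k) * \<tau>}|lborel. F (nat \<lceil>r / \<tau>\<rceil>)) = \<tau> * (\<Sum>i=j..<Suc k. F (Suc i))"
      using step(1) by (simp add: algebra_simps)
  qed
qed

text \<open>The bridge between random positions and finite weighted systems: the labels are the
  values of \<open>s\<close>, weighted by the measure of their preimages. As \<open>s\<close> has
  finite range, \<open>g\<close> may be arbitrary.\<close>

lemma (in prob_space) integral_simple_function_image:
  fixes g :: "'b \<Rightarrow> real"
  assumes s: "simple_function M s"
  shows "(LINT \<omega>|M. g (s \<omega>)) = (\<Sum>i\<in>s ` space M. measure M (s -` {i} \<inter> space M) * g i)"
proof -
  have fin: "finite (s ` space M)" using s by (simp add: simple_function_def)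
  have sets: "s -` {i} \<inter> space M \<in> sets M" if "i \<in> s ` space M" for i
    using s that by (auto simp: simple_function_def)
  have "(LINT \<omega>|M. g (s \<omega>)) = (LINT \<omega>|M. (\<Sum>i\<in>s ` space M. indicator (s -` {i} \<inter> space M) \<omega> * g i))"
  proof (intro Bochner_Integration.integral_cong refl)
    fix \<omega> assume \<omega>: "\<omega> \<in> space M"
    have "(\<Sum>i\<in>s ` space M. indicator (s -` {i} \<inter> space M) \<omega> * g i)
        = (\<Sum>i\<in>s ` space M. if i = s \<omega> then g i else 0)"
      using \<omega> by (intro sum.cong) (auto simp: indicator_def)
    then show "g (s \<omega>) = (\<Sum>i\<in>s ` space M. indicator (s -` {i} \<inter> space M) \<omega> * g i)"
      using fin \<omega> by simp
  qed
  also have "\<dots> = (\<Sum>i\<in>s ` space M. measure M (s -` {i} \<inter> space M) * g i)"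
  proof (subst Bochner_Integration.integral_sum)
    show "integrable M (\<lambda>\<omega>. indicator (s -` {i} \<inter> space M) \<omega> * g i)" if "i \<in> s ` space M" for i
      using sets[OF that] by (intro integrable_mult_left integrable_real_indicator) (auto simp: less_top[symmetric])
    show "(\<Sum>i\<in>s ` space M. LINT \<omega>|M. indicator (s -` {i} \<inter> space M) \<omega> * g i)
        = (\<Sum>i\<in>s ` space M. measure M (s -` {i} \<inter> space M) * g i)"
      using sets by (intro sum.cong refl) (simp add: Int_absorb2)
  qed
  finally show ?thesis .
qed

lemma (in prob_space) integral_square_le:
  fixes X :: "'a \<Rightarrow> real"
  assumes "integrable M X" "integrable M (\<lambda>x. (X x)\<^sup>2)"
  shows "(expectation X)\<^sup>2 \<le> expectation (\<lambda>x. (X x)\<^sup>2)"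
  using variance_eq[OF assms] variance_positive[of X] by simp

lemma (in prob_space) integrable_simple_function_image:
  fixes g :: "'b \<Rightarrow> real"
  assumes s: "simple_function M s"
  shows "integrable M (\<lambda>\<omega>. g (s \<omega>))"
proof (rule integrable_const_bound[where B="\<Sum>i\<in>s ` space M. \<bar>g i\<bar>"])
  have "finite (s ` space M)" using s by (simp add: simple_function_def)
  then show "AE \<omega> in M. norm (g (s \<omega>)) \<le> (\<Sum>i\<in>s ` space M. \<bar>g i\<bar>)"
    by (intro AE_I2) (auto intro!: member_le_sum)
  show "(\<lambda>\<omega>. g (s \<omega>)) \<in> borel_measurable M"
    by (intro borel_measurable_simple_function simple_function_compose1[OF s])
qed

lemma sum_shift_le:
  fixes d :: "nat \<Rightarrow> real"
  assumes "\<And>k. d k \<ge> 0" "j + m \<le> n"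
  shows "(\<Sum>k<m. d (j + k)) \<le> (\<Sum>k<n. d k)"
proof -
  have "(\<Sum>k<m. d (j + k)) = (\<Sum>k\<in>(+) j ` {..<m}. d k)"
    by (subst sum.reindex) (auto simp: o_def)
  also have "\<dots> \<le> (\<Sum>k<n. d k)" using assms by (intro sum_mono2) auto
  finally show ?thesis .
qed

section \<open>The rescaled kernel and the reference densities\<close>

lemma rescale_GDERIV:
  fixes V :: "'a::euclidean_space \<Rightarrow> real"
  assumes "\<And>x. GDERIV V x :> g x"
  shows "GDERIV (rescale \<epsilon> V) x :> ((1 / \<epsilon>) ^ DIM('a) / \<epsilon>) *\<^sub>R g (x /\<^sub>R \<epsilon>)"
proof -
  have "(V has_derivative (\<lambda>u. u \<bullet> g (x /\<^sub>R \<epsilon>))) (at (x /\<^sub>R \<epsilon>))"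
    using assms by (simp add: gderiv_def)
  moreover have "((\<lambda>x. x /\<^sub>R \<epsilon>) has_derivative (\<lambda>h. h /\<^sub>R \<epsilon>)) (at x)"
    by (auto intro!: derivative_eq_intros)
  ultimately have "((\<lambda>x. V (x /\<^sub>R \<epsilon>)) has_derivative (\<lambda>h. (h /\<^sub>R \<epsilon>) \<bullet> g (x /\<^sub>R \<epsilon>))) (at x)"
    by (rule has_derivative_compose[rotated])
  then have "(rescale \<epsilon> V has_derivative (\<lambda>h. (1 / \<epsilon>) ^ DIM('a) * ((h /\<^sub>R \<epsilon>) \<bullet> g (x /\<^sub>R \<epsilon>)))) (at x)"
    unfolding rescale_def[abs_def] by (rule has_derivative_mult_right)
  then show ?thesis
    unfolding gderiv_def
    by (rule back_subst[of "\<lambda>D. (_ has_derivative D) _"]) (auto simp: fun_eq_iff divide_inverse mult_ac)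
qed

text \<open>Oddness lets the derivative of \<open>W (y - Y i)\<close> in the particle position be
  written with \<open>gW (Y i - y)\<close>, the kernel of the convolution in the equation.\<close>

lemma GDERIV_even_odd:
  fixes V :: "'a::real_inner \<Rightarrow> real"
  assumes "\<And>x. GDERIV V x :> g x" "\<And>x. V x = V (- x)"
  shows "g (- x) = - g x"
proof -
  have "(V has_derivative (\<lambda>u. u \<bullet> g (- x))) (at (- x))"
    using assms by (simp add: gderiv_def)
  moreover have "((\<lambda>x. - x) has_derivative (\<lambda>h. - h)) (at x)"
    by (auto intro!: derivative_eq_intros)
  ultimately have "((\<lambda>x. V (- x)) has_derivative (\<lambda>h. (- h) \<bullet> g (- x))) (at x)"
    by (rule has_derivative_compose[rotated])
  then have "(V has_derivative (\<lambda>h. h \<bullet> (- g (- x)))) (at x)"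
    using assms(2) by simp
  then have "GDERIV V x :> - g (- x)" by (simp add: gderiv_def)
  then have "g x = - g (- x)" using assms(1) GDERIV_unique by blast
  then show ?thesis by simp
qed

text \<open>The bound \<open>norm x \<le> japanese x ^ p\<close> holds for both exponents, so
  \<open>exp (- norm x)\<close> dominates the numerator and the normalising integral is a genuine
  positive number. From here on both reference densities are represented by these three
  properties.\<close>

lemma Nref_properties:
  assumes "N = (Nref 1 :: 'a::euclidean_space \<Rightarrow> real) \<or> N = Nref 2"
  obtains B where "continuous_on UNIV N" "\<And>x. N x > 0" "\<And>x. N x \<le> B"
proof -
  obtain p :: nat where p: "p = 1 \<or> p = 2" "N = Nref p" using assms by blast
  define f where "f x = exp (- (japanese x ^ p))" for x :: 'a
  have fc: "continuous_on UNIV f"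
    unfolding f_def japanese_def by (intro continuous_intros)
  have jp: "norm x \<le> japanese x ^ p" for x :: 'a
  proof (cases "p = 1")
    case True
    then show ?thesis unfolding japanese_def by (auto intro: real_le_rsqrt)
  next
    case False
    then have "japanese x ^ p = 1 + (norm x)\<^sup>2" using p(1) by (simp add: japanese_def)
    moreover have "2 * norm x \<le> 1 + (norm x)\<^sup>2" using sum_squares_bound[of 1 "norm x"] by simp
    ultimately show ?thesis using norm_ge_zero[of x] by linarith
  qed
  have fint: "integrable lborel f"
    by (rule Bochner_Integration.integrable_bound[OF integrable_exp_minus_norm])
      (use jp borel_measurable_continuous_onI[OF fc] in \<open>auto simp: f_def\<close>)
  define Z where "Z = (LINT y|lborel. f y)"
  have "Z \<noteq> 0"
  proof
    assume "Z = 0"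
    then have "AE y in lborel. f y = 0"
      unfolding Z_def using fint by (subst (asm) integral_nonneg_eq_0_iff_AE) (auto simp: f_def)
    \<comment> \<open>A positive function vanishing almost everywhere would force Lebesgue measure
      to be zero.\<close>
    then have "AE y in (lborel :: 'a measure). False" by (simp add: f_def)
    then have "ae_filter (lborel :: 'a measure) = bot" by (simp only: trivial_limit_def)
    then show False by (simp add: ae_filter_eq_bot_iff)
  qed
  moreover have "Z \<ge> 0" unfolding Z_def by (intro integral_nonneg_AE) (auto simp: f_def)
  ultimately have Z: "Z > 0" by simp
  have N: "N x = f x / Z" for x by (simp add: p(2) Nref_def f_def Z_def)
  show ?thesis
  proof (rule that[of "1 / Z"])
    show "continuous_on UNIV N" unfolding N[abs_def] using Z by (intro continuous_intros fc) auto
    show "N x > 0" for x using Z by (simp add: N f_def)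
    show "N x \<le> 1 / Z" for x
    proof -
      have "f x \<le> 1" using order_trans[OF norm_ge_zero jp[of x]] by (simp add: f_def)
      then show ?thesis using Z by (simp add: N divide_right_mono)
    qed
  qed
qed

section \<open>The mollified entropy of finite particle systems\<close>

lemma integrable_continuous_compact_support:
  fixes f :: "'a::euclidean_space \<Rightarrow> 'b::{banach, second_countable_topology}"
  assumes "continuous_on UNIV f" "\<And>x. norm x > R \<Longrightarrow> f x = 0"
  shows "integrable lborel f"
proof -
  have "integrable lborel (\<lambda>x. indicator (cball 0 R) x *\<^sub>R f x)"
    by (intro borel_integrable_compact continuous_on_subset[OF assms(1)]) auto
  also have "(\<lambda>x. indicator (cball 0 R) x *\<^sub>R f x) = f"
    using assms(2) by (auto simp: fun_eq_iff indicator_def not_le)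
  finally show ?thesis .
qed

lemma lborel_integral_shift:
  fixes f :: "'a::euclidean_space \<Rightarrow> real"
  assumes [measurable]: "f \<in> borel_measurable borel"
  shows "(LINT y|lborel. f (y - c)) = (LINT y|lborel. f y)"
proof -
  have "(LINT y|lborel. f (y - c)) = (LINT y|distr lborel borel ((+) c). f (y - c))"
    by (simp add: lborel_distr_plus)
  also have "\<dots> = (LINT y|lborel. f y)"
    by (subst integral_distr) auto
  finally show ?thesis .
qed

text \<open>The function \<open>a * ln a + c * a\<close> has its minimum
  \<open>- exp (- 1 - c)\<close> at \<open>a = exp (- 1 - c)\<close>; the proof applies
  \<open>ln t \<le> t - 1\<close> at \<open>t = 1 / (a * exp (1 + c))\<close>.\<close>

lemma xlnx_lower:
  fixes a c :: real
  assumes "a > 0"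
  shows "- exp (- 1 - c) \<le> a * ln a + c * a"
proof -
  define x where "x = a * exp (1 + c)"
  have x: "x > 0" using assms by (simp add: x_def)
  have "ln (1 / x) \<le> 1 / x - 1" using x by (intro ln_le_minus_one) auto
  then have "- (1 / x) \<le> ln x - 1" using x by (simp add: ln_div)
  also have "ln x = ln a + 1 + c" using assms by (simp add: x_def ln_mult)
  finally have "- (1 / x) \<le> ln a + c" by simp
  then have "a * - (1 / x) \<le> a * (ln a + c)" using assms by (intro mult_left_mono) auto
  moreover have "a * - (1 / x) = - exp (- 1 - c)"
    using assms by (simp add: x_def exp_diff exp_minus exp_add field_simps)
  ultimately show ?thesis by (simp add: algebra_simps)
qed

text \<open>The linear term makes \<open>ln\<close> the exact derivative of \<open>ent\<close>; since the mass of the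
  mixture is conserved it changes the entropy functional only by a constant.\<close>

definition ent :: "real \<Rightarrow> real" where
  "ent s = s * ln s - s"

text \<open>The difference is \<open>a * ln (a + b)\<close> plus
  \<open>b * ln (1 + a / b) - a\<close>, and the second part is at most 0.\<close>

lemma ent_diff_upper:
  assumes "a \<ge> 0" "b > 0" "a + b \<le> M"
  shows "ent (a + b) - ent b \<le> a * ln M"
proof -
  have "ln (a + b) - ln b = ln (1 + a / b)"
    using assms by (subst ln_divide_pos[symmetric]) (auto simp: field_simps)
  also have "\<dots> \<le> a / b" using assms by (intro ln_add_one_self_le_self) auto
  finally have "b * (ln (a + b) - ln b) \<le> b * (a / b)" using assms by (intro mult_left_mono) auto
  then have "b * (ln (a + b) - ln b) \<le> a" using assms by simp
  moreover have "a * ln (a + b) \<le> a * ln M" using assms by (intro mult_left_mono) auto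
  ultimately show ?thesis by (simp add: ent_def algebra_simps)
qed

text \<open>By monotonicity of the logarithm \<open>ent (a + b) - ent b\<close> is at least
  \<open>a * ln a - a\<close>, a bound without \<open>b\<close>. The free \<open>c\<close> is later
  chosen to grow with \<open>y\<close>, so that the exponential becomes integrable in space.\<close>

lemma ent_diff_lower:
  assumes "a \<ge> 0" "b > 0"
  shows "- c * a - exp (- 1 - c) - a \<le> ent (a + b) - ent b"
proof (cases "a = 0")
  case False
  then have a: "a > 0" using assms by simp
  have "a * ln a \<le> a * ln (a + b)" "b * ln b \<le> b * ln (a + b)"
    using a assms by (auto intro!: mult_left_mono)
  then show ?thesis using xlnx_lower[OF a, of c] by (simp add: ent_def algebra_simps)
qed simp

lemma ent_has_derivative:
  assumes "(m has_field_derivative D) (at h within S)" "m h > 0"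
  shows "((\<lambda>h. ent (m h)) has_field_derivative D * ln (m h)) (at h within S)"
proof -
  have "((\<lambda>h. m h * ln (m h) - m h) has_field_derivative (D * ln (m h) + (1 / m h * D) * m h - D)) (at h within S)"
    using assms by (auto intro!: derivative_eq_intros)
  then show ?thesis using assms(2) by (simp add: ent_def)
qed

text \<open>Bolzano-Weierstrass for vectors indexed by a finite set; the number of particles varies
  with the approximation, so the configuration space is not one fixed Euclidean type.\<close>

lemma finite_index_subsequence:
  fixes Y :: "nat \<Rightarrow> 'i \<Rightarrow> 'a::euclidean_space"
  assumes "finite I" "\<And>i. i \<in> I \<Longrightarrow> bounded (range (\<lambda>k. Y k i))"
  shows "\<exists>r l. strict_mono (r :: nat \<Rightarrow> nat) \<and> (\<forall>i\<in>I. (\<lambda>k. Y (r k) i) \<longlonglongrightarrow> l i)"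
  using assms
proof (induction I rule: finite_induct)
  case empty
  then show ?case by (intro exI[of _ id]) (auto simp: strict_mono_id)
next
  case (insert i I)
  then obtain r l where r: "strict_mono (r :: nat \<Rightarrow> nat)" "\<And>j. j \<in> I \<Longrightarrow> (\<lambda>k. Y (r k) j) \<longlonglongrightarrow> l j"
    by auto
  have "bounded (range (\<lambda>k. Y (r k) i))"
    by (rule bounded_subset[of "range (\<lambda>k. Y k i)"]) (use insert.prems in auto)
  then obtain a s where s: "strict_mono (s :: nat \<Rightarrow> nat)" "((\<lambda>k. Y (r k) i) \<circ> s) \<longlonglongrightarrow> a"
    using bounded_imp_convergent_subsequence by blast
  show ?case
  proof (intro exI conjI ballI)
    show "strict_mono (r \<circ> s)" using r(1) s(1) by (rule strict_mono_o)
    fix j assume "j \<in> insert i I"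
    then show "(\<lambda>k. Y ((r \<circ> s) k) j) \<longlonglongrightarrow> (if j = i then a else l j)"
      using s(2) LIMSEQ_subseq_LIMSEQ[OF r(2) s(1)] insert.hyps(2) by (auto simp: o_def)
  qed
qed

text \<open>\<open>W\<close> stands for the rescaled kernel and \<open>gW\<close> for its gradient.
  The reference density enters through continuity, positivity and an upper bound, so both choices
  are treated at once.\<close>

locale mollified_entropy =
  fixes W :: "'a::euclidean_space \<Rightarrow> real" and gW :: "'a \<Rightarrow> 'a" and N :: "'a \<Rightarrow> real"
    and \<epsilon> \<sigma> K B :: real
  assumes eps: "\<epsilon> > 0" and sigma: "0 < \<sigma>" "\<sigma> < 1"
    and W_nonneg: "\<And>x. W x \<ge> 0" and W_le: "\<And>x. W x \<le> K" and W_supp: "\<And>x. norm x > \<epsilon> \<Longrightarrow> W x = 0"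
    and W_grad: "\<And>x. GDERIV W x :> gW x" and gW_cont: "continuous_on UNIV gW"
    and gW_odd: "\<And>x. gW (- x) = - gW x"
    and N_cont: "continuous_on UNIV N" and N_pos: "\<And>x. N x > 0" and N_le: "\<And>x. N x \<le> B"
begin

lemma W_cont: "continuous_on UNIV W"
  using has_derivative_continuous[OF W_grad[unfolded gderiv_def]]
  by (intro continuous_at_imp_continuous_on ballI)

lemma gW_supp: "norm x > \<epsilon> \<Longrightarrow> gW x = 0"
  by (rule GDERIV_eq_0_outside[OF W_grad W_supp])

lemma W_measurable [measurable]: "W \<in> borel_measurable borel"
  by (rule borel_measurable_continuous_onI[OF W_cont])

definition mass :: real where "mass = (LINT y|lborel. W y)"

lemma mass_nonneg: "mass \<ge> 0"
  unfolding mass_def using W_nonneg by (intro integral_nonneg_AE) auto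

lemma W_shift_cont: "continuous_on UNIV (\<lambda>y. W (y - c))"
  by (rule continuous_on_compose2[OF W_cont]) (auto intro!: continuous_intros)

lemma W_shift_supp: "norm y > norm c + \<epsilon> \<Longrightarrow> W (y - c) = 0"
  by (rule W_supp) (use norm_triangle_ineq2[of y c] in linarith)

lemma W_shift_integrable: "integrable lborel (\<lambda>y. W (y - c))"
  by (rule integrable_continuous_compact_support[OF W_shift_cont W_shift_supp])

lemma W_shift_mass: "(LINT y|lborel. W (y - c)) = mass"
  unfolding mass_def by (rule lborel_integral_shift) simp

text \<open>Zero weights are allowed, since a simple function may take a value on a null set; such
  particles are controlled neither by the energy nor by the cost.\<close>

definition weights :: "'i set \<Rightarrow> ('i \<Rightarrow> real) \<Rightarrow> bool" where
  "weights I w \<longleftrightarrow> finite I \<and> (\<forall>i\<in>I. w i \<ge> 0) \<and> sum w I = 1"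

definition dens :: "'i set \<Rightarrow> ('i \<Rightarrow> real) \<Rightarrow> ('i \<Rightarrow> 'a) \<Rightarrow> 'a \<Rightarrow> real" where
  "dens I w Y y = (\<Sum>i\<in>I. w i * W (y - Y i))"

definition mixd :: "'i set \<Rightarrow> ('i \<Rightarrow> real) \<Rightarrow> ('i \<Rightarrow> 'a) \<Rightarrow> 'a \<Rightarrow> real" where
  "mixd I w Y y = (1 - \<sigma>) * dens I w Y y + \<sigma> * N y"

text \<open>Subtracting the value at \<open>\<sigma> N\<close> gives the integrand compact support for every finite
  system of particles.\<close>

definition energy :: "'i set \<Rightarrow> ('i \<Rightarrow> real) \<Rightarrow> ('i \<Rightarrow> 'a) \<Rightarrow> real" where
  "energy I w Y = (LINT y|lborel. ent (mixd I w Y y) - ent (\<sigma> * N y))"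

text \<open>The cost of the plan that keeps the labels, moving particle \<open>i\<close> from one
  position to the other. It is the cost of one particular coupling of the two weighted empirical
  measures, hence an upper bound for their squared distance.\<close>

definition sqdist :: "'i set \<Rightarrow> ('i \<Rightarrow> real) \<Rightarrow> ('i \<Rightarrow> 'a) \<Rightarrow> ('i \<Rightarrow> 'a) \<Rightarrow> real" where
  "sqdist I w Y Z = (\<Sum>i\<in>I. w i * (dist (Y i) (Z i))\<^sup>2)"

lemma dens_nonneg: "weights I w \<Longrightarrow> dens I w Y y \<ge> 0"
  unfolding dens_def weights_def using W_nonneg by (intro sum_nonneg) auto

lemma dens_le: "weights I w \<Longrightarrow> dens I w Y y \<le> K"
proof -
  assume w: "weights I w"
  have "dens I w Y y \<le> (\<Sum>i\<in>I. w i * K)"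
    unfolding dens_def using w W_le by (intro sum_mono mult_left_mono) (auto simp: weights_def)
  also have "\<dots> = K" using w by (simp add: sum_distrib_right[symmetric] weights_def)
  finally show ?thesis .
qed

lemma K_nonneg: "K \<ge> 0" using W_nonneg[of 0] W_le[of 0] by linarith

lemma mixd_ge: "weights I w \<Longrightarrow> \<sigma> * N y \<le> mixd I w Y y"
  unfolding mixd_def using dens_nonneg[of I w Y y] sigma by simp

lemma mixd_pos: "weights I w \<Longrightarrow> mixd I w Y y > 0"
  using mixd_ge[of I w y Y] mult_pos_pos[OF sigma(1) N_pos[of y]] by linarith

lemma sigma_N_le: "\<sigma> * N y \<le> B"
proof -
  have "\<sigma> * N y \<le> 1 * N y" using sigma N_pos[of y] by (intro mult_right_mono) auto
  then show ?thesis using N_le[of y] by simp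
qed

lemma mixd_le: "weights I w \<Longrightarrow> mixd I w Y y \<le> K + B"
proof -
  assume w: "weights I w"
  have "(1 - \<sigma>) * dens I w Y y \<le> 1 * dens I w Y y"
    using sigma dens_nonneg[OF w, of Y y] by (intro mult_right_mono) auto
  then show ?thesis using dens_le[OF w, of Y y] sigma_N_le[of y] by (simp add: mixd_def)
qed

lemma dens_cont: "continuous_on UNIV (dens I w Y)"
  unfolding dens_def by (intro continuous_intros W_shift_cont)

lemma mixd_cont: "continuous_on UNIV (mixd I w Y)"
  unfolding mixd_def by (intro continuous_intros dens_cont N_cont)

lemma ent_cont: "continuous_on S f \<Longrightarrow> (\<And>x. x \<in> S \<Longrightarrow> f x > 0) \<Longrightarrow> continuous_on S (\<lambda>x. ent (f x))"
  unfolding ent_def by (intro continuous_intros) (auto simp: less_imp_neq[symmetric])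

lemma energy_integrand_cont:
  "weights I w \<Longrightarrow> continuous_on UNIV (\<lambda>y. ent (mixd I w Y y) - ent (\<sigma> * N y))"
  using mixd_pos N_pos sigma by (intro continuous_intros ent_cont mixd_cont N_cont) auto

lemma dens_supp:
  assumes "\<And>i. i \<in> I \<Longrightarrow> norm (Y i) \<le> R" "norm y > R + \<epsilon>"
  shows "dens I w Y y = 0"
  unfolding dens_def
proof (intro sum.neutral ballI)
  fix i assume "i \<in> I"
  then have "norm y > norm (Y i) + \<epsilon>" using assms(1)[of i] assms(2) by linarith
  then show "w i * W (y - Y i) = 0" by (simp add: W_shift_supp)
qed

lemma energy_integrand_supp:
  assumes "\<And>i. i \<in> I \<Longrightarrow> norm (Y i) \<le> R" "norm y > R + \<epsilon>"
  shows "ent (mixd I w Y y) - ent (\<sigma> * N y) = 0"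
proof -
  have "dens I w Y y = 0" by (rule dens_supp[OF assms])
  then show ?thesis by (simp add: mixd_def)
qed

lemma finite_index_bound:
  assumes "finite I"
  obtains R where "\<And>i. i \<in> I \<Longrightarrow> norm (Y i :: 'a) \<le> R" "R \<ge> 0"
proof
  show "norm (Y i) \<le> (\<Sum>i\<in>I. norm (Y i))" if "i \<in> I" for i
    using that assms by (intro member_le_sum) auto
  show "(\<Sum>i\<in>I. norm (Y i)) \<ge> 0" by (intro sum_nonneg) auto
qed

lemma energy_integrable:
  assumes "weights I w"
  shows "integrable lborel (\<lambda>y. ent (mixd I w Y y) - ent (\<sigma> * N y))"
proof -
  obtain R where R: "\<And>i. i \<in> I \<Longrightarrow> norm (Y i) \<le> R"
    using finite_index_bound assms unfolding weights_def by metis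
  show ?thesis
    by (rule integrable_continuous_compact_support[OF energy_integrand_cont[OF assms] energy_integrand_supp[OF R]])
qed

lemma dens_integrable: "integrable lborel (dens I w Y)"
  unfolding dens_def by (intro Bochner_Integration.integrable_sum integrable_mult_right W_shift_integrable)

lemma dens_mass: "weights I w \<Longrightarrow> (LINT y|lborel. dens I w Y y) = mass"
  unfolding dens_def
  by (subst Bochner_Integration.integral_sum)
    (auto simp: W_shift_integrable W_shift_mass sum_distrib_right[symmetric] weights_def)

text \<open>The \<open>max 1\<close> keeps the logarithm nonnegative, so that the bound can serve as
  a nonnegative constant in the a priori estimates.\<close>

definition energy_max :: real where
  "energy_max = (1 - \<sigma>) * mass * ln (max 1 (K + B))"

lemma energy_max_nonneg: "energy_max \<ge> 0"
  unfolding energy_max_def using sigma mass_nonneg by (intro mult_nonneg_nonneg) auto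

text \<open>One constant bounds the energy of every system, so the initial energies of all particle
  approximations are bounded together. It comes from \<open>ent_diff_upper\<close> and the uniform
  upper bound of the mixture.\<close>

lemma energy_le:
  assumes w: "weights I w"
  shows "energy I w Y \<le> energy_max"
proof -
  have "energy I w Y \<le> (LINT y|lborel. (1 - \<sigma>) * ln (max 1 (K + B)) * dens I w Y y)"
    unfolding energy_def
  proof (rule integral_mono[OF energy_integrable[OF w]])
    show "integrable lborel (\<lambda>y. (1 - \<sigma>) * ln (max 1 (K + B)) * dens I w Y y)"
      by (intro integrable_mult_right dens_integrable)
    show "ent (mixd I w Y y) - ent (\<sigma> * N y) \<le> (1 - \<sigma>) * ln (max 1 (K + B)) * dens I w Y y" for y
      using ent_diff_upper[of "(1 - \<sigma>) * dens I w Y y" "\<sigma> * N y" "max 1 (K + B)"]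
        mixd_le[OF w, of Y y] dens_nonneg[OF w, of Y y] sigma N_pos[of y]
      by (simp add: mixd_def mult_ac)
  qed
  then show ?thesis by (simp add: dens_mass[OF w] energy_max_def mult_ac)
qed

text \<open>At each \<open>y\<close>, \<open>ent_diff_lower\<close> is used with
  \<open>c = \<delta> * (norm y)^2\<close>. The density at \<open>y\<close> only counts particles
  within distance \<open>\<epsilon>\<close>, for which \<open>(norm y)^2\<close> is at most
  \<open>2 * (\<epsilon>^2 + (norm (Y i))^2)\<close>; this turns the linear term into a second
  moment. The exponential term becomes a Gaussian integral.\<close>

lemma energy_ge_aux:
  assumes w: "weights I w" and \<delta>: "\<delta> > 0"
  shows "energy I w Y \<ge> - (2 * \<delta> * mass) * sqdist I w Y (\<lambda>_. 0)
    - (2 * \<delta> * mass * \<epsilon>\<^sup>2 + exp (- 1) * (LINT y|lborel. exp (- \<delta> * (norm (y::'a))\<^sup>2)) + mass)"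
proof -
  have wn: "w i \<ge> 0" if "i \<in> I" for i using w that by (simp add: weights_def)
  define F where "F y = (\<Sum>i\<in>I. - (2 * \<delta> * w i * (\<epsilon>\<^sup>2 + (norm (Y i))\<^sup>2)) * W (y - Y i))
      - exp (- 1) * exp (- \<delta> * (norm y)\<^sup>2) - dens I w Y y" for y
  have Fint: "integrable lborel F"
    unfolding F_def
    by (intro Bochner_Integration.integrable_diff Bochner_Integration.integrable_sum integrable_mult_right
        W_shift_integrable dens_integrable integrable_exp_minus_norm_power2 \<delta>)
  have "(LINT y|lborel. F y) \<le> energy I w Y"
    unfolding energy_def
  proof (rule integral_mono[OF Fint energy_integrable[OF w]])
    fix y
    define a where "a = (1 - \<sigma>) * dens I w Y y"
    define c where "c = \<delta> * (norm y)\<^sup>2"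
    have d0: "0 \<le> dens I w Y y" by (rule dens_nonneg[OF w])
    have a: "0 \<le> a" "a \<le> dens I w Y y"
      using d0 sigma by (auto simp: a_def mult_left_le_one_le)
    have c0: "c \<ge> 0" using \<delta> by (simp add: c_def)
    have "c * a \<le> c * dens I w Y y" using a c0 by (intro mult_left_mono) auto
    also have "\<dots> = (\<Sum>i\<in>I. \<delta> * w i * ((norm y)\<^sup>2 * W (y - Y i)))"
      unfolding c_def dens_def sum_distrib_left by (intro sum.cong) auto
    also have "\<dots> \<le> (\<Sum>i\<in>I. \<delta> * w i * (2 * (\<epsilon>\<^sup>2 + (norm (Y i))\<^sup>2) * W (y - Y i)))"
    proof (intro sum_mono mult_left_mono)
      fix i assume i: "i \<in> I"
      show "(norm y)\<^sup>2 * W (y - Y i) \<le> 2 * (\<epsilon>\<^sup>2 + (norm (Y i))\<^sup>2) * W (y - Y i)"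
      proof (cases "norm (y - Y i) > \<epsilon>")
        case False
        then have "norm y \<le> \<epsilon> + norm (Y i)" using norm_triangle_sub[of y "Y i"] by linarith
        then have "(norm y)\<^sup>2 \<le> (\<epsilon> + norm (Y i))\<^sup>2" by (intro power_mono) auto
        also have "\<dots> \<le> 2 * (\<epsilon>\<^sup>2 + (norm (Y i))\<^sup>2)"
          using sum_squares_bound[of \<epsilon> "norm (Y i)"] by (simp add: power2_sum)
        finally show ?thesis using W_nonneg by (intro mult_right_mono) auto
      qed (simp add: W_supp)
      show "0 \<le> \<delta> * w i" using \<delta> wn[OF i] by simp
    qed
    finally have ca: "c * a \<le> (\<Sum>i\<in>I. \<delta> * w i * (2 * (\<epsilon>\<^sup>2 + (norm (Y i))\<^sup>2) * W (y - Y i)))" .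
    have "F y = - (\<Sum>i\<in>I. \<delta> * w i * (2 * (\<epsilon>\<^sup>2 + (norm (Y i))\<^sup>2) * W (y - Y i))) - exp (- 1 - c) - dens I w Y y"
      by (simp add: F_def c_def sum_negf[symmetric] exp_add[symmetric] mult_ac)
    also have "\<dots> \<le> - c * a - exp (- 1 - c) - a" using ca a by simp
    also have "\<dots> \<le> ent (a + \<sigma> * N y) - ent (\<sigma> * N y)"
      using a sigma N_pos[of y] by (intro ent_diff_lower) auto
    finally show "F y \<le> ent (mixd I w Y y) - ent (\<sigma> * N y)" by (simp add: mixd_def a_def)
  qed
  moreover have "(LINT y|lborel. F y) = - (\<Sum>i\<in>I. 2 * \<delta> * w i * (\<epsilon>\<^sup>2 + (norm (Y i))\<^sup>2)) * mass
      - exp (- 1) * (LINT y|lborel. exp (- \<delta> * (norm (y::'a))\<^sup>2)) - mass"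
  proof -
    define F1 where "F1 y = (\<Sum>i\<in>I. - (2 * \<delta> * w i * (\<epsilon>\<^sup>2 + (norm (Y i))\<^sup>2)) * W (y - Y i))" for y
    have 1: "integrable lborel F1"
      unfolding F1_def by (intro Bochner_Integration.integrable_sum integrable_mult_right W_shift_integrable)
    have 2: "(LINT y|lborel. F1 y) = - (\<Sum>i\<in>I. 2 * \<delta> * w i * (\<epsilon>\<^sup>2 + (norm (Y i))\<^sup>2)) * mass"
      unfolding F1_def
      by (subst Bochner_Integration.integral_sum, intro integrable_mult_right W_shift_integrable)
        (simp add: W_shift_mass sum_distrib_right sum_negf)
    have 3: "integrable lborel (\<lambda>y::'a. exp (- 1) * exp (- \<delta> * (norm y)\<^sup>2))"
      by (intro integrable_mult_right integrable_exp_minus_norm_power2 \<delta>)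
    have "(LINT y|lborel. F y) = (LINT y|lborel. F1 y) - (LINT y|lborel. exp (- 1) * exp (- \<delta> * (norm (y::'a))\<^sup>2))
        - (LINT y|lborel. dens I w Y y)"
      unfolding F_def F1_def[symmetric]
        Bochner_Integration.integral_diff[OF Bochner_Integration.integrable_diff[OF 1 3] dens_integrable]
        Bochner_Integration.integral_diff[OF 1 3] ..
    then show ?thesis by (simp only: 2 dens_mass[OF w] integral_mult_right_zero)
  qed
  moreover have "(\<Sum>i\<in>I. 2 * \<delta> * w i * (\<epsilon>\<^sup>2 + (norm (Y i))\<^sup>2)) = 2 * \<delta> * \<epsilon>\<^sup>2 + 2 * \<delta> * sqdist I w Y (\<lambda>_. 0)"
  proof -
    have "(\<Sum>i\<in>I. 2 * \<delta> * w i * (\<epsilon>\<^sup>2 + (norm (Y i))\<^sup>2))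
        = (\<Sum>i\<in>I. 2 * \<delta> * \<epsilon>\<^sup>2 * w i) + (\<Sum>i\<in>I. 2 * \<delta> * (w i * (norm (Y i))\<^sup>2))"
      by (simp add: sum.distrib[symmetric] algebra_simps)
    then show ?thesis
      using w by (simp add: sum_distrib_left[symmetric] sqdist_def weights_def)
  qed
  ultimately show ?thesis by (simp add: algebra_simps)
qed

lemma energy_ge:
  assumes "\<kappa> > 0"
  obtains C where "C \<ge> 0"
    "\<And>(I :: 'i set) w Y. weights I w \<Longrightarrow> energy I w Y \<ge> - \<kappa> * sqdist I w Y (\<lambda>_. 0) - C"
proof -
  \<comment> \<open>Gives \<open>2 * \<delta> * mass \<le> \<kappa>\<close>; the summand 1 covers a
    vanishing \<open>mass\<close>.\<close>
  define \<delta> where "\<delta> = \<kappa> / (2 * mass + 1)"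
  have \<delta>: "\<delta> > 0" using assms mass_nonneg by (simp add: \<delta>_def)
  have "2 * mass * \<delta> = \<kappa> * (2 * mass / (2 * mass + 1))" by (simp add: \<delta>_def)
  also have "\<dots> \<le> \<kappa> * 1" using assms mass_nonneg by (intro mult_left_mono) auto
  finally have le: "2 * \<delta> * mass \<le> \<kappa>" by (simp add: mult_ac)
  show ?thesis
  proof
    show "2 * \<delta> * mass * \<epsilon>\<^sup>2 + exp (- 1) * (LINT y|lborel. exp (- \<delta> * (norm (y::'a))\<^sup>2)) + mass \<ge> 0"
      using \<delta> mass_nonneg by (intro add_nonneg_nonneg mult_nonneg_nonneg integral_nonneg_AE) auto
    fix I :: "'i set" and w Y assume w: "weights I w"
    have "sqdist I w Y (\<lambda>_. 0) \<ge> 0" using w by (auto simp: sqdist_def weights_def intro!: sum_nonneg)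
    then have "2 * \<delta> * mass * sqdist I w Y (\<lambda>_. 0) \<le> \<kappa> * sqdist I w Y (\<lambda>_. 0)"
      using le by (intro mult_right_mono) auto
    then show "energy I w Y \<ge> - \<kappa> * sqdist I w Y (\<lambda>_. 0)
        - (2 * \<delta> * mass * \<epsilon>\<^sup>2 + exp (- 1) * (LINT y|lborel. exp (- \<delta> * (norm (y::'a))\<^sup>2)) + mass)"
      using energy_ge_aux[OF w \<delta>, of Y] unfolding mult_minus_left by linarith
  qed
qed

text \<open>This positive minimum on balls keeps every logarithm of a mixture bounded below there,
  uniformly in the particles or measures.\<close>

lemma N_lower:
  obtains c where "c > 0" "\<And>y. norm y \<le> R \<Longrightarrow> c \<le> \<sigma> * N y"
proof (cases "cball (0::'a) R = {}")
  case True
  then have "R < 0" by simp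
  show ?thesis
  proof (rule that[of 1])
    fix y :: 'a assume "norm y \<le> R"
    then show "1 \<le> \<sigma> * N y" using norm_ge_zero[of y] \<open>R < 0\<close> by linarith
  qed simp
next
  case False
  obtain z where "z \<in> cball 0 R" "\<And>y. y \<in> cball 0 R \<Longrightarrow> N z \<le> N y"
    using continuous_attains_inf[OF compact_cball False continuous_on_subset[OF N_cont]] by auto
  then show ?thesis using that[of "\<sigma> * N z"] sigma N_pos[of z] by auto
qed

text \<open>Convergent positions stay bounded, so all integrands vanish outside a common ball;
  inside it the mixtures lie in \<open>{c..K + B}\<close> with \<open>c > 0\<close>, where
  \<open>ent\<close> is bounded. Dominated convergence applies.\<close>

lemma energy_tendsto:
  assumes w: "weights I w" and lim: "\<And>i. i \<in> I \<Longrightarrow> (\<lambda>k. Y k i) \<longlonglongrightarrow> Z i"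
  shows "(\<lambda>k. energy I w (Y k)) \<longlonglongrightarrow> energy I w Z"
proof -
  have fin: "finite I" using w by (simp add: weights_def)
  have "\<exists>R. \<forall>k. norm (Y k i) \<le> R" if "i \<in> I" for i
    using convergent_imp_bounded[OF lim[OF that]] by (auto simp: bounded_iff)
  then obtain R where R: "\<And>i k. i \<in> I \<Longrightarrow> norm (Y k i) \<le> R i" by metis
  define R' where "R' = (\<Sum>i\<in>I. \<bar>R i\<bar>)"
  have R': "norm (Y k i) \<le> R'" if "i \<in> I" for i k
  proof -
    have "\<bar>R i\<bar> \<le> R'" unfolding R'_def using that fin by (intro member_le_sum) auto
    then show ?thesis using R[OF that, of k] by linarith
  qed
  obtain c where c: "c > 0" "\<And>y. norm y \<le> R' + \<epsilon> \<Longrightarrow> c \<le> \<sigma> * N y" using N_lower by blast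
  have "bounded (ent ` {c..K + B})"
    using c(1) by (intro compact_imp_bounded compact_continuous_image ent_cont[of _ id, simplified id_def]) auto
  then obtain E where "\<forall>x\<in>ent ` {c..K + B}. norm x \<le> E" unfolding bounded_iff by blast
  then have E: "\<And>s. c \<le> s \<Longrightarrow> s \<le> K + B \<Longrightarrow> \<bar>ent s\<bar> \<le> E" by auto
  have ev: "\<bar>ent (mixd I w (Y k) y) - ent (\<sigma> * N y)\<bar> \<le> indicator (cball 0 (R' + \<epsilon>)) y * (2 * E)" for k y
  proof (cases "norm y \<le> R' + \<epsilon>")
    case True
    have "\<bar>ent (mixd I w (Y k) y)\<bar> \<le> E"
      using c(2)[OF True] mixd_ge[OF w, of y "Y k"] mixd_le[OF w, of "Y k" y] by (intro E) auto
    moreover have "\<bar>ent (\<sigma> * N y)\<bar> \<le> E"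
      using c(2)[OF True] sigma_N_le[of y] K_nonneg by (intro E) auto
    ultimately show ?thesis using True by simp
  next
    case False
    then show ?thesis using energy_integrand_supp[of I "Y k" R' y w] R' by simp
  qed
  show ?thesis
    unfolding energy_def
  proof (rule integral_dominated_convergence)
    show "integrable lborel (\<lambda>y. indicator (cball (0::'a) (R' + \<epsilon>)) y * (2 * E))"
      using emeasure_compact_finite[OF compact_cball, of "0::'a" "R' + \<epsilon>"]
      by (intro integrable_mult_left integrable_real_indicator) auto
    show "AE y in lborel. norm (ent (mixd I w (Y k) y) - ent (\<sigma> * N y)) \<le> indicator (cball 0 (R' + \<epsilon>)) y * (2 * E)" for k
      using ev by simp
    show "(\<lambda>y. ent (mixd I w Z y) - ent (\<sigma> * N y)) \<in> borel_measurable lborel"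
      using borel_measurable_continuous_onI[OF energy_integrand_cont[OF w]] by simp
    show "(\<lambda>y. ent (mixd I w (Y k) y) - ent (\<sigma> * N y)) \<in> borel_measurable lborel" for k
      using borel_measurable_continuous_onI[OF energy_integrand_cont[OF w]] by simp
    show "AE y in lborel. (\<lambda>k. ent (mixd I w (Y k) y) - ent (\<sigma> * N y)) \<longlonglongrightarrow> ent (mixd I w Z y) - ent (\<sigma> * N y)"
    proof (intro AE_I2)
      fix y
      have "isCont W (y - Z i)" for i using W_cont by (simp add: continuous_on_eq_continuous_at)
      then have "(\<lambda>k. mixd I w (Y k) y) \<longlonglongrightarrow> mixd I w Z y"
        unfolding mixd_def dens_def
        by (intro tendsto_intros isCont_tendsto_compose[where g=W] lim) auto
      then show "(\<lambda>k. ent (mixd I w (Y k) y) - ent (\<sigma> * N y)) \<longlonglongrightarrow> ent (mixd I w Z y) - ent (\<sigma> * N y)"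
        unfolding ent_def using mixd_pos[OF w, of Z y] by (intro tendsto_intros) auto
    qed
  qed
qed

section \<open>Existence of minimizers for one implicit Euler step\<close>

lemma sqdist_nonneg: "weights I w \<Longrightarrow> sqdist I w Y Z \<ge> 0"
  by (auto simp: sqdist_def weights_def intro!: sum_nonneg)

lemma sqdist_triangle:
  assumes "weights I w"
  shows "sqdist I w X Z \<le> 2 * sqdist I w X Y + 2 * sqdist I w Y Z"
proof -
  have "sqdist I w X Z \<le> (\<Sum>i\<in>I. w i * (2 * (dist (X i) (Y i))\<^sup>2 + 2 * (dist (Y i) (Z i))\<^sup>2))"
    unfolding sqdist_def
  proof (intro sum_mono mult_left_mono)
    fix i
    have "(dist (X i) (Z i))\<^sup>2 \<le> (dist (X i) (Y i) + dist (Y i) (Z i))\<^sup>2"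
      by (intro power_mono dist_triangle) auto
    also have "\<dots> \<le> 2 * (dist (X i) (Y i))\<^sup>2 + 2 * (dist (Y i) (Z i))\<^sup>2"
      using sum_squares_bound[of "dist (X i) (Y i)" "dist (Y i) (Z i)"] by (simp add: power2_sum)
    finally show "(dist (X i) (Z i))\<^sup>2 \<le> 2 * (dist (X i) (Y i))\<^sup>2 + 2 * (dist (Y i) (Z i))\<^sup>2" .
  qed (use assms in \<open>auto simp: weights_def\<close>)
  then show ?thesis by (simp add: sqdist_def sum.distrib[symmetric] sum_distrib_left algebra_simps)
qed

text \<open>Particles of weight zero are invisible to the density, and so to the energy; this lets a
  minimizing sequence be changed at such labels.\<close>

lemma dens_cong: "(\<And>i. i \<in> I \<Longrightarrow> w i \<noteq> 0 \<Longrightarrow> Y i = Z i) \<Longrightarrow> dens I w Y y = dens I w Z y"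
  unfolding dens_def by (intro sum.cong refl) (metis mult_zero_left)

lemma energy_cong: "(\<And>i. i \<in> I \<Longrightarrow> w i \<noteq> 0 \<Longrightarrow> Y i = Z i) \<Longrightarrow> energy I w Y = energy I w Z"
  unfolding energy_def mixd_def by (simp cong: dens_cong)

lemma sqdist_cong: "(\<And>i. i \<in> I \<Longrightarrow> w i \<noteq> 0 \<Longrightarrow> Y i = Z i) \<Longrightarrow> sqdist I w Y X = sqdist I w Z X"
  unfolding sqdist_def by (intro sum.cong refl) (metis mult_zero_left)

text \<open>The functional of Jordan, Kinderlehrer and Otto with the labelled cost
  \<open>sqdist\<close> in place of the squared transport distance; it depends on finitely many
  vectors.\<close>

definition jko :: "real \<Rightarrow> 'i set \<Rightarrow> ('i \<Rightarrow> real) \<Rightarrow> ('i \<Rightarrow> 'a) \<Rightarrow> ('i \<Rightarrow> 'a) \<Rightarrow> real" where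
  "jko \<tau> I w Z Y = energy I w Y + sqdist I w Y Z / (2 * \<tau>)"

text \<open>The direct method: the penalty dominates the negative part of the energy, so a
  minimizing sequence has bounded positions; a subsequence converges label by label, and the
  functional is continuous along it.\<close>

lemma jko_minimizer:
  fixes I :: "'i set"
  assumes w: "weights I w" and \<tau>: "\<tau> > 0"
  obtains Y where "\<And>Y'. jko \<tau> I w Z Y \<le> jko \<tau> I w Z Y'"
proof -
  have fin: "finite I" and wn: "\<And>i. i \<in> I \<Longrightarrow> w i \<ge> 0" using w by (auto simp: weights_def)
  \<comment> \<open>With this slope and the factor 2 of \<open>sqdist_triangle\<close>, the negative
    part of the energy uses up half of the penalty \<open>1 / (2 * \<tau>)\<close>; the other half
    gives coercivity.\<close>
  have pos: "1 / (8 * \<tau>) > 0" using \<tau> by simp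
  obtain C where C: "C \<ge> 0" "\<And>(I :: 'i set) w Y. weights I w \<Longrightarrow> energy I w Y \<ge> - (1 / (8 * \<tau>)) * sqdist I w Y (\<lambda>_. 0) - C"
    by (rule energy_ge[OF pos]) blast
  define C' where "C' = C + sqdist I w Z (\<lambda>_. 0) / (4 * \<tau>)"
  have coercive: "sqdist I w Y Z / (4 * \<tau>) - C' \<le> jko \<tau> I w Z Y" for Y
  proof -
    have "sqdist I w Y (\<lambda>_. 0) \<le> 2 * sqdist I w Y Z + 2 * sqdist I w Z (\<lambda>_. 0)"
      by (rule sqdist_triangle[OF w])
    then have "1 / (8 * \<tau>) * sqdist I w Y (\<lambda>_. 0) \<le> 1 / (8 * \<tau>) * (2 * sqdist I w Y Z + 2 * sqdist I w Z (\<lambda>_. 0))"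
      using \<tau> by (intro mult_left_mono) auto
    also have "\<dots> = sqdist I w Y Z / (4 * \<tau>) + sqdist I w Z (\<lambda>_. 0) / (4 * \<tau>)"
      using \<tau> by (simp add: field_simps)
    finally have "energy I w Y \<ge> - (sqdist I w Y Z / (4 * \<tau>) + sqdist I w Z (\<lambda>_. 0) / (4 * \<tau>)) - C"
      using C(2)[OF w, of Y] by simp
    moreover have "sqdist I w Y Z / (2 * \<tau>) = sqdist I w Y Z / (4 * \<tau>) + sqdist I w Y Z / (4 * \<tau>)"
      using \<tau> by (simp add: field_simps)
    ultimately show ?thesis by (simp add: jko_def C'_def)
  qed
  define m where "m = Inf (range (jko \<tau> I w Z))"
  have bdd: "bdd_below (range (jko \<tau> I w Z))"
  proof (rule bdd_belowI2[of _ "- C'"])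
    show "- C' \<le> jko \<tau> I w Z Y" for Y
      using coercive[of Y] sqdist_nonneg[OF w, of Y Z] \<tau>
      by (smt (verit) divide_nonneg_pos)
  qed
  have m_le: "m \<le> jko \<tau> I w Z Y" for Y
    unfolding m_def using bdd by (intro cInf_lower) auto
  have "\<exists>Y. jko \<tau> I w Z Y < m + 1 / Suc k" for k
  proof -
    have "\<exists>q\<in>range (jko \<tau> I w Z). q < m + 1 / Suc k"
      unfolding m_def using bdd by (intro cInf_lessD) auto
    then show ?thesis by auto
  qed
  then obtain Y0 where Y0: "\<And>k. jko \<tau> I w Z (Y0 k) < m + 1 / Suc k" by metis
  \<comment> \<open>The cost does not control labels of weight zero, so they are moved to the origin
    to keep the sequence bounded; the functional does not change.\<close>
  define Y where "Y k i = (if w i = 0 then 0 else Y0 k i)" for k :: nat and i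
  have Y: "jko \<tau> I w Z (Y k) < m + 1 / Suc k" for k
  proof -
    have "jko \<tau> I w Z (Y k) = jko \<tau> I w Z (Y0 k)"
      unfolding jko_def by (simp add: Y_def cong: energy_cong sqdist_cong)
    then show ?thesis using Y0[of k] by simp
  qed
  define D where "D = 4 * \<tau> * (m + 1 + C')"
  have D: "sqdist I w (Y k) Z \<le> D" for k
  proof -
    have "sqdist I w (Y k) Z / (4 * \<tau>) \<le> m + 1 / Suc k + C'"
      using coercive[of "Y k"] Y[of k] by linarith
    also have "\<dots> \<le> m + 1 + C'" by simp
    finally show ?thesis using \<tau> by (simp add: D_def field_simps)
  qed
  have bnd: "bounded (range (\<lambda>k. Y k i))" if i: "i \<in> I" for i
  proof (cases "w i = 0")
    case True
    then show ?thesis by (simp add: Y_def)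
  next
    case False
    then have wi: "w i > 0" using wn[OF i] by simp
    have "dist (Z i) (Y k i) \<le> sqrt (D / w i)" for k
    proof (rule real_le_rsqrt)
      have "w i * (dist (Y k i) (Z i))\<^sup>2 \<le> sqdist I w (Y k) Z"
        unfolding sqdist_def using fin wn i by (intro member_le_sum) auto
      then show "(dist (Z i) (Y k i))\<^sup>2 \<le> D / w i"
        using D[of k] wi by (simp add: field_simps dist_commute)
    qed
    then show ?thesis unfolding bounded_def by blast
  qed
  obtain r l where r: "strict_mono (r :: nat \<Rightarrow> nat)"
    and l: "\<And>i. i \<in> I \<Longrightarrow> (\<lambda>k. Y (r k) i) \<longlonglongrightarrow> l i"
    using finite_index_subsequence[of I Y, OF fin bnd] by blast
  have "(\<lambda>k. jko \<tau> I w Z (Y (r k))) \<longlonglongrightarrow> jko \<tau> I w Z l"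
    unfolding jko_def sqdist_def using l \<tau>
    by (intro tendsto_intros energy_tendsto[OF w] tendsto_dist) auto
  moreover have "(\<lambda>k. m + 1 / Suc (r k)) \<longlonglongrightarrow> m + 0"
    using LIMSEQ_subseq_LIMSEQ[OF LIMSEQ_inverse_real_of_nat r]
    by (intro tendsto_intros) (simp add: o_def inverse_eq_divide)
  ultimately have "jko \<tau> I w Z l \<le> m"
    using Y by (intro LIMSEQ_le[where X="\<lambda>k. jko \<tau> I w Z (Y (r k))" and Y="\<lambda>k. m + 1 / Suc (r k)"])
      (auto intro!: exI[of _ 0] less_imp_le)
  then show ?thesis using that m_le by (meson order_trans)
qed

text \<open>The first variation of the energy in the direction \<open>\<Xi>\<close>, up to the
  factor \<open>1 - \<sigma>\<close>; the logarithm is the derivative of \<open>ent\<close>. For a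
  vector field evaluated at the particles it is the spatial integral of the weak formulation, taken
  for their weighted empirical measure.\<close>

definition drift :: "'i set \<Rightarrow> ('i \<Rightarrow> real) \<Rightarrow> ('i \<Rightarrow> 'a) \<Rightarrow> ('i \<Rightarrow> 'a) \<Rightarrow> real" where
  "drift I w Y \<Xi> = (LINT y|lborel. ln (mixd I w Y y) * (\<Sum>i\<in>I. w i * (gW (Y i - y) \<bullet> \<Xi> i)))"

lemma W_compose_cont: "continuous_on S f \<Longrightarrow> continuous_on S (\<lambda>p. W (f p))"
  by (rule continuous_on_compose2[OF W_cont]) auto

lemma gW_compose_cont: "continuous_on S f \<Longrightarrow> continuous_on S (\<lambda>p. gW (f p))"
  by (rule continuous_on_compose2[OF gW_cont]) auto

lemma N_compose_cont: "continuous_on S f \<Longrightarrow> continuous_on S (\<lambda>p. N (f p))"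
  by (rule continuous_on_compose2[OF N_cont]) auto

text \<open>For \<open>h\<close> in (-1, 1) all integrands vanish outside one box, so the Lebesgue
  integrals become integrals over that box and the Leibniz rule applies. It asks for joint
  continuity of the differentiated integrand, which holds because the mixture is positive.\<close>

lemma energy_derivative:
  fixes Y \<Xi> :: "'i \<Rightarrow> 'a"
  assumes w: "weights I w"
  shows "((\<lambda>h. energy I w (\<lambda>i. Y i + h *\<^sub>R \<Xi> i)) has_field_derivative (1 - \<sigma>) * drift I w Y \<Xi>) (at 0)"
proof -
  have fin: "finite I" using w by (simp add: weights_def)
  obtain R1 where R1: "\<And>i. i \<in> I \<Longrightarrow> norm (Y i) \<le> R1" using finite_index_bound[OF fin] by blast
  obtain R2 where R2: "\<And>i. i \<in> I \<Longrightarrow> norm (\<Xi> i) \<le> R2" "R2 \<ge> 0" using finite_index_bound[OF fin] by blast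
  define R where "R = R1 + R2 + \<epsilon>"
  define U where "U = {-1<..<1::real}"
  define Yh where "Yh h i = Y i + h *\<^sub>R \<Xi> i" for h i
  have Yh: "norm (Yh h i) \<le> R1 + R2" if "i \<in> I" "h \<in> U" for i h
  proof -
    have "norm (Yh h i) \<le> norm (Y i) + \<bar>h\<bar> * norm (\<Xi> i)"
      unfolding Yh_def by (rule order_trans[OF norm_triangle_ineq]) simp
    also have "\<bar>h\<bar> * norm (\<Xi> i) \<le> 1 * norm (\<Xi> i)" using that by (intro mult_right_mono) (auto simp: U_def)
    finally show ?thesis using R1[OF that(1)] R2(1)[OF that(1)] by simp
  qed
  define a b :: 'a where "a = - R *\<^sub>R One" and "b = R *\<^sub>R One"
  have box: "y \<in> cbox a b" if "norm y \<le> R" for y :: 'a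
  proof -
    have "- R \<le> y \<bullet> c \<and> y \<bullet> c \<le> R" if "c \<in> Basis" for c
      using Basis_le_norm[OF that, of y] \<open>norm y \<le> R\<close> by (auto simp: abs_le_iff)
    then show ?thesis by (simp add: mem_box a_def b_def)
  qed
  define f where "f h y = ent (mixd I w (Yh h) y) - ent (\<sigma> * N y)" for h y
  define fx where "fx h y = (1 - \<sigma>) * (\<Sum>i\<in>I. w i * (gW (Yh h i - y) \<bullet> \<Xi> i)) * ln (mixd I w (Yh h) y)" for h y
  have to_box: "(LINT y|lborel. F y) = integral (cbox a b) F"
    if F: "continuous_on UNIV F" "\<And>y. norm y > R \<Longrightarrow> F y = 0" for F :: "'a \<Rightarrow> real"
  proof -
    have zero: "F y = 0" if "y \<notin> cbox a b" for y
      using box[of y] that F(2)[of y] by (cases "norm y \<le> R") auto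
    then have eq: "(\<lambda>y. indicator (cbox a b) y *\<^sub>R F y) = F" by (auto simp: fun_eq_iff indicator_def)
    have "set_integrable lborel (cbox a b) F"
      unfolding set_integrable_def
      by (rule borel_integrable_compact[OF compact_cbox continuous_on_subset[OF F(1)]]) simp
    from set_borel_integral_eq_integral(2)[OF this] show ?thesis
      unfolding set_lebesgue_integral_def eq .
  qed
  have ecbox: "energy I w (Yh h) = integral (cbox a b) (f h)" if h: "h \<in> U" for h
    unfolding energy_def f_def
  proof (rule to_box)
    show "continuous_on UNIV (\<lambda>y. ent (mixd I w (Yh h) y) - ent (\<sigma> * N y))"
      by (rule energy_integrand_cont[OF w])
    fix y :: 'a assume "norm y > R"
    then show "ent (mixd I w (Yh h) y) - ent (\<sigma> * N y) = 0"
      using Yh[OF _ h] by (intro energy_integrand_supp[of I "Yh h" "R1 + R2"]) (auto simp: R_def)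
  qed
  have cont_dens: "continuous_on S (\<lambda>p. mixd I w (Yh (fst p)) (snd p))" for S
    unfolding mixd_def dens_def Yh_def
    by (intro continuous_intros W_compose_cont N_compose_cont)
  have "((\<lambda>h. integral (cbox a b) (f h)) has_field_derivative integral (cbox a b) (fx 0)) (at 0 within U)"
  proof (rule leibniz_rule_field_derivative)
    fix h y assume "h \<in> U" "y \<in> cbox a b"
    have W': "((\<lambda>h. W (y - Yh h i)) has_field_derivative gW (Yh h i - y) \<bullet> \<Xi> i) (at h within U)" for i
    proof -
      have "((\<lambda>h. W ((y - Y i) + h *\<^sub>R (- \<Xi> i))) has_field_derivative
          gW ((y - Y i) + h *\<^sub>R (- \<Xi> i)) \<bullet> (- \<Xi> i)) (at h within U)"
        by (rule GDERIV_line[OF W_grad])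
      \<comment> \<open>Oddness of \<open>gW\<close> absorbs the sign from differentiating in the
        position of the particle.\<close>
      moreover have "gW (Yh h i - y) = - gW ((y - Y i) + h *\<^sub>R (- \<Xi> i))"
        by (subst gW_odd[symmetric]) (simp add: Yh_def algebra_simps)
      ultimately show ?thesis by (simp add: Yh_def algebra_simps)
    qed
    have "((\<lambda>h. (1 - \<sigma>) * (\<Sum>i\<in>I. w i * W (y - Yh h i)) + \<sigma> * N y) has_field_derivative
        (1 - \<sigma>) * (\<Sum>i\<in>I. w i * (gW (Yh h i - y) \<bullet> \<Xi> i)) + 0) (at h within U)"
      by (intro DERIV_add DERIV_cmult DERIV_sum W' DERIV_const)
    then have "((\<lambda>h. mixd I w (Yh h) y) has_field_derivative
        (1 - \<sigma>) * (\<Sum>i\<in>I. w i * (gW (Yh h i - y) \<bullet> \<Xi> i))) (at h within U)"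
      by (simp add: mixd_def dens_def)
    from ent_has_derivative[OF this mixd_pos[OF w]]
    show "((\<lambda>h. f h y) has_field_derivative fx h y) (at h within U)"
      unfolding f_def fx_def by (rule DERIV_diff[OF _ DERIV_const, simplified])
  next
    fix h assume "h \<in> U"
    show "f h integrable_on cbox a b"
      unfolding f_def by (intro integrable_continuous continuous_on_subset[OF energy_integrand_cont[OF w]]) auto
  next
    show "continuous_on (U \<times> cbox a b) (\<lambda>(h, y). fx h y)"
      unfolding fx_def split_beta
      using mixd_pos[OF w]
      by (intro continuous_intros cont_dens gW_compose_cont) (auto simp: Yh_def less_imp_neq[symmetric] intro!: continuous_intros)
  qed (auto simp: U_def)
  then have "((\<lambda>h. integral (cbox a b) (f h)) has_field_derivative integral (cbox a b) (fx 0)) (at 0)"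
    by (subst (asm) at_within_open) (auto simp: U_def)
  then have "((\<lambda>h. energy I w (Yh h)) has_field_derivative integral (cbox a b) (fx 0)) (at 0)"
    by (rule DERIV_cong_ev[THEN iffD1, rotated -1])
      (auto intro!: eventually_nhds_in_open[THEN eventually_mono, of U] simp: ecbox U_def)
  moreover have "integral (cbox a b) (fx 0) = (LINT y|lborel. fx 0 y)"
  proof (rule to_box[symmetric])
    show "continuous_on UNIV (fx 0)"
      unfolding fx_def using mixd_pos[OF w]
      by (intro continuous_intros gW_compose_cont mixd_cont) (auto simp: less_imp_neq[symmetric])
    fix y :: 'a assume y: "norm y > R"
    have "gW (Yh 0 i - y) = 0" if "i \<in> I" for i
    proof (rule gW_supp)
      have "norm (Yh 0 i) \<le> R1 + R2" using Yh[OF that] by (auto simp: U_def)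
      then show "\<epsilon> < norm (Yh 0 i - y)"
        using y norm_triangle_ineq2[of y "Yh 0 i"] by (simp add: R_def norm_minus_commute)
    qed
    then show "fx 0 y = 0" by (simp add: fx_def)
  qed
  moreover have "(LINT y|lborel. fx 0 y) = (1 - \<sigma>) * drift I w Y \<Xi>"
  proof -
    have "Yh 0 = Y" by (simp add: Yh_def fun_eq_iff)
    then show ?thesis
      unfolding drift_def
      by (subst integral_mult_right_zero[symmetric], intro Bochner_Integration.integral_cong refl)
        (simp only: fx_def mult_ac)
  qed
  ultimately show ?thesis by (simp add: Yh_def[abs_def])
qed

text \<open>Along the line \<open>Y i + h *\<^sub>R \<Xi> i\<close> the functional has its minimum
  at \<open>h = 0\<close>. The direction is arbitrary, so it can later be the gradient of a test
  function at the new positions.\<close>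

lemma jko_euler_lagrange:
  fixes Y Z \<Xi> :: "'i \<Rightarrow> 'a"
  assumes w: "weights I w" and \<tau>: "\<tau> > 0" and min: "\<And>Y'. jko \<tau> I w Z Y \<le> jko \<tau> I w Z Y'"
  shows "(\<Sum>i\<in>I. w i * ((Y i - Z i) \<bullet> \<Xi> i)) = - \<tau> * (1 - \<sigma>) * drift I w Y \<Xi>"
proof -
  have fin: "finite I" using w by (simp add: weights_def)
  have sq: "((\<lambda>h. sqdist I w (\<lambda>i. Y i + h *\<^sub>R \<Xi> i) Z) has_field_derivative
      2 * (\<Sum>i\<in>I. w i * ((Y i - Z i) \<bullet> \<Xi> i))) (at 0)"
  proof -
    have eq: "sqdist I w (\<lambda>i. Y i + h *\<^sub>R \<Xi> i) Z =
        (\<Sum>i\<in>I. w i * ((Y i - Z i) \<bullet> (Y i - Z i) + 2 * h * ((Y i - Z i) \<bullet> \<Xi> i) + h\<^sup>2 * (\<Xi> i \<bullet> \<Xi> i)))" for h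
      unfolding sqdist_def dist_norm power2_norm_eq_inner
      by (intro sum.cong refl arg_cong[of _ _ "(*) _"])
        (simp add: algebra_simps inner_add_left inner_add_right inner_diff_left inner_diff_right inner_commute power2_eq_square)
    show ?thesis
      unfolding eq sum_distrib_left by (auto intro!: derivative_eq_intros sum.cong)
  qed
  have "((\<lambda>h. jko \<tau> I w Z (\<lambda>i. Y i + h *\<^sub>R \<Xi> i)) has_field_derivative
      ((1 - \<sigma>) * drift I w Y \<Xi> + (2 * (\<Sum>i\<in>I. w i * ((Y i - Z i) \<bullet> \<Xi> i))) / (2 * \<tau>))) (at 0)"
    unfolding jko_def by (intro DERIV_add energy_derivative[OF w] DERIV_cdivide sq)
  then have "(1 - \<sigma>) * drift I w Y \<Xi> + (2 * (\<Sum>i\<in>I. w i * ((Y i - Z i) \<bullet> \<Xi> i))) / (2 * \<tau>) = 0"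
    by (rule DERIV_local_min[of _ _ _ 1]) (use min in auto)
  then show ?thesis using \<tau> by (simp add: field_simps)
qed

section \<open>The iterated scheme and its uniform bounds\<close>

lemma jko_scheme:
  fixes Y\<^sub>0 :: "'i \<Rightarrow> 'a"
  assumes w: "weights I w" and \<tau>: "\<tau> > 0"
  obtains Y where "Y 0 = Y\<^sub>0"
    "\<And>k. energy I w (Y (Suc k)) + sqdist I w (Y (Suc k)) (Y k) / (2 * \<tau>) \<le> energy I w (Y k)"
    "\<And>k \<Xi>. (\<Sum>i\<in>I. w i * ((Y (Suc k) i - Y k i) \<bullet> \<Xi> i)) = - \<tau> * (1 - \<sigma>) * drift I w (Y (Suc k)) \<Xi>"
proof -
  have "\<forall>Z. \<exists>Y. \<forall>Y'. jko \<tau> I w Z Y \<le> jko \<tau> I w Z Y'"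
    using jko_minimizer[OF w \<tau>] by metis
  then obtain S where S: "\<And>Z Y'. jko \<tau> I w Z (S Z) \<le> jko \<tau> I w Z Y'" by metis
  define Y where "Y k = (S ^^ k) Y\<^sub>0" for k
  have Ysuc: "Y (Suc k) = S (Y k)" for k by (simp add: Y_def)
  show ?thesis
  proof
    show "Y 0 = Y\<^sub>0" by (simp add: Y_def)
    show "energy I w (Y (Suc k)) + sqdist I w (Y (Suc k)) (Y k) / (2 * \<tau>) \<le> energy I w (Y k)" for k
      \<comment> \<open>The competitor is \<open>Y k\<close> itself, whose cost vanishes.\<close>
      using S[of "Y k" "Y k"] by (simp add: Ysuc jko_def sqdist_def)
    show "(\<Sum>i\<in>I. w i * ((Y (Suc k) i - Y k i) \<bullet> \<Xi> i)) = - \<tau> * (1 - \<sigma>) * drift I w (Y (Suc k)) \<Xi>" for k \<Xi>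
      using jko_euler_lagrange[OF w \<tau>, of "Y k" "Y (Suc k)"] S[of "Y k"] by (simp add: Ysuc)
  qed
qed

text \<open>Triangle inequality and Cauchy-Schwarz over the \<open>n\<close> steps. Against a total
  squared displacement of order \<open>\<tau>\<close> the factor \<open>n\<close> produces
  \<open>n * \<tau>\<close>, the elapsed time.\<close>

lemma sqdist_chain:
  assumes w: "weights I w"
  shows "sqdist I w (Y (j + n)) (Y j) \<le> real n * (\<Sum>k<n. sqdist I w (Y (Suc (j + k))) (Y (j + k)))"
proof -
  have "(dist (Y (j + n) i) (Y j i))\<^sup>2 \<le> real n * (\<Sum>k<n. (dist (Y (Suc (j + k)) i) (Y (j + k) i))\<^sup>2)" for i
  proof -
    have "dist (Y (j + n) i) (Y j i) \<le> (\<Sum>k<n. dist (Y (Suc (j + k)) i) (Y (j + k) i))"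
    proof (induction n)
      case (Suc n)
      then show ?case
        using dist_triangle[of "Y (Suc (j + n)) i" "Y j i" "Y (j + n) i"] by simp
    qed simp
    then have "(dist (Y (j + n) i) (Y j i))\<^sup>2 \<le> (\<Sum>k<n. dist (Y (Suc (j + k)) i) (Y (j + k) i))\<^sup>2"
      by (intro power_mono) auto
    also have "\<dots> \<le> (\<Sum>k<n. (dist (Y (Suc (j + k)) i) (Y (j + k) i))\<^sup>2) * card {..<n}"
      by (rule sum_squared_le_sum_of_squares)
    finally show ?thesis by (simp add: mult.commute)
  qed
  then have "sqdist I w (Y (j + n)) (Y j) \<le> (\<Sum>i\<in>I. w i * (real n * (\<Sum>k<n. (dist (Y (Suc (j + k)) i) (Y (j + k) i))\<^sup>2)))"
    unfolding sqdist_def using w by (intro sum_mono mult_left_mono) (auto simp: weights_def)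
  also have "\<dots> = real n * (\<Sum>k<n. sqdist I w (Y (Suc (j + k))) (Y (j + k)))"
    unfolding sqdist_def sum_distrib_left by (subst sum.swap) (simp add: mult_ac)
  finally show ?thesis .
qed

text \<open>The lower bound on the energy has an arbitrarily small quadratic part, which the
  Cauchy--Schwarz bound for the displacement over \<open>[0,T]\<close> absorbs.\<close>

lemma jko_scheme_bounds:
  assumes T: "T > 0" and M: "M \<ge> 0"
  obtains C where "C > 0"
    "\<And>(I :: 'i set) w Y\<^sub>0 n. weights I w \<Longrightarrow> sqdist I w Y\<^sub>0 (\<lambda>_. 0) \<le> M \<Longrightarrow> n > 0 \<Longrightarrow>
      \<exists>Y. Y 0 = Y\<^sub>0 \<and> (\<forall>k\<le>n. sqdist I w (Y k) (\<lambda>_. 0) \<le> C) \<and>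
        (\<Sum>k<n. sqdist I w (Y (Suc k)) (Y k)) \<le> C * (T / real n) \<and>
        (\<forall>k \<Xi>. (\<Sum>i\<in>I. w i * ((Y (Suc k) i - Y k i) \<bullet> \<Xi> i)) = - (T / real n) * (1 - \<sigma>) * drift I w (Y (Suc k)) \<Xi>)"
proof -
  have pos: "1 / (8 * T) > 0" using T by simp
  obtain A where A: "A \<ge> 0" "\<And>(I :: 'i set) w Y. weights I w \<Longrightarrow> energy I w Y \<ge> - (1 / (8 * T)) * sqdist I w Y (\<lambda>_. 0) - A"
    by (rule energy_ge[OF pos]) blast
  \<comment> \<open>With the slope \<open>1 / (8 * T)\<close> a second moment \<open>m\<close> at
    any step satisfies \<open>m \<le> 2 * M + 4 * T * (energy_max + A) + m / 2\<close>;
    \<open>C1\<close> is the bound that results.\<close>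
  define C1 where "C1 = 4 * M + 8 * T * (energy_max + A)"
  define C2 where "C2 = 2 * (energy_max + A + C1 / (8 * T))"
  have C1: "C1 \<ge> 0" unfolding C1_def using M T A energy_max_nonneg by simp
  have C2: "C2 \<ge> 0" unfolding C2_def using C1 T A energy_max_nonneg by simp
  show ?thesis
  proof (rule that[of "C1 + C2 + 1"])
    show "C1 + C2 + 1 > 0" using C1 C2 by linarith
    fix I :: "'i set" and w Y\<^sub>0 and n :: nat
    assume w: "weights I w" and M0: "sqdist I w Y\<^sub>0 (\<lambda>_. 0) \<le> M" and n: "n > 0"
    define \<tau> where "\<tau> = T / real n"
    have \<tau>: "\<tau> > 0" using T n by (simp add: \<tau>_def)
    obtain Y where Y0: "Y 0 = Y\<^sub>0"
      and dec: "\<And>k. energy I w (Y (Suc k)) + sqdist I w (Y (Suc k)) (Y k) / (2 * \<tau>) \<le> energy I w (Y k)"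
      and EL: "\<And>k \<Xi>. (\<Sum>i\<in>I. w i * ((Y (Suc k) i - Y k i) \<bullet> \<Xi> i)) = - \<tau> * (1 - \<sigma>) * drift I w (Y (Suc k)) \<Xi>"
      by (rule jko_scheme[OF w \<tau>, where Y\<^sub>0=Y\<^sub>0]) blast
    define D where "D k = (\<Sum>l<k. sqdist I w (Y (Suc l)) (Y l))" for k
    have tel: "energy I w (Y k) + D k / (2 * \<tau>) \<le> energy I w (Y 0)" for k
    proof (induction k)
      case (Suc k)
      then show ?case using dec[of k] by (simp add: D_def add_divide_distrib)
    qed (simp add: D_def)
    have Dle: "D k \<le> 2 * \<tau> * (energy_max + A + sqdist I w (Y k) (\<lambda>_. 0) / (8 * T))" for k
    proof -
      have "D k / (2 * \<tau>) \<le> energy_max + A + sqdist I w (Y k) (\<lambda>_. 0) / (8 * T)"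
        using tel[of k] energy_le[OF w, of "Y 0"] A(2)[OF w, of "Y k"] by simp
      then show ?thesis using \<tau> by (simp add: pos_divide_le_eq mult_ac)
    qed
    have M2: "sqdist I w (Y k) (\<lambda>_. 0) \<le> C1" if k: "k \<le> n" for k
    proof -
      let ?m = "sqdist I w (Y k) (\<lambda>_. 0)"
      have D0: "D k \<ge> 0" unfolding D_def using sqdist_nonneg[OF w] by (intro sum_nonneg) auto
      have kt: "real k * \<tau> \<le> T"
      proof -
        have "real k * \<tau> \<le> real n * \<tau>" using k \<tau> by (intro mult_right_mono) auto
        then show ?thesis using n by (simp add: \<tau>_def)
      qed
      have "?m \<le> 2 * sqdist I w (Y k) (Y 0) + 2 * M"
        using sqdist_triangle[OF w, of "Y k" "\<lambda>_. 0" "Y 0"] M0 by (simp add: Y0)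
      also have "sqdist I w (Y k) (Y 0) \<le> real k * D k"
        using sqdist_chain[OF w, of Y 0 k] by (simp add: D_def)
      also have "real k * D k \<le> real k * (2 * \<tau> * (energy_max + A + ?m / (8 * T)))"
        by (intro mult_left_mono Dle) simp
      also have "\<dots> = 2 * (real k * \<tau>) * (energy_max + A + ?m / (8 * T))" by simp
      also have "\<dots> \<le> 2 * T * (energy_max + A + ?m / (8 * T))"
        using kt sqdist_nonneg[OF w, of "Y k" "\<lambda>_. 0"] A(1) energy_max_nonneg T
        by (intro mult_right_mono add_nonneg_nonneg divide_nonneg_nonneg) auto
      also have "\<dots> = 2 * T * (energy_max + A) + ?m / 4" using T by (simp add: field_simps)
      finally show ?thesis by (simp add: C1_def)
    qed
    have "D n \<le> 2 * \<tau> * (energy_max + A + C1 / (8 * T))"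
      using M2[of n] \<tau> T by (intro order_trans[OF Dle] mult_left_mono add_left_mono divide_right_mono) auto
    then have "D n \<le> C2 * \<tau>" by (simp add: C2_def mult_ac)
    also have "\<dots> \<le> (C1 + C2 + 1) * \<tau>" using C1 \<tau> by (intro mult_right_mono) auto
    finally have Dn: "D n \<le> (C1 + C2 + 1) * \<tau>" .
    show "\<exists>Y. Y 0 = Y\<^sub>0 \<and> (\<forall>k\<le>n. sqdist I w (Y k) (\<lambda>_. 0) \<le> C1 + C2 + 1) \<and>
        (\<Sum>k<n. sqdist I w (Y (Suc k)) (Y k)) \<le> (C1 + C2 + 1) * (T / real n) \<and>
        (\<forall>k \<Xi>. (\<Sum>i\<in>I. w i * ((Y (Suc k) i - Y k i) \<bullet> \<Xi> i)) = - (T / real n) * (1 - \<sigma>) * drift I w (Y (Suc k)) \<Xi>)"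
    proof (intro exI[of _ Y] conjI allI impI)
      show "sqdist I w (Y k) (\<lambda>_. 0) \<le> C1 + C2 + 1" if "k \<le> n" for k
        using M2[OF that] C2 by linarith
      show "(\<Sum>k<n. sqdist I w (Y (Suc k)) (Y k)) \<le> (C1 + C2 + 1) * (T / real n)"
        using Dn by (simp add: D_def \<tau>_def)
    qed (use Y0 EL in \<open>auto simp: \<tau>_def\<close>)
  qed
qed

text \<open>Minkowski's inequality, with constant 1 where \<open>sqdist_triangle\<close> has 2:
  lengths of consecutive steps have to add up without loss to give a metric speed.\<close>

lemma sqrt_sqdist_triangle:
  assumes "weights I w"
  shows "sqrt (sqdist I w X Z) \<le> sqrt (sqdist I w X Y) + sqrt (sqdist I w Y Z)"
proof -
  have w: "w i \<ge> 0" if "i \<in> I" for i using assms that by (simp add: weights_def)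
  have eq: "sqrt (sqdist I w A B) = L2_set (\<lambda>i. sqrt (w i) * dist (A i) (B i)) I" for A B
    unfolding sqdist_def L2_set_def using w by (intro arg_cong[of _ _ sqrt] sum.cong) (auto simp: power_mult_distrib)
  have "L2_set (\<lambda>i. sqrt (w i) * dist (X i) (Z i)) I
      \<le> L2_set (\<lambda>i. sqrt (w i) * dist (X i) (Y i) + sqrt (w i) * dist (Y i) (Z i)) I"
    using w by (intro L2_set_mono) (auto simp: distrib_left[symmetric] intro!: mult_left_mono dist_triangle)
  also have "\<dots> \<le> L2_set (\<lambda>i. sqrt (w i) * dist (X i) (Y i)) I + L2_set (\<lambda>i. sqrt (w i) * dist (Y i) (Z i)) I"
    by (rule L2_set_triangle_ineq)
  finally show ?thesis by (simp add: eq)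
qed

lemma sqrt_sqdist_chain:
  assumes w: "weights I w" and "j \<le> k"
  shows "sqrt (sqdist I w (Y k) (Y j)) \<le> (\<Sum>i=j..<k. sqrt (sqdist I w (Y (Suc i)) (Y i)))"
  using \<open>j \<le> k\<close>
proof (induction k rule: dec_induct)
  case base
  then show ?case by (simp add: sqdist_def)
next
  case (step k)
  then show ?case using sqrt_sqdist_triangle[OF w, of "Y (Suc k)" "Y j" "Y k"] by simp
qed

text \<open>The increments of \<open>\<phi>\<close> are expanded at the new positions; the
  Euler-Lagrange equation turns the linear parts into the drift. The remainder
  \<open>\<eta> * d\<close> of a displacement \<open>d\<close> is bounded through
  \<open>d \<le> d^2 / \<tau> + \<tau>\<close>, whose weighted sum over all steps is at most
  \<open>C + T\<close>. The error thus vanishes when first \<open>\<tau>\<close> and then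
  \<open>\<eta>\<close> tends to 0.\<close>

lemma scheme_weak_form:
  fixes Y :: "nat \<Rightarrow> 'i \<Rightarrow> 'a"
  assumes w: "weights I w" and \<tau>: "\<tau> > 0" "real n * \<tau> \<le> T"
    and D: "D \<ge> 0" "\<eta> > 0" "\<And>a b. \<bar>\<phi> b - \<phi> a - g b \<bullet> (b - a)\<bar> \<le> \<eta> * dist a b + D * (dist a b)\<^sup>2"
    and C: "(\<Sum>k<n. sqdist I w (Y (Suc k)) (Y k)) \<le> C * \<tau>"
    and EL: "\<And>k \<Xi>. (\<Sum>i\<in>I. w i * ((Y (Suc k) i - Y k i) \<bullet> \<Xi> i)) = - \<tau> * (1 - \<sigma>) * drift I w (Y (Suc k)) \<Xi>"
    and k: "k \<le> n"
  shows "\<bar>(\<Sum>i\<in>I. w i * \<phi> (Y k i)) - (\<Sum>i\<in>I. w i * \<phi> (Y 0 i))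
      + (1 - \<sigma>) * (\<tau> * (\<Sum>j<k. drift I w (Y (Suc j)) (\<lambda>i. g (Y (Suc j) i))))\<bar>
    \<le> \<eta> * (C + T) + D * C * \<tau>"
proof -
  have wn: "w i \<ge> 0" if "i \<in> I" for i using w that by (simp add: weights_def)
  define E where "E j = (\<Sum>i\<in>I. w i * (\<phi> (Y (Suc j) i) - \<phi> (Y j i) - g (Y (Suc j) i) \<bullet> (Y (Suc j) i - Y j i)))" for j
  have eq: "(\<Sum>i\<in>I. w i * \<phi> (Y k i)) - (\<Sum>i\<in>I. w i * \<phi> (Y 0 i))
      + (1 - \<sigma>) * (\<tau> * (\<Sum>j<k. drift I w (Y (Suc j)) (\<lambda>i. g (Y (Suc j) i)))) = (\<Sum>j<k. E j)"
  proof (induction k)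
    case (Suc k)
    have "E k = (\<Sum>i\<in>I. w i * \<phi> (Y (Suc k) i)) - (\<Sum>i\<in>I. w i * \<phi> (Y k i))
        - (\<Sum>i\<in>I. w i * ((Y (Suc k) i - Y k i) \<bullet> g (Y (Suc k) i)))"
      unfolding E_def by (simp add: sum_subtractf[symmetric] algebra_simps inner_commute)
    then show ?case using Suc EL[of k "\<lambda>i. g (Y (Suc k) i)"] by (simp add: algebra_simps)
  qed simp
  have Eb: "\<bar>E j\<bar> \<le> \<eta> * (sqdist I w (Y (Suc j)) (Y j) / \<tau> + \<tau>) + D * sqdist I w (Y (Suc j)) (Y j)" for j
  proof -
    have "\<bar>E j\<bar> \<le> (\<Sum>i\<in>I. w i * (\<eta> * ((dist (Y (Suc j) i) (Y j i))\<^sup>2 / \<tau> + \<tau>) + D * (dist (Y (Suc j) i) (Y j i))\<^sup>2))"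
      unfolding E_def
    proof (rule order_trans[OF sum_abs], intro sum_mono)
      fix i assume i: "i \<in> I"
      define d where "d = dist (Y j i) (Y (Suc j) i)"
      have "d * \<tau> \<le> d\<^sup>2 + \<tau>\<^sup>2" using sum_squares_bound[of d \<tau>] \<tau>(1) by (auto simp: d_def intro: order_trans[rotated])
      then have "d \<le> d\<^sup>2 / \<tau> + \<tau>" using \<tau>(1) by (simp add: field_simps power2_eq_square)
      then have "\<eta> * d + D * d\<^sup>2 \<le> \<eta> * (d\<^sup>2 / \<tau> + \<tau>) + D * d\<^sup>2" using D(2) by simp
      then have "\<bar>\<phi> (Y (Suc j) i) - \<phi> (Y j i) - g (Y (Suc j) i) \<bullet> (Y (Suc j) i - Y j i)\<bar> \<le> \<eta> * (d\<^sup>2 / \<tau> + \<tau>) + D * d\<^sup>2"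
        using D(3)[of "Y (Suc j) i" "Y j i"] unfolding d_def by linarith
      then show "\<bar>w i * (\<phi> (Y (Suc j) i) - \<phi> (Y j i) - g (Y (Suc j) i) \<bullet> (Y (Suc j) i - Y j i))\<bar>
          \<le> w i * (\<eta> * ((dist (Y (Suc j) i) (Y j i))\<^sup>2 / \<tau> + \<tau>) + D * (dist (Y (Suc j) i) (Y j i))\<^sup>2)"
        using wn[OF i] by (auto simp: abs_mult d_def dist_commute intro!: mult_left_mono)
    qed
    also have "\<dots> = (\<Sum>i\<in>I. \<eta> / \<tau> * (w i * (dist (Y (Suc j) i) (Y j i))\<^sup>2) + \<eta> * \<tau> * w i + D * (w i * (dist (Y (Suc j) i) (Y j i))\<^sup>2))"
      by (intro sum.cong refl) (simp add: algebra_simps)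
    also have "\<dots> = \<eta> / \<tau> * sqdist I w (Y (Suc j)) (Y j) + \<eta> * \<tau> + D * sqdist I w (Y (Suc j)) (Y j)"
      unfolding sum.distrib sum_distrib_left[symmetric] sqdist_def using w by (simp add: weights_def)
    finally show ?thesis by (simp add: algebra_simps)
  qed
  have "\<bar>\<Sum>j<k. E j\<bar> \<le> (\<Sum>j<n. \<bar>E j\<bar>)"
    by (rule order_trans[OF sum_abs]) (use k in \<open>auto intro!: sum_mono2\<close>)
  also have "\<dots> \<le> (\<Sum>j<n. \<eta> * (sqdist I w (Y (Suc j)) (Y j) / \<tau> + \<tau>) + D * sqdist I w (Y (Suc j)) (Y j))"
    by (intro sum_mono Eb)
  also have "\<dots> = \<eta> * ((\<Sum>j<n. sqdist I w (Y (Suc j)) (Y j)) / \<tau> + real n * \<tau>) + D * (\<Sum>j<n. sqdist I w (Y (Suc j)) (Y j))"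
    by (simp add: sum.distrib sum_distrib_left sum_divide_distrib algebra_simps)
  also have "\<dots> \<le> \<eta> * (C * \<tau> / \<tau> + T) + D * (C * \<tau>)"
    using D(1,2) C \<tau> by (intro add_mono mult_left_mono divide_right_mono) auto
  finally show ?thesis using \<tau>(1) by (simp add: eq)
qed

section \<open>Passage to the limit\<close>

definition mixm :: "'a measure \<Rightarrow> 'a \<Rightarrow> real" where
  "mixm \<mu> y = (1 - \<sigma>) * conv_measure W \<mu> y + \<sigma> * N y"

definition flux :: "('a \<Rightarrow> 'a) \<Rightarrow> 'a measure \<Rightarrow> 'a \<Rightarrow> real" where
  "flux \<xi> \<mu> y = (LINT x|\<mu>. gW (x - y) \<bullet> \<xi> x)"

text \<open>The spatial integral of the weak formulation with the integration over the measure
  innermost: in this order it passes to weak limits by dominated convergence, and Fubini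
  recovers the original form.\<close>

definition mdrift :: "('a \<Rightarrow> 'a) \<Rightarrow> 'a measure \<Rightarrow> real" where
  "mdrift \<xi> \<mu> = (LINT y|lborel. ln (mixm \<mu> y) * flux \<xi> \<mu> y)"

lemma gW_measurable [measurable]: "gW \<in> borel_measurable borel"
  by (rule borel_measurable_continuous_onI[OF gW_cont])

lemma N_measurable [measurable]: "N \<in> borel_measurable borel"
  by (rule borel_measurable_continuous_onI[OF N_cont])

section \<open>The drift as a functional of measures\<close>

context
  fixes \<mu> :: "'a measure"
  assumes prob: "prob_space \<mu>" and sets_\<mu> [measurable_cong]: "sets \<mu> = sets borel"
begin

interpretation prob_space \<mu> by (rule prob)

lemma W_shift_integrable_measure: "integrable \<mu> (\<lambda>x. W (y - x))"
  using W_nonneg W_le by (intro integrable_const_bound[where B=K]) auto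

lemma conv_measure_bounds: "0 \<le> conv_measure W \<mu> y" "conv_measure W \<mu> y \<le> K"
proof -
  show "0 \<le> conv_measure W \<mu> y" unfolding conv_measure_def using W_nonneg by (intro integral_nonneg_AE) auto
  have "conv_measure W \<mu> y \<le> (LINT x|\<mu>. K)"
    unfolding conv_measure_def using W_shift_integrable_measure W_le by (intro integral_mono) auto
  then show "conv_measure W \<mu> y \<le> K" by (simp add: prob_space)
qed

lemma conv_measure_measurable [measurable]: "conv_measure W \<mu> \<in> borel_measurable borel"
  unfolding conv_measure_def[abs_def] by measurable

lemma mixm_measurable [measurable]: "mixm \<mu> \<in> borel_measurable borel"
  unfolding mixm_def[abs_def] by measurable

lemma mixm_bounds: "\<sigma> * N y \<le> mixm \<mu> y" "mixm \<mu> y \<le> K + B"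
proof -
  show "\<sigma> * N y \<le> mixm \<mu> y"
    unfolding mixm_def using conv_measure_bounds(1)[of y] sigma by simp
  have "(1 - \<sigma>) * conv_measure W \<mu> y \<le> 1 * conv_measure W \<mu> y"
    using sigma conv_measure_bounds(1)[of y] by (intro mult_right_mono) auto
  then show "mixm \<mu> y \<le> K + B"
    using conv_measure_bounds(2)[of y] sigma_N_le[of y] by (simp add: mixm_def)
qed

lemma flux_measurable:
  assumes [measurable]: "\<xi> \<in> borel_measurable borel"
  shows "flux \<xi> \<mu> \<in> borel_measurable borel"
  unfolding flux_def[abs_def] by measurable

end

lemma ln_bound_on_ball:
  obtains C where "C \<ge> 0" "\<And>y s. norm y \<le> R \<Longrightarrow> \<sigma> * N y \<le> s \<Longrightarrow> s \<le> K + B \<Longrightarrow> \<bar>ln s\<bar> \<le> C"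
proof -
  obtain c where c: "c > 0" "\<And>y. norm y \<le> R \<Longrightarrow> c \<le> \<sigma> * N y" using N_lower by blast
  show ?thesis
  proof (rule that[of "\<bar>ln c\<bar> + \<bar>ln (K + B)\<bar>"])
    fix y s assume "norm y \<le> R" "\<sigma> * N y \<le> s" "s \<le> K + B"
    then have s: "c \<le> s" "s \<le> K + B" using c(2)[of y] by auto
    then have "ln c \<le> ln s" "ln s \<le> ln (K + B)" using c(1) by auto
    then show "\<bar>ln s\<bar> \<le> \<bar>ln c\<bar> + \<bar>ln (K + B)\<bar>" by linarith
  qed simp
qed

text \<open>The field confines \<open>x\<close>, and the kernel then confines \<open>y\<close> to
  the ball of radius \<open>R + \<epsilon>\<close>, where the logarithm is bounded however fast
  \<open>N\<close> decays. The constant depends neither on \<open>s\<close> nor on \<open>x\<close>,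
  which makes it uniform over all measures.\<close>

lemma drift_kernel_bound:
  fixes \<xi> :: "'a \<Rightarrow> 'a"
  assumes \<xi>: "continuous_on UNIV \<xi>" "\<And>x. norm x > R \<Longrightarrow> \<xi> x = 0"
  obtains C where "C \<ge> 0"
    "\<And>s x y. \<sigma> * N y \<le> s \<Longrightarrow> s \<le> K + B \<Longrightarrow> \<bar>ln s * (gW (x - y) \<bullet> \<xi> x)\<bar> \<le> C * indicator (cball 0 (R + \<epsilon>)) y"
proof -
  obtain L where L: "\<And>x. norm (gW x) \<le> L" "L > 0"
    using continuous_compact_support_bounded[OF gW_cont gW_supp] by blast
  obtain X where X: "\<And>x. norm (\<xi> x) \<le> X" "X > 0"
    using continuous_compact_support_bounded[OF \<xi>] by blast
  obtain A where A: "A \<ge> 0" "\<And>y s. norm y \<le> R + \<epsilon> \<Longrightarrow> \<sigma> * N y \<le> s \<Longrightarrow> s \<le> K + B \<Longrightarrow> \<bar>ln s\<bar> \<le> A"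
    using ln_bound_on_ball by blast
  show ?thesis
  proof (rule that[of "A * (L * X)"])
    show "A * (L * X) \<ge> 0" using A L X by simp
    fix s :: real and x y assume s: "\<sigma> * N y \<le> s" "s \<le> K + B"
    show "\<bar>ln s * (gW (x - y) \<bullet> \<xi> x)\<bar> \<le> A * (L * X) * indicator (cball 0 (R + \<epsilon>)) y"
    proof (cases "norm y \<le> R + \<epsilon>")
      case True
      have "\<bar>gW (x - y) \<bullet> \<xi> x\<bar> \<le> norm (gW (x - y)) * norm (\<xi> x)" by (rule Cauchy_Schwarz_ineq2)
      also have "\<dots> \<le> L * X" using L X by (intro mult_mono) (auto intro: less_imp_le)
      finally have "\<bar>ln s\<bar> * \<bar>gW (x - y) \<bullet> \<xi> x\<bar> \<le> A * (L * X)"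
        using A(1) A(2)[OF True s] by (intro mult_mono) auto
      then show ?thesis using True by (simp add: abs_mult)
    next
      case False
      have "gW (x - y) \<bullet> \<xi> x = 0"
      proof (cases "norm x > R")
        case nx: False
        then have "norm (x - y) > \<epsilon>" using False norm_triangle_ineq2[of y x] by (simp add: norm_minus_commute)
        then show ?thesis by (simp add: gW_supp)
      qed (simp add: \<xi>)
      then show ?thesis using False by simp
    qed
  qed
qed

lemma ball_indicator_integrable: "integrable lborel (\<lambda>y::'a. C * indicator (cball 0 R) y :: real)"
  using emeasure_compact_finite[OF compact_cball, of "0::'a" R]
  by (intro integrable_mult_right integrable_real_indicator) auto

lemma mdrift_integrand_bound:
  fixes \<xi> :: "'a \<Rightarrow> 'a"
  assumes \<xi>: "continuous_on UNIV \<xi>" "\<And>x. norm x > R \<Longrightarrow> \<xi> x = 0"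
  obtains C where "C \<ge> 0"
    "\<And>\<mu> y. prob_space \<mu> \<Longrightarrow> sets \<mu> = sets borel \<Longrightarrow>
      \<bar>ln (mixm \<mu> y) * flux \<xi> \<mu> y\<bar> \<le> C * indicator (cball 0 (R + \<epsilon>)) y"
proof -
  obtain C where C: "C \<ge> 0"
    "\<And>s x y. \<sigma> * N y \<le> s \<Longrightarrow> s \<le> K + B \<Longrightarrow> \<bar>ln s * (gW (x - y) \<bullet> \<xi> x)\<bar> \<le> C * indicator (cball 0 (R + \<epsilon>)) y"
    using drift_kernel_bound[OF \<xi>] by blast
  show ?thesis
  proof (rule that[OF C(1)])
    fix \<mu> :: "'a measure" and y assume \<mu>: "prob_space \<mu>" "sets \<mu> = sets borel"
    interpret prob_space \<mu> by (rule \<mu>)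
    note [measurable_cong] = \<mu>(2)
    note [measurable] = borel_measurable_continuous_onI[OF \<xi>(1)]
    have b: "\<bar>ln (mixm \<mu> y) * (gW (x - y) \<bullet> \<xi> x)\<bar> \<le> C * indicator (cball 0 (R + \<epsilon>)) y" for x
      using mixm_bounds[OF \<mu>] by (rule C(2))
    have "\<bar>ln (mixm \<mu> y) * flux \<xi> \<mu> y\<bar> = \<bar>LINT x|\<mu>. ln (mixm \<mu> y) * (gW (x - y) \<bullet> \<xi> x)\<bar>"
      by (simp add: flux_def)
    also have "\<dots> \<le> (LINT x|\<mu>. \<bar>ln (mixm \<mu> y) * (gW (x - y) \<bullet> \<xi> x)\<bar>)" by (rule integral_abs_bound)
    also have "\<dots> \<le> (LINT x|\<mu>. C * indicator (cball 0 (R + \<epsilon>)) y)"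
    proof (rule integral_mono)
      show "integrable \<mu> (\<lambda>x. \<bar>ln (mixm \<mu> y) * (gW (x - y) \<bullet> \<xi> x)\<bar>)"
        using b by (intro integrable_const_bound[where B="C * indicator (cball 0 (R + \<epsilon>)) y"]) auto
    qed (use b in auto)
    finally show "\<bar>ln (mixm \<mu> y) * flux \<xi> \<mu> y\<bar> \<le> C * indicator (cball 0 (R + \<epsilon>)) y"
      by (simp add: prob_space)
  qed
qed

lemma mdrift_bounded:
  fixes \<xi> :: "'a \<Rightarrow> 'a"
  assumes \<xi>: "continuous_on UNIV \<xi>" "\<And>x. norm x > R \<Longrightarrow> \<xi> x = 0"
  obtains C where "\<And>\<mu>. prob_space \<mu> \<Longrightarrow> sets \<mu> = sets borel \<Longrightarrow> \<bar>mdrift \<xi> \<mu>\<bar> \<le> C"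
proof -
  obtain C where C: "C \<ge> 0" "\<And>\<mu> y. prob_space \<mu> \<Longrightarrow> sets \<mu> = sets borel \<Longrightarrow>
      \<bar>ln (mixm \<mu> y) * flux \<xi> \<mu> y\<bar> \<le> C * indicator (cball 0 (R + \<epsilon>)) y"
    using mdrift_integrand_bound[OF \<xi>] by blast
  have "\<bar>mdrift \<xi> \<mu>\<bar> \<le> (LINT y|lborel. C * indicator (cball 0 (R + \<epsilon>)) (y::'a))"
    if \<mu>: "prob_space \<mu>" "sets \<mu> = sets borel" for \<mu>
  proof -
    note [measurable] = flux_measurable[OF \<mu> borel_measurable_continuous_onI[OF \<xi>(1)]] mixm_measurable[OF \<mu>]
    have "\<bar>mdrift \<xi> \<mu>\<bar> \<le> (LINT y|lborel. \<bar>ln (mixm \<mu> y) * flux \<xi> \<mu> y\<bar>)"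
      unfolding mdrift_def by (rule integral_abs_bound)
    also have "\<dots> \<le> (LINT y|lborel. C * indicator (cball 0 (R + \<epsilon>)) (y::'a))"
    proof (rule integral_mono)
      show "integrable lborel (\<lambda>y. \<bar>ln (mixm \<mu> y) * flux \<xi> \<mu> y\<bar>)"
        by (rule Bochner_Integration.integrable_bound[OF ball_indicator_integrable[of C "R + \<epsilon>"]])
          (use C \<mu> in auto)
    qed (use C \<mu> ball_indicator_integrable in auto)
    finally show ?thesis .
  qed
  then show ?thesis by (rule that)
qed

text \<open>For fixed \<open>y\<close> both \<open>conv_measure\<close> and \<open>flux\<close> are
  integrals of bounded continuous functions, so they converge; the limit mixture is at least
  \<open>\<sigma> * N y > 0\<close>, where the logarithm is continuous. The uniform bound on a ball
  provides the domination in \<open>y\<close>.\<close>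

lemma mdrift_tendsto:
  fixes \<xi> :: "'a \<Rightarrow> 'a"
  assumes \<xi>: "continuous_on UNIV \<xi>" "\<And>x. norm x > R \<Longrightarrow> \<xi> x = 0"
    and M: "\<And>n. prob_space (M n)" "\<And>n. sets (M n) = sets borel"
    and L: "prob_space L" "sets L = sets borel" and w: "weak_lim M L"
  shows "(\<lambda>n. mdrift \<xi> (M n)) \<longlonglongrightarrow> mdrift \<xi> L"
proof -
  obtain C where C: "C \<ge> 0" "\<And>\<mu> y. prob_space \<mu> \<Longrightarrow> sets \<mu> = sets borel \<Longrightarrow>
      \<bar>ln (mixm \<mu> y) * flux \<xi> \<mu> y\<bar> \<le> C * indicator (cball 0 (R + \<epsilon>)) y"
    using mdrift_integrand_bound[OF \<xi>] by blast
  obtain X where X: "\<And>x. norm (\<xi> x) \<le> X" "X > 0"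
    using continuous_compact_support_bounded[OF \<xi>] by blast
  obtain G where G: "\<And>x. norm (gW x) \<le> G" "G > 0"
    using continuous_compact_support_bounded[OF gW_cont gW_supp] by blast
  note m1 = flux_measurable[OF _ _ borel_measurable_continuous_onI[OF \<xi>(1)]] mixm_measurable
  have conv: "(\<lambda>n. conv_measure W (M n) y) \<longlonglongrightarrow> conv_measure W L y" for y
    unfolding conv_measure_def
    using W_nonneg W_le
    by (intro weak_limD[OF w, where B=K]) (auto intro!: W_compose_cont continuous_intros)
  have flux: "(\<lambda>n. flux \<xi> (M n) y) \<longlonglongrightarrow> flux \<xi> L y" for y
    unfolding flux_def
  proof (rule weak_limD[OF w])
    show "continuous_on UNIV (\<lambda>x. gW (x - y) \<bullet> \<xi> x)"
      by (intro continuous_intros gW_compose_cont \<xi>)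
    fix x
    have "\<bar>gW (x - y) \<bullet> \<xi> x\<bar> \<le> norm (gW (x - y)) * norm (\<xi> x)" by (rule Cauchy_Schwarz_ineq2)
    also have "\<dots> \<le> G * X" using G X by (intro mult_mono) (auto intro: less_imp_le)
    finally show "\<bar>gW (x - y) \<bullet> \<xi> x\<bar> \<le> G * X" .
  qed
  show ?thesis
    unfolding mdrift_def
  proof (rule integral_dominated_convergence)
    show "integrable lborel (\<lambda>y::'a. C * indicator (cball 0 (R + \<epsilon>)) y)" by (rule ball_indicator_integrable)
    show "(\<lambda>y. ln (mixm L y) * flux \<xi> L y) \<in> borel_measurable lborel"
      using m1[OF L] by measurable
    show "(\<lambda>y. ln (mixm (M n) y) * flux \<xi> (M n) y) \<in> borel_measurable lborel" for n
      using m1[OF M] by measurable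
    show "AE y in lborel. norm (ln (mixm (M n) y) * flux \<xi> (M n) y) \<le> C * indicator (cball 0 (R + \<epsilon>)) y" for n
      using C(2)[OF M] by simp
    show "AE y in lborel. (\<lambda>n. ln (mixm (M n) y) * flux \<xi> (M n) y) \<longlonglongrightarrow> ln (mixm L y) * flux \<xi> L y"
    proof (intro AE_I2 tendsto_intros flux)
      fix y
      show "(\<lambda>n. mixm (M n) y) \<longlonglongrightarrow> mixm L y" unfolding mixm_def by (intro tendsto_intros conv)
      show "mixm L y \<noteq> 0" using mixm_bounds(1)[OF L, of y] mult_pos_pos[OF sigma(1) N_pos[of y]] by linarith
    qed
  qed
qed

lemma mdrift_eq_conv_vec:
  fixes \<xi> :: "'a \<Rightarrow> 'a"
  assumes \<xi>: "continuous_on UNIV \<xi>" "\<And>x. norm x > R \<Longrightarrow> \<xi> x = 0"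
    and \<mu>: "prob_space \<mu>" "sets \<mu> = sets borel"
  shows "(LINT x|\<mu>. \<xi> x \<bullet> conv_vec gW (\<lambda>y. ln (mixm \<mu> y)) x) = mdrift \<xi> \<mu>"
proof -
  interpret prob_space \<mu> by (rule \<mu>)
  interpret pair_sigma_finite \<mu> "lborel :: 'a measure" ..
  note [measurable_cong] = \<mu>(2)
  note [measurable] = borel_measurable_continuous_onI[OF \<xi>(1)] mixm_measurable[OF \<mu>]
  obtain C where C: "C \<ge> 0"
    "\<And>s x y. \<sigma> * N y \<le> s \<Longrightarrow> s \<le> K + B \<Longrightarrow> \<bar>ln s * (gW (x - y) \<bullet> \<xi> x)\<bar> \<le> C * indicator (cball 0 (R + \<epsilon>)) y"
    using drift_kernel_bound[OF \<xi>] by blast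
  have b: "\<bar>ln (mixm \<mu> y) * (gW (x - y) \<bullet> \<xi> x)\<bar> \<le> C * indicator (cball 0 (R + \<epsilon>)) y" for x y
    using mixm_bounds[OF \<mu>] by (rule C(2))
  have int: "integrable (\<mu> \<Otimes>\<^sub>M lborel) (\<lambda>(x, y). ln (mixm \<mu> y) * (gW (x - y) \<bullet> \<xi> x))"
  proof (rule Bochner_Integration.integrable_bound)
    \<comment> \<open>The integrand vanishes unless \<open>y\<close> lies in a ball, and the strip
      over that ball has finite measure since \<open>\<mu>\<close> is a probability measure.\<close>
    have "emeasure (\<mu> \<Otimes>\<^sub>M lborel) (space \<mu> \<times> cball (0::'a) (R + \<epsilon>)) < \<infinity>"
      using emeasure_compact_finite[OF compact_cball, of "0::'a" "R + \<epsilon>"]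
      by (subst lborel.emeasure_pair_measure_Times) (auto simp: emeasure_space_1)
    then show "integrable (\<mu> \<Otimes>\<^sub>M lborel) (\<lambda>p. C * indicator (space \<mu> \<times> cball (0::'a) (R + \<epsilon>)) p)"
      by (intro integrable_mult_right integrable_real_indicator) auto
    show "AE p in \<mu> \<Otimes>\<^sub>M lborel. norm (case p of (x, y) \<Rightarrow> ln (mixm \<mu> y) * (gW (x - y) \<bullet> \<xi> x))
        \<le> norm (C * indicator (space \<mu> \<times> cball (0::'a) (R + \<epsilon>)) p)"
    proof (rule AE_I2)
      fix p :: "'a \<times> 'a" assume "p \<in> space (\<mu> \<Otimes>\<^sub>M lborel)"
      then obtain x y where p: "p = (x, y)" "x \<in> space \<mu>" by (cases p) (auto simp: space_pair_measure)
      then have "indicator (space \<mu> \<times> cball (0::'a) (R + \<epsilon>)) p = (indicator (cball 0 (R + \<epsilon>)) y :: real)"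
        by (simp add: indicator_def)
      then show "norm (case p of (x, y) \<Rightarrow> ln (mixm \<mu> y) * (gW (x - y) \<bullet> \<xi> x))
          \<le> norm (C * indicator (space \<mu> \<times> cball (0::'a) (R + \<epsilon>)) p)"
        using b[of y x] C(1) by (simp add: p(1) abs_mult)
    qed
  qed measurable
  \<comment> \<open>Moving the inner product under the vector integral requires integrability: for
    fixed \<open>x\<close> the kernel confines \<open>y\<close> to a ball, where the logarithm is
    bounded.\<close>
  have inner: "\<xi> x \<bullet> conv_vec gW (\<lambda>y. ln (mixm \<mu> y)) x = (LINT y|lborel. ln (mixm \<mu> y) * (gW (x - y) \<bullet> \<xi> x))" for x
  proof -
    obtain A where A: "A \<ge> 0" "\<And>y s. norm y \<le> norm x + \<epsilon> \<Longrightarrow> \<sigma> * N y \<le> s \<Longrightarrow> s \<le> K + B \<Longrightarrow> \<bar>ln s\<bar> \<le> A"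
      using ln_bound_on_ball by blast
    obtain G where G: "\<And>x. norm (gW x) \<le> G" "G > 0"
      using continuous_compact_support_bounded[OF gW_cont gW_supp] by blast
    have "integrable lborel (\<lambda>y. ln (mixm \<mu> y) *\<^sub>R gW (x - y))"
    proof (rule Bochner_Integration.integrable_bound[OF ball_indicator_integrable[of "A * G" "norm x + \<epsilon>"]])
      have "norm (ln (mixm \<mu> y) *\<^sub>R gW (x - y)) \<le> norm (A * G * indicator (cball 0 (norm x + \<epsilon>)) y)" for y
      proof (cases "norm y \<le> norm x + \<epsilon>")
        case True
        then show ?thesis
          using A(2)[OF True mixm_bounds[OF \<mu>]] A(1) G by (auto intro!: mult_mono)
      next
        case False
        then have "norm (x - y) > \<epsilon>" using norm_triangle_ineq2[of y x] by (simp add: norm_minus_commute)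
        then show ?thesis by (simp add: gW_supp)
      qed
      then show "AE y in lborel. norm (ln (mixm \<mu> y) *\<^sub>R gW (x - y)) \<le> norm (A * G * indicator (cball 0 (norm x + \<epsilon>)) y)"
        by simp
    qed measurable
    then have "\<xi> x \<bullet> conv_vec gW (\<lambda>y. ln (mixm \<mu> y)) x = (LINT y|lborel. \<xi> x \<bullet> (ln (mixm \<mu> y) *\<^sub>R gW (x - y)))"
      unfolding conv_vec_def by (subst integral_inner_right) auto
    then show ?thesis by (simp add: inner_commute)
  qed
  have "(LINT x|\<mu>. \<xi> x \<bullet> conv_vec gW (\<lambda>y. ln (mixm \<mu> y)) x)
      = (LINT x|\<mu>. LINT y|lborel. ln (mixm \<mu> y) * (gW (x - y) \<bullet> \<xi> x))"
    by (simp only: inner)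
  also have "\<dots> = (LINT y|lborel. LINT x|\<mu>. ln (mixm \<mu> y) * (gW (x - y) \<bullet> \<xi> x))"
    using Fubini_integral[OF int] by simp
  also have "\<dots> = mdrift \<xi> \<mu>" by (simp add: mdrift_def flux_def)
  finally show ?thesis .
qed

text \<open>The particles are labelled by the values of simple functions \<open>s n\<close> approximating the
  identity, and all of them live on the probability space \<open>\<rho>\<^sub>0\<close>. Hence the positions at two
  times are automatically coupled, and no gluing of transport plans is needed.\<close>

lemma approximate_solutions:
  fixes \<rho>\<^sub>0 :: "'a measure"
  assumes T: "T > 0" and \<rho>\<^sub>0: "\<rho>\<^sub>0 \<in> P2"
  obtains C and X :: "nat \<Rightarrow> real \<Rightarrow> 'a \<Rightarrow> 'a" and u :: "nat \<Rightarrow> real \<Rightarrow> real" and b :: "nat \<Rightarrow> real" where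
    "C > 0"
    "\<And>n t. X n t \<in> borel_measurable \<rho>\<^sub>0"
    "\<And>n t s. integrable \<rho>\<^sub>0 (\<lambda>\<omega>. (dist (X n s \<omega>) (X n t \<omega>))\<^sup>2)"
    "\<And>n t s. integrable \<rho>\<^sub>0 (\<lambda>\<omega>. dist (X n s \<omega>) (X n t \<omega>))"
    "\<And>n t. t \<in> {0..T} \<Longrightarrow> (\<integral>\<^sup>+\<omega>. ennreal ((norm (X n t \<omega>))\<^sup>2) \<partial>\<rho>\<^sub>0) \<le> ennreal C"
    "\<And>n s t. 0 \<le> s \<Longrightarrow> s \<le> t \<Longrightarrow> t \<le> T \<Longrightarrow>
      (LINT \<omega>|\<rho>\<^sub>0. (dist (X n s \<omega>) (X n t \<omega>))\<^sup>2) \<le> C * (t - s + T / Suc n)"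
    "\<And>\<omega>. (\<lambda>n. X n 0 \<omega>) \<longlonglongrightarrow> \<omega>"
    "\<And>n. u n \<in> borel_measurable borel" "\<And>n x. \<bar>u n x\<bar> \<le> b n" "\<And>n x. 0 \<le> u n x"
    "\<And>n. (LINT x:{0..T}|lborel. (u n x)\<^sup>2) \<le> C"
    "\<And>n s t. 0 \<le> s \<Longrightarrow> s \<le> t \<Longrightarrow> t \<le> T \<Longrightarrow>
      sqrt (LINT \<omega>|\<rho>\<^sub>0. (dist (X n s \<omega>) (X n t \<omega>))\<^sup>2) \<le> (LINT x:{s..t}|lborel. u n x) + sqrt (C * (T / Suc n))"
    "\<And>n \<phi>. \<phi> \<in> C1c \<Longrightarrow> (\<lambda>x. mdrift (grad \<phi>) (distr \<rho>\<^sub>0 borel (X n x))) \<in> borel_measurable borel"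
    "\<And>\<phi> \<eta>. \<phi> \<in> C1c \<Longrightarrow> \<eta> > 0 \<Longrightarrow> \<exists>D. \<forall>n. \<forall>t\<in>{0..T}. \<exists>t'. t \<le> t' \<and> t' \<le> T \<and> t' \<le> t + T / Suc n \<and>
      \<bar>(LINT \<omega>|\<rho>\<^sub>0. \<phi> (X n t \<omega>)) - (LINT \<omega>|\<rho>\<^sub>0. \<phi> (X n 0 \<omega>))
        + (1 - \<sigma>) * (LINT x:{0<..t'}|lborel. mdrift (grad \<phi>) (distr \<rho>\<^sub>0 borel (X n x)))\<bar> \<le> \<eta> * (C + T) + D * (T / Suc n)"
proof -
  have prob: "prob_space \<rho>\<^sub>0" and sets_\<rho>: "sets \<rho>\<^sub>0 = sets borel"
    and fin2: "(\<integral>\<^sup>+x. ennreal ((norm x)\<^sup>2) \<partial>\<rho>\<^sub>0) < \<infinity>"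
    using \<rho>\<^sub>0 by (auto simp: P2_def)
  interpret P: prob_space \<rho>\<^sub>0 by (rule prob)
  note [measurable_cong] = sets_\<rho>
  have space_\<rho>: "space \<rho>\<^sub>0 = UNIV" using sets_eq_imp_space_eq[OF sets_\<rho>] by simp
  have int2: "integrable \<rho>\<^sub>0 (\<lambda>x. (norm x)\<^sup>2)"
    using fin2 by (intro integrableI_bounded) auto
  define m0 where "m0 = (LINT x|\<rho>\<^sub>0. (norm x)\<^sup>2)"
  have m0: "m0 \<ge> 0" unfolding m0_def by (intro integral_nonneg_AE) auto
  have idm: "(\<lambda>x. x) \<in> borel_measurable \<rho>\<^sub>0" by measurable
  \<comment> \<open>Approximation with base point 0 keeps the norms below \<open>2 * norm x\<close>;
    this is the source of the factor 4 in the moment bound.\<close>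
  obtain s where s: "\<And>n. simple_function \<rho>\<^sub>0 (s n)" and s_lim: "\<And>x. (\<lambda>n. s n x) \<longlonglongrightarrow> x"
    and s_norm: "\<And>n x. norm (s n x) \<le> 2 * norm x"
    using borel_measurable_implies_sequence_metric[OF idm, of 0] unfolding space_\<rho> by auto
  define I where "I n = s n ` space \<rho>\<^sub>0" for n
  define w where "w n i = measure \<rho>\<^sub>0 (s n -` {i} \<inter> space \<rho>\<^sub>0)" for n i
  have expect: "(LINT \<omega>|\<rho>\<^sub>0. g (s n \<omega>)) = (\<Sum>i\<in>I n. w n i * g i)" for g :: "'a \<Rightarrow> real" and n
    unfolding I_def w_def by (rule P.integral_simple_function_image[OF s])
  have ints: "integrable \<rho>\<^sub>0 (\<lambda>\<omega>. g (s n \<omega>))" for g :: "'a \<Rightarrow> real" and n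
    by (rule P.integrable_simple_function_image[OF s])
  have wI: "weights (I n) (w n)" for n
    unfolding weights_def
  proof (intro conjI ballI)
    show "finite (I n)" using s[of n] by (simp add: I_def simple_function_def)
    show "0 \<le> w n i" for i by (simp add: w_def)
    show "sum (w n) (I n) = 1" using expect[of "\<lambda>_. 1" n] by (simp add: P.prob_space)
  qed
  have sq: "sqdist (I n) (w n) Y Z = (LINT \<omega>|\<rho>\<^sub>0. (dist (Y (s n \<omega>)) (Z (s n \<omega>)))\<^sup>2)" for n Y Z
    unfolding sqdist_def by (rule expect[symmetric])
  have M0: "sqdist (I n) (w n) (\<lambda>i. i) (\<lambda>_. 0) \<le> 4 * m0" for n
  proof -
    have "sqdist (I n) (w n) (\<lambda>i. i) (\<lambda>_. 0) = (LINT \<omega>|\<rho>\<^sub>0. (norm (s n \<omega>))\<^sup>2)" by (simp add: sq)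
    also have "\<dots> \<le> (LINT \<omega>|\<rho>\<^sub>0. 4 * (norm \<omega>)\<^sup>2)"
    proof (rule integral_mono)
      show "integrable \<rho>\<^sub>0 (\<lambda>\<omega>. (norm (s n \<omega>))\<^sup>2)" by (rule ints)
      show "integrable \<rho>\<^sub>0 (\<lambda>\<omega>. 4 * (norm \<omega>)\<^sup>2)" using int2 by simp
      show "(norm (s n \<omega>))\<^sup>2 \<le> 4 * (norm \<omega>)\<^sup>2" for \<omega>
        using power_mono[OF s_norm[of n \<omega>], of 2] by (simp add: power_mult_distrib)
    qed
    finally show ?thesis by (simp add: m0_def)
  qed
  have m4: "4 * m0 \<ge> 0" using m0 by simp
  obtain C where C: "C > 0" and scheme:
    "\<And>(I :: 'a set) w Y\<^sub>0 n. weights I w \<Longrightarrow> sqdist I w Y\<^sub>0 (\<lambda>_. 0) \<le> 4 * m0 \<Longrightarrow> n > 0 \<Longrightarrow>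
      \<exists>Y. Y 0 = Y\<^sub>0 \<and> (\<forall>k\<le>n. sqdist I w (Y k) (\<lambda>_. 0) \<le> C) \<and>
        (\<Sum>k<n. sqdist I w (Y (Suc k)) (Y k)) \<le> C * (T / real n) \<and>
        (\<forall>k \<Xi>. (\<Sum>i\<in>I. w i * ((Y (Suc k) i - Y k i) \<bullet> \<Xi> i)) = - (T / real n) * (1 - \<sigma>) * drift I w (Y (Suc k)) \<Xi>)"
    by (rule jko_scheme_bounds[OF T m4]) blast
  \<comment> \<open>The same \<open>n\<close> indexes the particle approximation and the time step;
    \<open>Suc n\<close> steps fill [0, T] exactly.\<close>
  define \<tau> where "\<tau> n = T / real (Suc n)" for n
  have \<tau>: "\<tau> n > 0" "real (Suc n) * \<tau> n = T" for n using T by (auto simp: \<tau>_def)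
  define Q where "Q n Y \<longleftrightarrow> Y 0 = (\<lambda>i. i) \<and> (\<forall>k\<le>Suc n. sqdist (I n) (w n) (Y k) (\<lambda>_. 0) \<le> C) \<and>
        (\<Sum>k<Suc n. sqdist (I n) (w n) (Y (Suc k)) (Y k)) \<le> C * \<tau> n \<and>
        (\<forall>k \<Xi>. (\<Sum>i\<in>I n. w n i * ((Y (Suc k) i - Y k i) \<bullet> \<Xi> i)) = - \<tau> n * (1 - \<sigma>) * drift (I n) (w n) (Y (Suc k)) \<Xi>)" for n Y
  have "\<exists>Y. Q n Y" for n
    unfolding Q_def \<tau>_def by (rule scheme[OF wI M0]) simp
  then obtain Y where "\<And>n. Q n (Y n)" by metis
  then have Y0: "Y n 0 = (\<lambda>i. i)"
    and Y_mom: "k \<le> Suc n \<Longrightarrow> sqdist (I n) (w n) (Y n k) (\<lambda>_. 0) \<le> C"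
    and Y_en: "(\<Sum>k<Suc n. sqdist (I n) (w n) (Y n (Suc k)) (Y n k)) \<le> C * \<tau> n"
    and EL: "(\<Sum>i\<in>I n. w n i * ((Y n (Suc k) i - Y n k i) \<bullet> \<Xi> i)) = - \<tau> n * (1 - \<sigma>) * drift (I n) (w n) (Y n (Suc k)) \<Xi>" for n k \<Xi>
    unfolding Q_def by blast+
  define d where "d n k = sqdist (I n) (w n) (Y n (Suc k)) (Y n k)" for n k
  have d0: "d n k \<ge> 0" for n k unfolding d_def by (rule sqdist_nonneg[OF wI])
  have dle: "d n k \<le> C * \<tau> n" if "k < Suc n" for n k
  proof -
    have "d n k \<le> (\<Sum>k<Suc n. d n k)" using that d0 by (intro member_le_sum) auto
    then show ?thesis using Y_en[of n] by (simp add: d_def)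
  qed
  \<comment> \<open>For positive \<open>t\<close>, the index of the right end of the left-open step
    interval containing \<open>t\<close>; time 0 has index 0, the initial position.\<close>
  define \<kappa> where "\<kappa> n t = nat \<lceil>t / \<tau> n\<rceil>" for n t
  have \<kappa>_le: "\<kappa> n t \<le> Suc n" if "t \<le> T" for n t
  proof -
    have "t / \<tau> n \<le> real (Suc n)" using that \<tau>[of n] by (simp add: pos_divide_le_eq)
    then have "\<lceil>t / \<tau> n\<rceil> \<le> int (Suc n)" by (intro ceiling_le) simp
    then show ?thesis unfolding \<kappa>_def nat_le_iff .
  qed
  have \<kappa>: "t \<le> real (\<kappa> n t) * \<tau> n" "real (\<kappa> n t) * \<tau> n < t + \<tau> n" if "0 \<le> t" for n t
  proof -
    have r: "real (\<kappa> n t) = of_int \<lceil>t / \<tau> n\<rceil>"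
      using that \<tau>(1)[of n] by (simp add: \<kappa>_def)
    have "t / \<tau> n \<le> real (\<kappa> n t)" "real (\<kappa> n t) < t / \<tau> n + 1" unfolding r by linarith+
    then show "t \<le> real (\<kappa> n t) * \<tau> n" "real (\<kappa> n t) * \<tau> n < t + \<tau> n"
      using \<tau>(1)[of n] by (auto simp: field_simps)
  qed
  have \<kappa>_mono: "\<kappa> n a \<le> \<kappa> n b" if "a \<le> b" for n a b
    unfolding \<kappa>_def using that \<tau>(1)[of n] by (intro nat_mono ceiling_mono divide_right_mono) auto
  have \<kappa>T: "real (\<kappa> n t) * \<tau> n \<le> T" if "t \<le> T" for n t
  proof -
    have "real (\<kappa> n t) * \<tau> n \<le> real (Suc n) * \<tau> n"
      using \<kappa>_le[OF that, of n] \<tau>(1)[of n] by (intro mult_right_mono) auto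
    then show ?thesis by (simp only: \<tau>)
  qed
  have \<kappa>0: "\<kappa> n 0 = 0" for n by (simp add: \<kappa>_def)
  have step_meas: "(\<lambda>x. F (\<kappa> n x)) \<in> borel_measurable borel" for F :: "nat \<Rightarrow> real" and n
    unfolding \<kappa>_def by measurable
  define X where "X n t \<omega> = Y n (\<kappa> n t) (s n \<omega>)" for n t \<omega>
  \<comment> \<open>The metric speed on the step that ends at index \<open>k\<close>. Index 0 ends
    no step, and indices beyond the horizon get 0, which keeps each speed function bounded.\<close>
  define F where "F n k = (case k of 0 \<Rightarrow> 0 | Suc j \<Rightarrow> if j < Suc n then sqrt (d n j) / \<tau> n else 0)" for n k
  define u where "u n x = F n (\<kappa> n x)" for n x
  have F0: "F n 0 = 0" "0 \<le> F n k" for n k using d0 \<tau>(1)[of n] by (auto simp: F_def less_imp_le split: nat.split)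
  have X_sq: "(LINT \<omega>|\<rho>\<^sub>0. (dist (X n a \<omega>) (X n b \<omega>))\<^sup>2) = sqdist (I n) (w n) (Y n (\<kappa> n a)) (Y n (\<kappa> n b))" for n a b
    by (simp add: sq X_def)
  have sq_commute: "sqdist (I n) (w n) A B = sqdist (I n) (w n) B A" for n A B
    by (simp add: sqdist_def dist_commute)
  have X_meas: "X n t \<in> borel_measurable \<rho>\<^sub>0" for n t
    unfolding X_def[abs_def] by (intro borel_measurable_simple_function simple_function_compose1[OF s])
  have law_int: "(LINT x|distr \<rho>\<^sub>0 borel (X n t). g x) = (\<Sum>i\<in>I n. w n i * g (Y n (\<kappa> n t) i))"
    if "g \<in> borel_measurable borel" for g :: "'a \<Rightarrow> real" and n t
    using that X_meas expect[of "\<lambda>i. g (Y n (\<kappa> n t) i)" n] by (simp add: integral_distr X_def)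
  have law_drift: "mdrift g (distr \<rho>\<^sub>0 borel (X n t)) = drift (I n) (w n) (Y n (\<kappa> n t)) (\<lambda>i. g (Y n (\<kappa> n t) i))"
    if [measurable]: "g \<in> borel_measurable borel" for g n t
  proof -
    have "mixm (distr \<rho>\<^sub>0 borel (X n t)) y = mixd (I n) (w n) (Y n (\<kappa> n t)) y" for y
      unfolding mixm_def mixd_def conv_measure_def dens_def by (subst law_int) auto
    moreover have "flux g (distr \<rho>\<^sub>0 borel (X n t)) y = (\<Sum>i\<in>I n. w n i * (gW (Y n (\<kappa> n t) i - y) \<bullet> g (Y n (\<kappa> n t) i)))" for y
      unfolding flux_def by (subst law_int) auto
    ultimately show ?thesis by (simp add: mdrift_def drift_def)
  qed
  show ?thesis
  proof (rule that[of C X u "\<lambda>n. \<Sum>k\<le>Suc n. F n k"])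
    show "C > 0" by (rule C)
    show "X n t \<in> borel_measurable \<rho>\<^sub>0" for n t by (rule X_meas)
    show "integrable \<rho>\<^sub>0 (\<lambda>\<omega>. (dist (X n a \<omega>) (X n t \<omega>))\<^sup>2)" for n t a
      unfolding X_def by (rule ints[of "\<lambda>i. (dist (Y n (\<kappa> n a) i) (Y n (\<kappa> n t) i))\<^sup>2"])
    show "integrable \<rho>\<^sub>0 (\<lambda>\<omega>. dist (X n a \<omega>) (X n t \<omega>))" for n t a
      unfolding X_def by (rule ints[of "\<lambda>i. dist (Y n (\<kappa> n a) i) (Y n (\<kappa> n t) i)"])
    show "(\<integral>\<^sup>+\<omega>. ennreal ((norm (X n t \<omega>))\<^sup>2) \<partial>\<rho>\<^sub>0) \<le> ennreal C" if "t \<in> {0..T}" for n t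
    proof -
      have "integrable \<rho>\<^sub>0 (\<lambda>\<omega>. (norm (X n t \<omega>))\<^sup>2)"
        unfolding X_def by (rule ints[of "\<lambda>i. (norm (Y n (\<kappa> n t) i))\<^sup>2"])
      then have "(\<integral>\<^sup>+\<omega>. ennreal ((norm (X n t \<omega>))\<^sup>2) \<partial>\<rho>\<^sub>0) = ennreal (LINT \<omega>|\<rho>\<^sub>0. (norm (X n t \<omega>))\<^sup>2)"
        by (intro nn_integral_eq_integral) auto
      also have "(LINT \<omega>|\<rho>\<^sub>0. (norm (X n t \<omega>))\<^sup>2) = sqdist (I n) (w n) (Y n (\<kappa> n t)) (\<lambda>_. 0)"
        by (simp add: sq X_def)
      also have "\<dots> \<le> C" using that by (intro Y_mom \<kappa>_le) auto
      finally show ?thesis by (simp add: ennreal_leI)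
    qed
    show "(LINT \<omega>|\<rho>\<^sub>0. (dist (X n a \<omega>) (X n t \<omega>))\<^sup>2) \<le> C * (t - a + T / Suc n)"
      if a: "0 \<le> a" "a \<le> t" "t \<le> T" for n a t
    proof -
      define m where "m = \<kappa> n t - \<kappa> n a"
      have m: "\<kappa> n t = \<kappa> n a + m" using \<kappa>_mono[OF a(2), of n] by (simp add: m_def)
      have "(LINT \<omega>|\<rho>\<^sub>0. (dist (X n a \<omega>) (X n t \<omega>))\<^sup>2) = sqdist (I n) (w n) (Y n (\<kappa> n a + m)) (Y n (\<kappa> n a))"
        unfolding X_sq m by (rule sq_commute)
      also have "\<dots> \<le> real m * (\<Sum>k<m. d n (\<kappa> n a + k))"
        unfolding d_def by (rule sqdist_chain[OF wI])
      also have "\<dots> \<le> real m * (\<Sum>k<Suc n. d n k)"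
        using \<kappa>_le[OF a(3), of n] by (intro mult_left_mono sum_shift_le d0) (auto simp: m)
      also have "\<dots> \<le> real m * (C * \<tau> n)"
        using Y_en[of n] by (intro mult_left_mono) (auto simp: d_def)
      also have "\<dots> = C * (real (\<kappa> n t) * \<tau> n - real (\<kappa> n a) * \<tau> n)" by (simp add: m algebra_simps)
      also have "\<dots> \<le> C * (t - a + \<tau> n)"
      proof (rule mult_left_mono)
        have "0 \<le> t" using a by simp
        then show "real (\<kappa> n t) * \<tau> n - real (\<kappa> n a) * \<tau> n \<le> t - a + \<tau> n"
          using \<kappa>(2)[of t n] \<kappa>(1)[OF a(1), of n] by linarith
      qed (use C in simp)
      finally show ?thesis by (simp add: \<tau>_def)
    qed
    show "(\<lambda>n. X n 0 \<omega>) \<longlonglongrightarrow> \<omega>" for \<omega> using s_lim[of \<omega>] by (simp add: X_def \<kappa>0 Y0)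
    show "u n \<in> borel_measurable borel" for n unfolding u_def[abs_def] by (rule step_meas)
    show "\<bar>u n x\<bar> \<le> (\<Sum>k\<le>Suc n. F n k)" for n x
    proof (cases "\<kappa> n x \<le> Suc n")
      case True
      then show ?thesis unfolding u_def using F0 by (auto intro!: member_le_sum simp del: sum.atMost_Suc)
    next
      case False
      then have "F n (\<kappa> n x) = 0" by (auto simp: F_def split: nat.split)
      then show ?thesis unfolding u_def using F0 by (auto intro!: sum_nonneg simp del: sum.atMost_Suc)
    qed
    show "0 \<le> u n x" for n x by (simp add: u_def F0)
    show "(LINT x:{0..T}|lborel. (u n x)\<^sup>2) \<le> C" for n
    proof -
      \<comment> \<open>The value \<open>F n 0 = 0\<close> removes the point 0, in which the closed
        and the half-open interval differ.\<close>
      have "(LINT x:{0..T}|lborel. (u n x)\<^sup>2) = (LINT x:{real 0 * \<tau> n<..real (Suc n) * \<tau> n}|lborel. (F n (nat \<lceil>x / \<tau> n\<rceil>))\<^sup>2)"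
        unfolding \<tau>(2) set_lebesgue_integral_def u_def \<kappa>_def
        by (intro Bochner_Integration.integral_cong refl) (auto simp: indicator_def F0)
      also have "\<dots> = \<tau> n * (\<Sum>i=0..<Suc n. (F n (Suc i))\<^sup>2)"
        using step_function_integral[OF \<tau>(1), of 0 "Suc n" n "\<lambda>k. (F n k)\<^sup>2"] by blast
      also have "\<dots> = \<tau> n * (\<Sum>i<Suc n. d n i / (\<tau> n)\<^sup>2)"
        unfolding atLeast0LessThan using d0
        by (intro arg_cong[of _ _ "(*) (\<tau> n)"] sum.cong refl) (auto simp: F_def power_divide)
      also have "\<dots> = (\<Sum>i<Suc n. d n i) / \<tau> n"
        unfolding sum_divide_distrib[symmetric] using \<tau>(1)[of n] by (simp add: power2_eq_square)
      also have "\<dots> \<le> C" using Y_en[of n] \<tau>(1)[of n] by (simp add: d_def pos_divide_le_eq)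
      finally show ?thesis .
    qed
    show "sqrt (LINT \<omega>|\<rho>\<^sub>0. (dist (X n a \<omega>) (X n t \<omega>))\<^sup>2) \<le> (LINT x:{a..t}|lborel. u n x) + sqrt (C * (T / Suc n))"
      if a: "0 \<le> a" "a \<le> t" "t \<le> T" for n a t
    proof -
      have u_int: "set_integrable lborel {a..t} (u n)"
        unfolding set_integrable_def
      proof (rule integrableI_bounded_set_indicator[where B="\<Sum>k\<le>Suc n. F n k"])
        show "u n \<in> borel_measurable lborel" unfolding u_def[abs_def] using step_meas by simp
        show "AE x in lborel. x \<in> {a..t} \<longrightarrow> norm (u n x) \<le> (\<Sum>k\<le>Suc n. F n k)"
        proof (intro AE_I2 impI)
          fix x assume "x \<in> {a..t}"
          then have "\<kappa> n x \<le> Suc n" using a by (intro \<kappa>_le) auto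
          then show "norm (u n x) \<le> (\<Sum>k\<le>Suc n. F n k)"
            unfolding u_def using F0 by (auto intro!: member_le_sum simp del: sum.atMost_Suc)
        qed
      qed (use a in auto)
      have u_pos: "0 \<le> (LINT x:{a..t}|lborel. u n x)"
        unfolding set_lebesgue_integral_def by (intro integral_nonneg_AE AE_I2) (simp add: u_def F0)
      have eq: "sqrt (LINT \<omega>|\<rho>\<^sub>0. (dist (X n a \<omega>) (X n t \<omega>))\<^sup>2) = sqrt (sqdist (I n) (w n) (Y n (\<kappa> n t)) (Y n (\<kappa> n a)))"
        unfolding X_sq by (simp add: sq_commute)
      show ?thesis
      proof (cases "\<kappa> n t = \<kappa> n a")
        case True
        then show ?thesis using u_pos C T unfolding eq by (simp add: sqdist_def)
      next
        case False
        then have lt: "\<kappa> n a < \<kappa> n t" using \<kappa>_mono[OF a(2), of n] by simp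
        \<comment> \<open>The last step may end after \<open>t\<close>, so only the steps up to
          \<open>k\<close> are compared with the integral over \<open>{a..t}\<close>; the last one
          is estimated by its own length, at most \<open>sqrt (C * \<tau> n)\<close>.\<close>
        then obtain k where k: "\<kappa> n t = Suc k" "\<kappa> n a \<le> k" by (cases "\<kappa> n t") auto
        have kn: "k < Suc n" using \<kappa>_le[OF a(3), of n] k by simp
        have "sqrt (sqdist (I n) (w n) (Y n (Suc k)) (Y n (\<kappa> n a))) \<le> (\<Sum>i=\<kappa> n a..<Suc k. sqrt (d n i))"
          unfolding d_def using k by (intro sqrt_sqdist_chain[OF wI]) simp
        also have "\<dots> = (\<Sum>i=\<kappa> n a..<k. sqrt (d n i)) + sqrt (d n k)" using k by simp
        also have "(\<Sum>i=\<kappa> n a..<k. sqrt (d n i)) = \<tau> n * (\<Sum>i=\<kappa> n a..<k. F n (Suc i))"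
          unfolding sum_distrib_left using kn \<tau>(1)[of n] by (intro sum.cong) (auto simp: F_def)
        also have "\<dots> = (LINT x:{real (\<kappa> n a) * \<tau> n<..real k * \<tau> n}|lborel. F n (nat \<lceil>x / \<tau> n\<rceil>))"
          using step_function_integral[OF \<tau>(1) k(2), of n "F n"] by simp
        also have "\<dots> \<le> (LINT x:{a..t}|lborel. u n x)"
          unfolding set_lebesgue_integral_def
        proof (rule integral_mono)
          show "integrable lborel (\<lambda>x. indicator {real (\<kappa> n a) * \<tau> n<..real k * \<tau> n} x *\<^sub>R F n (nat \<lceil>x / \<tau> n\<rceil>))"
            using step_function_integral[OF \<tau>(1) k(2), of n "F n"] by (simp add: set_integrable_def)
          show "integrable lborel (\<lambda>x. indicator {a..t} x *\<^sub>R u n x)" using u_int by (simp add: set_integrable_def)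
          fix x
          have "x \<in> {a..t}" if "x \<in> {real (\<kappa> n a) * \<tau> n<..real k * \<tau> n}"
          proof -
            have "0 \<le> t" using a by simp
            then have "real k * \<tau> n \<le> t" using \<kappa>(2)[of t n] by (simp add: k algebra_simps)
            then show ?thesis using \<kappa>(1)[OF a(1), of n] that by auto
          qed
          then show "indicator {real (\<kappa> n a) * \<tau> n<..real k * \<tau> n} x *\<^sub>R F n (nat \<lceil>x / \<tau> n\<rceil>) \<le> indicator {a..t} x *\<^sub>R u n x"
            using F0 by (auto simp: indicator_def u_def \<kappa>_def)
        qed
        also have "sqrt (d n k) \<le> sqrt (C * (T / Suc n))"
          using dle[OF kn] by (intro real_sqrt_le_mono) (simp add: \<tau>_def)
        finally show ?thesis unfolding eq k(1) by simp
      qed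
    qed
    show "(\<lambda>x. mdrift (grad \<phi>) (distr \<rho>\<^sub>0 borel (X n x))) \<in> borel_measurable borel" if \<phi>: "\<phi> \<in> C1c" for n \<phi>
    proof -
      have "grad \<phi> \<in> borel_measurable borel"
        by (rule C1c_taylor[OF \<phi>]) (rule borel_measurable_continuous_onI)
      then show ?thesis
        unfolding law_drift
        using step_meas[of "\<lambda>k. drift (I n) (w n) (Y n k) (\<lambda>i. grad \<phi> (Y n k i))" n] by (simp add: law_drift)
    qed
    show "\<exists>D. \<forall>n. \<forall>t\<in>{0..T}. \<exists>t'. t \<le> t' \<and> t' \<le> T \<and> t' \<le> t + T / Suc n \<and>
      \<bar>(LINT \<omega>|\<rho>\<^sub>0. \<phi> (X n t \<omega>)) - (LINT \<omega>|\<rho>\<^sub>0. \<phi> (X n 0 \<omega>))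
        + (1 - \<sigma>) * (LINT x:{0<..t'}|lborel. mdrift (grad \<phi>) (distr \<rho>\<^sub>0 borel (X n x)))\<bar> \<le> \<eta> * (C + T) + D * (T / Suc n)"
      if \<phi>: "\<phi> \<in> C1c" and \<eta>: "\<eta> > 0" for \<phi> \<eta>
    proof -
      have gm: "grad \<phi> \<in> borel_measurable borel"
        by (rule C1c_taylor[OF \<phi>]) (rule borel_measurable_continuous_onI)
      have "\<exists>D\<ge>0. \<forall>a b. \<bar>\<phi> b - \<phi> a - grad \<phi> b \<bullet> (b - a)\<bar> \<le> \<eta> * dist a b + D * (dist a b)\<^sup>2"
        by (rule C1c_taylor[OF \<phi>]) (use \<eta> in blast)
      then obtain D where D: "D \<ge> 0" "\<And>a b. \<bar>\<phi> b - \<phi> a - grad \<phi> b \<bullet> (b - a)\<bar> \<le> \<eta> * dist a b + D * (dist a b)\<^sup>2"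
        by blast
      show ?thesis
      proof (rule exI[of _ "D * C"], intro allI ballI)
        fix n t assume t: "t \<in> {0..T}"
        \<comment> \<open>The witness for \<open>t'\<close> is \<open>real k * \<tau> n\<close>, the
          first grid point at or after \<open>t\<close>: the drift is summed over whole steps, and
          the grid ends at \<open>T\<close>.\<close>
        define k where "k = \<kappa> n t"
        have k: "k \<le> Suc n" using t by (auto simp: k_def intro: \<kappa>_le)
        have "(LINT x:{0<..real k * \<tau> n}|lborel. mdrift (grad \<phi>) (distr \<rho>\<^sub>0 borel (X n x)))
            = (LINT x:{real 0 * \<tau> n<..real k * \<tau> n}|lborel. drift (I n) (w n) (Y n (nat \<lceil>x / \<tau> n\<rceil>)) (\<lambda>i. grad \<phi> (Y n (nat \<lceil>x / \<tau> n\<rceil>) i)))"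
          unfolding law_drift[OF gm] by (simp add: \<kappa>_def)
        also have "\<dots> = \<tau> n * (\<Sum>i=0..<k. drift (I n) (w n) (Y n (Suc i)) (\<lambda>j. grad \<phi> (Y n (Suc i) j)))"
          using step_function_integral[OF \<tau>(1), of 0 k n "\<lambda>k. drift (I n) (w n) (Y n k) (\<lambda>i. grad \<phi> (Y n k i))"] by blast
        finally have drift_eq: "(LINT x:{0<..real k * \<tau> n}|lborel. mdrift (grad \<phi>) (distr \<rho>\<^sub>0 borel (X n x)))
            = \<tau> n * (\<Sum>i<k. drift (I n) (w n) (Y n (Suc i)) (\<lambda>j. grad \<phi> (Y n (Suc i) j)))"
          by (simp add: atLeast0LessThan)
        have \<phi>_eq: "(LINT \<omega>|\<rho>\<^sub>0. \<phi> (X n x \<omega>)) = (\<Sum>i\<in>I n. w n i * \<phi> (Y n (\<kappa> n x) i))" for x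
          unfolding X_def by (rule expect)
        have nT: "real (Suc n) * \<tau> n \<le> T" by (simp only: \<tau>)
        have "\<bar>(\<Sum>i\<in>I n. w n i * \<phi> (Y n k i)) - (\<Sum>i\<in>I n. w n i * \<phi> (Y n 0 i))
            + (1 - \<sigma>) * (\<tau> n * (\<Sum>j<k. drift (I n) (w n) (Y n (Suc j)) (\<lambda>i. grad \<phi> (Y n (Suc j) i))))\<bar>
          \<le> \<eta> * (C + T) + D * C * \<tau> n"
          by (rule scheme_weak_form[where \<phi>=\<phi> and g="grad \<phi>" and Y="Y n" and I="I n" and w="w n" and \<tau>="\<tau> n",
              OF wI \<tau>(1) nT D(1) \<eta> D(2) Y_en EL k])
        then show "\<exists>t'. t \<le> t' \<and> t' \<le> T \<and> t' \<le> t + T / Suc n \<and>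
            \<bar>(LINT \<omega>|\<rho>\<^sub>0. \<phi> (X n t \<omega>)) - (LINT \<omega>|\<rho>\<^sub>0. \<phi> (X n 0 \<omega>))
            + (1 - \<sigma>) * (LINT x:{0<..t'}|lborel. mdrift (grad \<phi>) (distr \<rho>\<^sub>0 borel (X n x)))\<bar> \<le> \<eta> * (C + T) + D * C * (T / Suc n)"
          using \<kappa>[of t n] \<kappa>T[of t n] t
          by (intro exI[of _ "real k * \<tau> n"]) (simp add: drift_eq[unfolded k_def] \<phi>_eq \<kappa>0 k_def \<tau>_def[symmetric] del: of_nat_Suc)
      qed
    qed
  qed
qed

text \<open>The weak limits of one subsequence at all times form the curve. Its initial law is
  \<open>\<rho>\<^sub>0\<close> because the initial positions converge pointwise to the identity.
  The weak formulation survives because the drift is bounded uniformly over probability measures and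
  continuous under weak limits at each time.\<close>

theorem weak_solution_exists:
  fixes \<rho>\<^sub>0 :: "'a measure"
  assumes T: "T > 0" and \<rho>\<^sub>0: "\<rho>\<^sub>0 \<in> P2"
  obtains \<rho> where "abs_cont_curve wasserstein2 P2 T \<rho>" "\<rho> 0 = \<rho>\<^sub>0"
    "\<And>\<phi> t. \<phi> \<in> C1c \<Longrightarrow> t \<in> {0..T} \<Longrightarrow>
      (LINT x|\<rho> t. \<phi> x) - (LINT x|\<rho> 0. \<phi> x) = - (1 - \<sigma>) * (LINT s:{0..t}|lborel. mdrift (grad \<phi>) (\<rho> s))"
proof -
  have prob: "prob_space \<rho>\<^sub>0" and sets_\<rho>: "sets \<rho>\<^sub>0 = sets borel"
    using \<rho>\<^sub>0 by (auto simp: P2_def)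
  interpret P: prob_space \<rho>\<^sub>0 by (rule prob)
  obtain C and X :: "nat \<Rightarrow> real \<Rightarrow> 'a \<Rightarrow> 'a" and u :: "nat \<Rightarrow> real \<Rightarrow> real" and b :: "nat \<Rightarrow> real" where
    C: "C > 0"
    and X: "\<And>n t. X n t \<in> borel_measurable \<rho>\<^sub>0"
    and int_sq: "\<And>n t s. integrable \<rho>\<^sub>0 (\<lambda>\<omega>. (dist (X n s \<omega>) (X n t \<omega>))\<^sup>2)"
    and int: "\<And>n t s. integrable \<rho>\<^sub>0 (\<lambda>\<omega>. dist (X n s \<omega>) (X n t \<omega>))"
    and mom: "\<And>n t. t \<in> {0..T} \<Longrightarrow> (\<integral>\<^sup>+\<omega>. ennreal ((norm (X n t \<omega>))\<^sup>2) \<partial>\<rho>\<^sub>0) \<le> ennreal C"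
    and holder: "\<And>n s t. 0 \<le> s \<Longrightarrow> s \<le> t \<Longrightarrow> t \<le> T \<Longrightarrow>
      (LINT \<omega>|\<rho>\<^sub>0. (dist (X n s \<omega>) (X n t \<omega>))\<^sup>2) \<le> C * (t - s + T / Suc n)"
    and X0: "\<And>\<omega>. (\<lambda>n. X n 0 \<omega>) \<longlonglongrightarrow> \<omega>"
    and u: "\<And>n. u n \<in> borel_measurable borel" "\<And>n x. \<bar>u n x\<bar> \<le> b n" "\<And>n x. 0 \<le> u n x"
    and u2: "\<And>n. (LINT x:{0..T}|lborel. (u n x)\<^sup>2) \<le> C"
    and speed: "\<And>n s t. 0 \<le> s \<Longrightarrow> s \<le> t \<Longrightarrow> t \<le> T \<Longrightarrow>
      sqrt (LINT \<omega>|\<rho>\<^sub>0. (dist (X n s \<omega>) (X n t \<omega>))\<^sup>2) \<le> (LINT x:{s..t}|lborel. u n x) + sqrt (C * (T / Suc n))"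
    and drift_meas: "\<And>n \<phi>. \<phi> \<in> C1c \<Longrightarrow> (\<lambda>x. mdrift (grad \<phi>) (distr \<rho>\<^sub>0 borel (X n x))) \<in> borel_measurable borel"
    and weak: "\<And>\<phi> \<eta>. \<phi> \<in> C1c \<Longrightarrow> \<eta> > 0 \<Longrightarrow> \<exists>D. \<forall>n. \<forall>t\<in>{0..T}. \<exists>t'. t \<le> t' \<and> t' \<le> T \<and> t' \<le> t + T / Suc n \<and>
      \<bar>(LINT \<omega>|\<rho>\<^sub>0. \<phi> (X n t \<omega>)) - (LINT \<omega>|\<rho>\<^sub>0. \<phi> (X n 0 \<omega>))
        + (1 - \<sigma>) * (LINT x:{0<..t'}|lborel. mdrift (grad \<phi>) (distr \<rho>\<^sub>0 borel (X n x)))\<bar> \<le> \<eta> * (C + T) + D * (T / Suc n)"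
    by (rule approximate_solutions[OF T \<rho>\<^sub>0]) blast
  define \<mu> where "\<mu> n t = distr \<rho>\<^sub>0 borel (X n t)" for n t
  have \<mu>: "prob_space (\<mu> n t)" "sets (\<mu> n t) = sets borel" for n t
    unfolding \<mu>_def using X by (auto intro: P.prob_space_distr)
  have \<mu>int: "(LINT x|\<mu> n t. f x) = (LINT \<omega>|\<rho>\<^sub>0. f (X n t \<omega>))" if "continuous_on UNIV f" for f :: "'a \<Rightarrow> real" and n t
    unfolding \<mu>_def using X borel_measurable_continuous_onI[OF that] by (subst integral_distr) auto
  have \<tau>_lim: "(\<lambda>n. T / Suc n) \<longlonglongrightarrow> 0"
    using tendsto_mult_right_zero[OF LIMSEQ_inverse_real_of_nat, of T] by (simp add: divide_inverse)
  have H: "(LINT \<omega>|\<rho>\<^sub>0. dist (X n s \<omega>) (X n t \<omega>)) \<le> sqrt (C * (\<bar>t - s\<bar> + T / Suc n))"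
    if st: "s \<in> {0..T}" "t \<in> {0..T}" for n s t
  proof -
    have *: "(LINT \<omega>|\<rho>\<^sub>0. dist (X n s \<omega>) (X n t \<omega>)) \<le> sqrt (C * (\<bar>t - s\<bar> + T / Suc n))"
      if "0 \<le> s" "s \<le> t" "t \<le> T" for s t
    proof (rule real_le_rsqrt)
      have "(LINT \<omega>|\<rho>\<^sub>0. dist (X n s \<omega>) (X n t \<omega>))\<^sup>2 \<le> (LINT \<omega>|\<rho>\<^sub>0. (dist (X n s \<omega>) (X n t \<omega>))\<^sup>2)"
        by (rule P.integral_square_le[OF int int_sq])
      also have "\<dots> \<le> C * (\<bar>t - s\<bar> + T / Suc n)" using holder[OF that, of n] that by simp
      finally show "(LINT \<omega>|\<rho>\<^sub>0. dist (X n s \<omega>) (X n t \<omega>))\<^sup>2 \<le> C * (\<bar>t - s\<bar> + T / Suc n)" .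
    qed
    show ?thesis
    proof (cases "s \<le> t")
      case True
      then show ?thesis using st by (intro *) auto
    next
      case False
      then show ?thesis using *[of t s] st by (simp add: dist_commute abs_minus_commute)
    qed
  qed
  obtain r \<rho>' where r: "strict_mono (r :: nat \<Rightarrow> nat)"
    and \<rho>'p: "\<And>t. t \<in> {0..T} \<Longrightarrow> prob_space (\<rho>' t)" and \<rho>'s: "\<And>t. t \<in> {0..T} \<Longrightarrow> sets (\<rho>' t) = sets borel"
    and \<rho>'w: "\<And>t. t \<in> {0..T} \<Longrightarrow> weak_lim (\<lambda>n. \<mu> (r n) t) (\<rho>' t)"
  proof (rule curve_compactness[OF prob T X mom int H C \<tau>_lim])
    fix r :: "nat \<Rightarrow> nat" and \<rho>' :: "real \<Rightarrow> 'a measure"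
    assume "strict_mono r" "\<And>t. t \<in> {0..T} \<Longrightarrow> prob_space (\<rho>' t)" "\<And>t. t \<in> {0..T} \<Longrightarrow> sets (\<rho>' t) = sets borel"
      "\<And>t. t \<in> {0..T} \<Longrightarrow> weak_lim (\<lambda>n. distr \<rho>\<^sub>0 borel (X (r n) t)) (\<rho>' t)"
    then show thesis by (intro that[of r \<rho>']) (simp_all add: \<mu>_def)
  qed
  define \<rho> where "\<rho> = \<rho>'"
  have \<rho>p: "prob_space (\<rho> t)" and \<rho>s: "sets (\<rho> t) = sets borel" and \<rho>w: "weak_lim (\<lambda>n. \<mu> (r n) t) (\<rho> t)"
    if "t \<in> {0..T}" for t
    using \<rho>'p \<rho>'s \<rho>'w that by (auto simp: \<rho>_def)
  have \<tau>r_lim: "(\<lambda>n. T / Suc (r n)) \<longlonglongrightarrow> 0"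
    using LIMSEQ_subseq_LIMSEQ[OF \<tau>_lim r] by (simp add: o_def)
  have \<mu>C: "(\<integral>\<^sup>+x. ennreal ((norm x)\<^sup>2) \<partial>\<mu> n t) \<le> ennreal C" if "t \<in> {0..T}" for n t
    unfolding \<mu>_def using mom[OF that] X by (subst nn_integral_distr) auto
  have \<rho>P2: "\<rho> t \<in> P2" if t: "t \<in> {0..T}" for t
  proof -
    have "(\<integral>\<^sup>+x. ennreal ((norm x)\<^sup>2) \<partial>\<rho> t) \<le> ennreal C"
      using C by (intro weak_lim_nn_integral_le[OF \<rho>w[OF t]] \<mu> \<rho>p \<rho>s t \<mu>C continuous_intros) auto
    also have "\<dots> < \<infinity>" by simp
    finally show ?thesis using \<rho>p[OF t] \<rho>s[OF t] by (simp add: P2_def)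
  qed
  have \<rho>0: "\<rho> 0 = \<rho>\<^sub>0"
  proof (rule weak_lim_unique)
    show "weak_lim (\<lambda>n. \<mu> (r n) 0) (\<rho> 0)" by (rule \<rho>w) (use T in simp)
    show "weak_lim (\<lambda>n. \<mu> (r n) 0) \<rho>\<^sub>0"
      unfolding weak_lim_def
    proof (intro allI impI)
      fix f :: "'a \<Rightarrow> real" assume f: "continuous_on UNIV f" "bounded (range f)"
      obtain M where M: "\<And>x. \<bar>f x\<bar> \<le> M" using f(2) by (auto simp: bounded_iff)
      have fm: "f \<in> borel_measurable borel" using f(1) by (rule borel_measurable_continuous_onI)
      have "(\<lambda>n. LINT \<omega>|\<rho>\<^sub>0. f (X (r n) 0 \<omega>)) \<longlonglongrightarrow> (LINT \<omega>|\<rho>\<^sub>0. f \<omega>)"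
      proof (rule integral_dominated_convergence[where w="\<lambda>_. M"])
        show "f \<in> borel_measurable \<rho>\<^sub>0" by (subst measurable_cong_sets[OF sets_\<rho> refl]) (rule fm)
        show "(\<lambda>\<omega>. f (X (r n) 0 \<omega>)) \<in> borel_measurable \<rho>\<^sub>0" for n
          by (rule measurable_compose[OF X fm])
        show "AE \<omega> in \<rho>\<^sub>0. (\<lambda>n. f (X (r n) 0 \<omega>)) \<longlonglongrightarrow> f \<omega>"
        proof (rule AE_I2)
          fix \<omega>
          have "(\<lambda>n. X (r n) 0 \<omega>) \<longlonglongrightarrow> \<omega>" using LIMSEQ_subseq_LIMSEQ[OF X0 r] by (simp add: o_def)
          moreover have "isCont f \<omega>" using f(1) by (simp add: continuous_on_eq_continuous_at)
          ultimately show "(\<lambda>n. f (X (r n) 0 \<omega>)) \<longlonglongrightarrow> f \<omega>" by (rule isCont_tendsto_compose[rotated])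
        qed
      qed (use M in auto)
      then show "(\<lambda>n. LINT x|\<mu> (r n) 0. f x) \<longlonglongrightarrow> (LINT x|\<rho>\<^sub>0. f x)" by (simp add: \<mu>int[OF f(1)])
    qed
  qed (use \<rho>p \<rho>s prob sets_\<rho> T in auto)
  have AC: "abs_cont_curve wasserstein2 P2 T \<rho>"
  proof -
    \<comment> \<open>Restricted to [0, T], Lebesgue measure is finite, as the limit of the discrete
      speeds requires.\<close>
    define M where "M = restrict_space lborel {0..T}"
    have Mint: "(LINT x|M. f x) = (LINT x:{0..T}|lborel. f x)" for f :: "real \<Rightarrow> real"
      unfolding M_def set_lebesgue_integral_def by (rule integral_restrict_space) simp
    interpret M: finite_measure M
      by standard (use T in \<open>simp add: M_def emeasure_restrict_space space_restrict_space\<close>)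
    have u': "u (r k) \<in> borel_measurable M" for k
      unfolding M_def by (rule measurable_restrict_space1) (use u(1) in simp)
    obtain m where m: "integrable M m"
      "\<And>A c. A \<in> sets M \<Longrightarrow> (\<forall>\<^sub>F k in sequentially. c \<le> (LINT x|M. indicator A x * u (r k) x)) \<Longrightarrow>
        c \<le> (LINT x|M. indicator A x * m x)"
    proof (rule M.bounded_L2_liminf[of "\<lambda>k. u (r k)" "\<lambda>k. b (r k)" C])
      show "(LINT x|M. (u (r k) x)\<^sup>2) \<le> C" for k unfolding Mint by (rule u2)
    qed (use u' u(2) in auto)
    have sub: "(LINT x|M. indicator {s..t} x * f x) = (LINT x:{s..t}|lborel. f x)"
      if "0 \<le> s" "t \<le> T" for s t and f :: "real \<Rightarrow> real"
      unfolding Mint set_lebesgue_integral_def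
      by (intro Bochner_Integration.integral_cong refl) (use that in \<open>auto simp: indicator_def\<close>)
    have "wasserstein2 (\<rho> s) (\<rho> t) \<le> (LINT x:{s..t}|lborel. m x)" if st: "0 \<le> s" "s \<le> t" "t \<le> T" for s t
    proof (rule ccontr)
      define a where "a = (LINT x:{s..t}|lborel. m x)"
      have s': "s \<in> {0..T}" and t': "t \<in> {0..T}" using st by auto
      have "{s..t} = {0..T} \<inter> {s..t}" using st by auto
      then have A: "{s..t} \<in> sets M"
        unfolding M_def sets_restrict_space by (metis image_eqI sets.Int atLeastAtMost_borel sets_lborel)
      have low: "c \<le> a" if "\<forall>\<^sub>F k in sequentially. c \<le> (LINT x:{s..t}|lborel. u (r k) x)" for c
        using m(2)[OF A, of c] that st by (simp add: sub a_def)
      have a0: "0 \<le> a"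
        by (rule low) (auto simp: set_lebesgue_integral_def u(3) intro!: always_eventually integral_nonneg_AE)
      assume "\<not> wasserstein2 (\<rho> s) (\<rho> t) \<le> (LINT x:{s..t}|lborel. m x)"
      then have "a < wasserstein2 (\<rho> s) (\<rho> t)" by (simp add: a_def)
      then obtain c where c: "a < c" "c < wasserstein2 (\<rho> s) (\<rho> t)" using dense by blast
      define E where "E n = (LINT \<omega>|\<rho>\<^sub>0. (dist (X (r n) s \<omega>) (X (r n) t \<omega>))\<^sup>2)" for n
      \<comment> \<open>Otherwise infinitely many of the natural couplings would cost at most
        \<open>c^2\<close>, and a limit of them would bound the distance by
        \<open>c\<close>.\<close>
      have "\<forall>\<^sub>F n in sequentially. c < sqrt (E n)"
      proof (rule ccontr)
        assume "\<not> (\<forall>\<^sub>F n in sequentially. c < sqrt (E n))"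
        then have "infinite {n. \<not> c < sqrt (E n)}"
          by (simp add: not_eventually cofinite_eq_sequentially[symmetric] INFM_iff_infinite)
        then obtain q :: "nat \<Rightarrow> nat" where q: "strict_mono q" "\<And>n. \<not> c < sqrt (E (q n))"
          using infinite_enumerate[of "{n. \<not> c < sqrt (E n)}"] by auto
        have "wasserstein2 (\<rho> s) (\<rho> t) \<le> c"
        proof (rule wasserstein2_weak_lim_le[where X="\<lambda>n. X (r (q n)) s" and Z="\<lambda>n. X (r (q n)) t" and C=C, OF prob])
          show "weak_lim (\<lambda>k. distr \<rho>\<^sub>0 borel (X (r (q k)) s)) (\<rho> s)"
            using weak_lim_subseq[OF \<rho>w[OF s'] q(1)] by (simp add: o_def \<mu>_def)
          show "weak_lim (\<lambda>k. distr \<rho>\<^sub>0 borel (X (r (q k)) t)) (\<rho> t)"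
            using weak_lim_subseq[OF \<rho>w[OF t'] q(1)] by (simp add: o_def \<mu>_def)
          show "0 \<le> c" using a0 c by simp
          show "(\<integral>\<^sup>+\<omega>. ennreal ((dist (X (r (q k)) s \<omega>) (X (r (q k)) t \<omega>))\<^sup>2) \<partial>\<rho>\<^sub>0) \<le> ennreal (c\<^sup>2)" for k
          proof -
            have "E (q k) \<ge> 0" unfolding E_def by (intro integral_nonneg_AE) auto
            then have "E (q k) \<le> c\<^sup>2"
              using q(2)[of k] a0 c by (metis less_eq_real_def not_le real_sqrt_le_iff real_sqrt_unique sqrt_le_D)
            moreover have "(\<integral>\<^sup>+\<omega>. ennreal ((dist (X (r (q k)) s \<omega>) (X (r (q k)) t \<omega>))\<^sup>2) \<partial>\<rho>\<^sub>0) = ennreal (E (q k))"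
              unfolding E_def using int_sq by (intro nn_integral_eq_integral) auto
            ultimately show ?thesis by (simp add: ennreal_leI)
          qed
        qed (use X mom s' t' \<rho>p \<rho>s in auto)
        then show False using c by simp
      qed
      \<comment> \<open>A level strictly between \<open>a\<close> and \<open>c\<close>: the gap
        \<open>c - c'\<close> absorbs the length of the last step, which tends to 0.\<close>
      define c' where "c' = (a + c) / 2"
      have c': "a < c'" "c' < c" using c by (auto simp: c'_def)
      have "(\<lambda>n. sqrt (C * (T / Suc (r n)))) \<longlonglongrightarrow> sqrt (C * 0)"
        by (intro tendsto_intros \<tau>r_lim)
      then have "\<forall>\<^sub>F n in sequentially. sqrt (C * (T / Suc (r n))) < c - c'"
        by (rule order_tendstoD(2)) (use c' in simp)
      with \<open>\<forall>\<^sub>F n in sequentially. c < sqrt (E n)\<close>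
      have "\<forall>\<^sub>F n in sequentially. c' \<le> (LINT x:{s..t}|lborel. u (r n) x)"
      proof eventually_elim
        case (elim n)
        then show ?case using speed[OF st, of "r n"] unfolding E_def by linarith
      qed
      then have "c' \<le> a" by (rule low)
      then show False using c' by simp
    qed
    moreover have "set_integrable lborel {0..T} m"
      using m(1) unfolding M_def set_integrable_def by (subst (asm) integrable_restrict_space) auto
    ultimately show ?thesis
      unfolding abs_cont_curve_def using \<rho>P2 by blast
  qed
  have WF: "(LINT x|\<rho> t. \<phi> x) - (LINT x|\<rho> 0. \<phi> x) = - (1 - \<sigma>) * (LINT s:{0..t}|lborel. mdrift (grad \<phi>) (\<rho> s))"
    if \<phi>: "\<phi> \<in> C1c" and t: "t \<in> {0..T}" for \<phi> t
  proof -
    obtain R where dg: "\<And>x. GDERIV \<phi> x :> grad \<phi> x" and cg: "continuous_on UNIV (grad \<phi>)"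
      and \<phi>R: "\<And>x. norm x > R \<Longrightarrow> \<phi> x = 0" and gR: "\<And>x. norm x > R \<Longrightarrow> grad \<phi> x = 0"
      by (rule C1c_taylor[OF \<phi>]) blast
    have c\<phi>: "continuous_on UNIV \<phi>"
      using has_derivative_continuous[OF dg[unfolded gderiv_def]]
      by (intro continuous_at_imp_continuous_on ballI)
    obtain M where M: "\<And>x. norm (\<phi> x) \<le> M" using continuous_compact_support_bounded[OF c\<phi> \<phi>R] by blast
    obtain B where B: "\<And>\<mu>. prob_space \<mu> \<Longrightarrow> sets \<mu> = sets borel \<Longrightarrow> \<bar>mdrift (grad \<phi>) \<mu>\<bar> \<le> B"
      using mdrift_bounded[OF cg gR] by blast
    define \<Lambda> where "\<Lambda> n x = mdrift (grad \<phi>) (\<mu> (r n) x)" for n x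
    \<comment> \<open>Left-open as in the discrete integrals; the single point 0 is restored
      afterwards and does not change the integral.\<close>
    define L where "L x = indicator {0<..t} x * mdrift (grad \<phi>) (\<rho> x)" for x :: real
    have \<Lambda>_meas: "\<Lambda> n \<in> borel_measurable borel" for n
      unfolding \<Lambda>_def \<mu>_def by (rule drift_meas[OF \<phi>])
    have \<Lambda>B: "\<bar>\<Lambda> n x\<bar> \<le> B" for n x unfolding \<Lambda>_def by (rule B[OF \<mu>])
    have \<Lambda>lim: "(\<lambda>n. \<Lambda> n x) \<longlonglongrightarrow> mdrift (grad \<phi>) (\<rho> x)" if "x \<in> {0..T}" for x
      unfolding \<Lambda>_def by (rule mdrift_tendsto[OF cg gR \<mu> \<rho>p[OF that] \<rho>s[OF that] \<rho>w[OF that]])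
    \<comment> \<open>The end points \<open>t' n\<close> exceed \<open>t\<close> by at most one time
      step, so the indicators converge at every time. Measurability of \<open>L\<close> is obtained
      from its being a pointwise limit.\<close>
    have lim_int: "integrable lborel L \<and> (\<lambda>n. LINT x:{0<..t' n}|lborel. \<Lambda> n x) \<longlonglongrightarrow> (LINT x|lborel. L x)"
      if t': "\<And>n. t \<le> t' n" "\<And>n. t' n \<le> T" "\<And>n. t' n \<le> t + T / Suc (r n)" for t'
    proof -
      have ind: "(\<lambda>n. indicator {0<..t' n} x * \<Lambda> n x) \<longlonglongrightarrow> L x" for x
      proof (cases "x \<in> {0<..t}")
        case True
        then have "x \<in> {0<..t' n}" for n using t'(1)[of n] by auto
        moreover have "x \<in> {0..T}" using True t by auto
        ultimately show ?thesis using \<Lambda>lim[of x] True by (simp add: L_def)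
      next
        case False
        have "\<forall>\<^sub>F n in sequentially. x \<notin> {0<..t' n}"
        proof (cases "x \<le> 0")
          case nx: False
          then have "x - t > 0" using False by auto
          then have "\<forall>\<^sub>F n in sequentially. T / Suc (r n) < x - t" by (rule order_tendstoD(2)[OF \<tau>r_lim])
          then show ?thesis
          proof eventually_elim
            case (elim n)
            then show ?case using t'(3)[of n] by simp
          qed
        qed simp
        then have "\<forall>\<^sub>F n in sequentially. indicator {0<..t' n} x * \<Lambda> n x = L x"
          by eventually_elim (use False in \<open>simp add: L_def\<close>)
        then show ?thesis by (rule tendsto_eventually)
      qed
      have meas: "(\<lambda>x. indicator {0<..t' n} x * \<Lambda> n x) \<in> borel_measurable borel" for n
        using \<Lambda>_meas[of n] by measurable
      have L_meas: "L \<in> borel_measurable borel"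
        by (rule borel_measurable_LIMSEQ_real[OF ind meas])
      have dom: "integrable lborel (\<lambda>x::real. B * indicator {0..T} x)"
        by (intro integrable_mult_right integrable_real_indicator) (use T in auto)
      have bd: "\<bar>indicator {0<..t' n} x * \<Lambda> n x\<bar> \<le> B * indicator {0..T} x" for n x
        using \<Lambda>B[of n x] t'(2)[of n] by (auto simp: indicator_def abs_mult)
      have "integrable lborel L"
        by (rule integrable_dominated_convergence[where w="\<lambda>x. B * indicator {0..T} x" and s="\<lambda>n x. indicator {0<..t' n} x * \<Lambda> n x"])
          (use L_meas meas dom ind bd in auto)
      moreover have "(\<lambda>n. LINT x|lborel. indicator {0<..t' n} x * \<Lambda> n x) \<longlonglongrightarrow> (LINT x|lborel. L x)"
        by (rule integral_dominated_convergence[where w="\<lambda>x. B * indicator {0..T} x"])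
          (use L_meas meas dom ind bd in auto)
      ultimately show ?thesis by (simp add: set_lebesgue_integral_def)
    qed
    have intL: "integrable lborel L" using lim_int[of "\<lambda>_. t"] t T by simp
    have L_eq: "(LINT s:{0..t}|lborel. mdrift (grad \<phi>) (\<rho> s)) = (LINT x|lborel. L x)"
    proof -
      have "(LINT s:{0..t}|lborel. mdrift (grad \<phi>) (\<rho> s)) = (LINT x|lborel. L x + indicator {0} x * mdrift (grad \<phi>) (\<rho> 0))"
        unfolding set_lebesgue_integral_def L_def
        by (intro Bochner_Integration.integral_cong refl) (use t in \<open>auto simp: indicator_def\<close>)
      also have "\<dots> = (LINT x|lborel. L x) + (LINT x|lborel. indicator {0::real} x * mdrift (grad \<phi>) (\<rho> 0))"
        by (intro Bochner_Integration.integral_add intL integrable_mult_left integrable_real_indicator) auto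
      finally show ?thesis by simp
    qed
    define a where "a = (LINT x|\<rho> t. \<phi> x) - (LINT x|\<rho> 0. \<phi> x)"
    have a_lim: "(\<lambda>n. (LINT \<omega>|\<rho>\<^sub>0. \<phi> (X (r n) t \<omega>)) - (LINT \<omega>|\<rho>\<^sub>0. \<phi> (X (r n) 0 \<omega>))) \<longlonglongrightarrow> a"
      unfolding a_def \<mu>int[OF c\<phi>, symmetric]
      using M t T by (intro tendsto_diff weak_limD[OF \<rho>w c\<phi>, of _ M]) auto
    \<comment> \<open>\<open>\<eta>\<close> stays fixed while the time step tends to 0, so the term
      with \<open>D\<close>, which depends on \<open>\<eta>\<close>, is gone before
      \<open>\<eta>\<close> becomes small.\<close>
    have "\<bar>a + (1 - \<sigma>) * (LINT x|lborel. L x)\<bar> \<le> \<eta> * (C + T)" if \<eta>: "\<eta> > 0" for \<eta>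
    proof -
      obtain D where D: "\<And>n t. t \<in> {0..T} \<Longrightarrow> \<exists>t'. t \<le> t' \<and> t' \<le> T \<and> t' \<le> t + T / Suc n \<and>
        \<bar>(LINT \<omega>|\<rho>\<^sub>0. \<phi> (X n t \<omega>)) - (LINT \<omega>|\<rho>\<^sub>0. \<phi> (X n 0 \<omega>))
        + (1 - \<sigma>) * (LINT x:{0<..t'}|lborel. mdrift (grad \<phi>) (distr \<rho>\<^sub>0 borel (X n x)))\<bar> \<le> \<eta> * (C + T) + D * (T / Suc n)"
        using weak[OF \<phi> \<eta>] by blast
      have "\<exists>t'. t \<le> t' \<and> t' \<le> T \<and> t' \<le> t + T / Suc (r n) \<and>
        \<bar>(LINT \<omega>|\<rho>\<^sub>0. \<phi> (X (r n) t \<omega>)) - (LINT \<omega>|\<rho>\<^sub>0. \<phi> (X (r n) 0 \<omega>))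
        + (1 - \<sigma>) * (LINT x:{0<..t'}|lborel. \<Lambda> n x)\<bar> \<le> \<eta> * (C + T) + D * (T / Suc (r n))" for n
        using D[OF t, of "r n"] by (simp only: \<Lambda>_def \<mu>_def)
      then obtain t' where t': "\<And>n. t \<le> t' n" "\<And>n. t' n \<le> T" "\<And>n. t' n \<le> t + T / Suc (r n)"
        and est: "\<And>n. \<bar>(LINT \<omega>|\<rho>\<^sub>0. \<phi> (X (r n) t \<omega>)) - (LINT \<omega>|\<rho>\<^sub>0. \<phi> (X (r n) 0 \<omega>))
        + (1 - \<sigma>) * (LINT x:{0<..t' n}|lborel. \<Lambda> n x)\<bar> \<le> \<eta> * (C + T) + D * (T / Suc (r n))"
        by metis
      have int_lim: "(\<lambda>n. LINT x:{0<..t' n}|lborel. \<Lambda> n x) \<longlonglongrightarrow> (LINT x|lborel. L x)"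
        using lim_int[OF t'] by blast
      have l1: "(\<lambda>n. \<bar>(LINT \<omega>|\<rho>\<^sub>0. \<phi> (X (r n) t \<omega>)) - (LINT \<omega>|\<rho>\<^sub>0. \<phi> (X (r n) 0 \<omega>))
        + (1 - \<sigma>) * (LINT x:{0<..t' n}|lborel. \<Lambda> n x)\<bar>) \<longlonglongrightarrow> \<bar>a + (1 - \<sigma>) * (LINT x|lborel. L x)\<bar>"
        by (intro tendsto_rabs tendsto_add[OF a_lim] tendsto_mult_left int_lim)
      have l2: "(\<lambda>n. \<eta> * (C + T) + D * (T / Suc (r n))) \<longlonglongrightarrow> \<eta> * (C + T) + D * 0"
        by (intro tendsto_add tendsto_const tendsto_mult_left \<tau>r_lim)
      show ?thesis using LIMSEQ_le[OF l1 l2] est by auto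
    qed
    then have bound: "\<bar>a + (1 - \<sigma>) * (LINT x|lborel. L x)\<bar> \<le> \<eta> * (C + T)" if "\<eta> > 0" for \<eta>
      using that by blast
    have CT: "C + T > 0" using C T by simp
    have "\<bar>a + (1 - \<sigma>) * (LINT x|lborel. L x)\<bar> \<le> 0"
    proof (rule field_le_epsilon)
      fix e :: real assume "e > 0"
      then show "\<bar>a + (1 - \<sigma>) * (LINT x|lborel. L x)\<bar> \<le> 0 + e"
        using bound[of "e / (C + T)"] CT by simp
    qed
    then have "a + (1 - \<sigma>) * (LINT x|lborel. L x) = 0" by simp
    then have "a = - (1 - \<sigma>) * (LINT x|lborel. L x)" by (simp only: mult_minus_left eq_neg_iff_add_eq_0)
    then show ?thesis by (simp only: a_def L_eq)
  qed
  show ?thesis by (rule that[OF AC \<rho>0 WF])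
qed

end

section \<open>Specialization to the rescaled kernel and the two reference densities\<close>

theorem theorem3p1:
  fixes T \<epsilon> \<sigma> :: real
    and V\<^sub>1 N :: "'a::euclidean_space \<Rightarrow> real"
    and \<rho>\<^sub>0 :: "'a measure"
  assumes "T > 0" and "\<epsilon> > 0" and "0 < \<sigma>" and "\<sigma> < 1"
    and "V1_cond V\<^sub>1" and "supp V\<^sub>1 \<subseteq> cball 0 1"
    and "N = Nref 1 \<or> N = Nref 2"
    and "\<rho>\<^sub>0 \<in> P2"
    and "entropy_functional V\<^sub>1 N \<sigma> \<epsilon> \<rho>\<^sub>0 < \<infinity>"
  shows "\<exists>\<rho> :: real \<Rightarrow> 'a measure.
    weak_measure_solution V\<^sub>1 N \<sigma> \<epsilon> T \<rho> \<and> \<rho> 0 = \<rho>\<^sub>0"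
proof -
  obtain g where g: "\<And>x. GDERIV V\<^sub>1 x :> g x" "continuous_on UNIV g"
    using assms(5) by (auto simp: V1_cond_def C1_def)
  have V: "\<And>x. V\<^sub>1 x \<ge> 0" "\<And>x. V\<^sub>1 x = V\<^sub>1 (- x)" "V\<^sub>1 \<in> bcontfun"
    using assms(5) by (auto simp: V1_cond_def)
  obtain K where K: "\<And>x. \<bar>V\<^sub>1 x\<bar> \<le> K" using V(3) by (auto simp: bcontfun_def bounded_iff)
  have V0: "V\<^sub>1 x = 0" if "norm x > 1" for x
    using assms(6) that closure_subset[of "{x. V\<^sub>1 x \<noteq> 0}"] by (auto simp: supp_def subset_iff)
  obtain B where N: "continuous_on UNIV N" "\<And>x. N x > 0" "\<And>x. N x \<le> B"
    using Nref_properties[OF assms(7)] by blast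
  define c where "c = (1 / \<epsilon>) ^ DIM('a)"
  have c: "c > 0" using \<open>\<epsilon> > 0\<close> by (simp add: c_def)
  define W where "W = rescale \<epsilon> V\<^sub>1"
  define gW where "gW x = (c / \<epsilon>) *\<^sub>R g (x /\<^sub>R \<epsilon>)" for x
  have W: "W x = c * V\<^sub>1 (x /\<^sub>R \<epsilon>)" for x by (simp add: W_def rescale_def c_def)
  have dW: "GDERIV W x :> gW x" for x
    unfolding W_def gW_def c_def by (rule rescale_GDERIV[OF g(1)])
  \<comment> \<open>The supremum bound is multiplied by \<open>c\<close>, and the support in the
    unit ball becomes the ball of radius \<open>\<epsilon>\<close>.\<close>
  interpret mollified_entropy W gW N \<epsilon> \<sigma> "c * K" B
  proof
    show "W x \<ge> 0" for x using c V(1) by (simp add: W)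
    show "W x \<le> c * K" for x unfolding W using c K[of "x /\<^sub>R \<epsilon>"] by (intro mult_left_mono) auto
    show "W x = 0" if "norm x > \<epsilon>" for x
      unfolding W using that \<open>\<epsilon> > 0\<close> by (subst V0) (auto simp: field_simps)
    show "continuous_on UNIV gW"
      unfolding gW_def by (intro continuous_intros continuous_on_compose2[OF g(2)]) (use \<open>\<epsilon> > 0\<close> in auto)
    show "gW (- x) = - gW x" for x
      using GDERIV_even_odd[OF g(1) V(2), of "x /\<^sub>R \<epsilon>"] by (simp add: gW_def)
  qed (use assms dW N in auto)
  \<comment> \<open>\<open>grad\<close> is a definite description, so its identification with
    \<open>gW\<close> rests on uniqueness of gradients.\<close>
  have gradW: "grad (rescale \<epsilon> V\<^sub>1) = gW" unfolding W_def[symmetric] by (rule grad_eq[OF dW])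
  have mix: "mixture V\<^sub>1 N \<sigma> \<epsilon> \<mu> = mixm \<mu>" for \<mu>
    unfolding fun_eq_iff by (simp only: mixture_def mixm_def W_def[symmetric] simp_thms)
  obtain \<rho> where AC: "abs_cont_curve wasserstein2 P2 T \<rho>" and \<rho>0: "\<rho> 0 = \<rho>\<^sub>0"
    and WF: "\<And>\<phi> t. \<phi> \<in> C1c \<Longrightarrow> t \<in> {0..T} \<Longrightarrow>
      (LINT x|\<rho> t. \<phi> x) - (LINT x|\<rho> 0. \<phi> x) = - (1 - \<sigma>) * (LINT s:{0..t}|lborel. mdrift (grad \<phi>) (\<rho> s))"
    using weak_solution_exists[OF \<open>T > 0\<close> assms(8)] by blast
  have "weak_measure_solution V\<^sub>1 N \<sigma> \<epsilon> T \<rho>"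
    unfolding weak_measure_solution_def gradW mix
  proof (intro conjI ballI AC)
    fix \<phi> :: "'a \<Rightarrow> real" and t assume \<phi>: "\<phi> \<in> C1c" and t: "t \<in> {0..T}"
    obtain R where cg: "continuous_on UNIV (grad \<phi>)" and gR: "\<And>x. norm x > R \<Longrightarrow> grad \<phi> x = 0"
      by (rule C1c_taylor[OF \<phi>]) blast
    \<comment> \<open>The Fubini form is stated for probability measures, and membership in
      \<open>P2\<close> along the curve is known on [0, T]; the comparison therefore stays inside
      the set integral.\<close>
    have "(LINT s:{0..t}|lborel. (LINT x|\<rho> s. grad \<phi> x \<bullet> conv_vec gW (\<lambda>y. ln (mixm (\<rho> s) y)) x))
        = (LINT s:{0..t}|lborel. mdrift (grad \<phi>) (\<rho> s))"
    proof (rule set_lebesgue_integral_cong)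
      show "\<forall>s. s \<in> {0..t} \<longrightarrow> (LINT x|\<rho> s. grad \<phi> x \<bullet> conv_vec gW (\<lambda>y. ln (mixm (\<rho> s) y)) x) = mdrift (grad \<phi>) (\<rho> s)"
      proof (intro allI impI)
        fix s assume "s \<in> {0..t}"
        then have "\<rho> s \<in> P2" using AC t by (auto simp: abs_cont_curve_def)
        then have "prob_space (\<rho> s)" "sets (\<rho> s) = sets borel" by (auto simp: P2_def)
        then show "(LINT x|\<rho> s. grad \<phi> x \<bullet> conv_vec gW (\<lambda>y. ln (mixm (\<rho> s) y)) x) = mdrift (grad \<phi>) (\<rho> s)"
          using mdrift_eq_conv_vec[of "grad \<phi>" R "\<rho> s", OF cg gR] by blast
      qed
    qed simp
    then show "(LINT x|\<rho> t. \<phi> x) - (LINT x|\<rho> 0. \<phi> x) = - (1 - \<sigma>) *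
        (LINT s:{0..t}|lborel. (LINT x|\<rho> s. grad \<phi> x \<bullet> conv_vec gW (\<lambda>y. ln (mixm (\<rho> s) y)) x))"
      using WF[OF \<phi> t] by (simp only:)
  qed
  then show ?thesis using \<rho>0 by blast
qed

end
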